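(* Let $\varepsilon>0$ and let $\delta^\varepsilon:\mathbb{R}^n\to\mathbb{R}$ be a continuous function with $\operatorname{supp}\delta^\varepsilon\subset B(0,K\varepsilon)$, where $K>0$. Suppose that $F\in C^1(\Theta)^n$. Then, for $1\le p<\frac{n}{n-1}$, we have $$\|f-f^{\varepsilon,\zeta}\|_{W^{-1,p}}\le C\left[\left|1-\int_{\mathbb{R}^n}\delta^\varepsilon(y)\,dy\right|+\|\rho\,\delta^\varepsilon\|_{L^p(\mathbb{R}^n)}+\zeta+\zeta^{1-n+\frac np}\right],$$ where $\rho(x)=x$ and $C$ denotes a positive constant depending only on $n$, $p$, $\|J_X\|_{L^\infty(\Theta)}$, $|F|_{W^{1,\infty}(\Theta)}$ and $|X|_{W^{1,\infty}(\Theta)^n}$.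
   Context: Geometry. $\Omega\subset\mathbb{R}^n$, $n\in\{2,3\}$, is a polyhedral domain with boundary $\partial\Omega$. It is divided into two disjoint components $\Omega_0,\Omega_1$ by a simple closed curve ($n=2$) or surface ($n=3$) $\Gamma$, called the immersed boundary, parametrized as $\Gamma=\{X(\theta)=(X_1(\theta),\dots,X_n(\theta)) : \theta\in\Theta\}$, where $\Theta=(c_1,d_1)$ if $n=2$ and $\Theta=(c_1,d_1)\times(c_2,d_2)$ if $n=3$, with $c_l<d_l$. Define $J_X=\sqrt{\left|\frac{\partial X_1}{\partial\theta}\right|^2+\left|\frac{\partial X_2}{\partial\theta}\right|^2}$ if $n=2$, and $J_X=\sqrt{\left|\frac{\partial(X_2,X_3)}{\partial(\theta_1,\theta_2)}\right|^2+\left|\frac{\partial(X_3,X_1)}{\partial(\theta_1,\theta_2)}\right|^2+\left|\frac{\partial(X_1,X_2)}{\partial(\theta_1,\theta_2)}\right|^2}$ if $n=3$. Standing assumptions: $\Gamma$ is a $C^1$ boundary ($X$ is a $C^1$ function); $\operatorname{dist}(\Gamma,\partial\Omega)>0$; $J_X(\theta)\ne0$ for $\theta\in\Theta$. Notation. $p'$ is the conjugate exponent of $p$, $\frac1p+\frac1{p'}=1$. $W^{1,s}_0(\Omega)=\{v\in W^{1,s}(\Omega): v|_{\partial\Omega}=0\}$; $W^{-1,p}(\Omega)^n$ is the topological dual of $W^{1,p'}_0(\Omega)^n$, with dual norm $\|\cdot\|_{W^{-1,p}}$. $|\cdot|_{W^{1,\infty}(\Theta)}$ denotes the seminorm in $W^{1,\infty}(\Theta)$.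 $B(a,r)=\{x\in\mathbb{R}^n:|x-a|<r\}$. Thus $\|\rho\delta^\varepsilon\|_{L^p(\mathbb{R}^n)}=\left(\int_{\mathbb{R}^n}|y|^p|\delta^\varepsilon(y)|^p\,dy\right)^{1/p}$. Immersed boundary force. $f\in W^{-1,p}(\Omega)^n$ is the extension by continuity of the functional $\langle f,\varphi\rangle=\int_\Theta F(\theta)\cdot\varphi(X(\theta))\,d\theta$, $\varphi\in C_0^\infty(\Omega)^n$ (formally, $f=\int_\Theta F(\theta)\,\delta(\cdot-X(\theta))\,d\theta$ with $\delta$ the Dirac delta). Numerical integration. For $n=2$: let $c_1=\theta_0<\theta_1<\dots<\theta_M=d_1$, $\theta_{-1/2}=\theta_0$, $\theta_{i-1/2}=(\theta_i+\theta_{i-1})/2$ for $1\le i\le M$, $\theta_{M+1/2}=\theta_M$, $\zeta_i=\theta_{i+1/2}-\theta_{i-1/2}$ for $0\le i\le M$, and $\zeta=\max_{0\le i\le M}\zeta_i$. Let $\hat F^\zeta,\hat X^\zeta$ be the piecewise constant functions with $\hat F^\zeta(\theta)=F(\theta_i)$, $\hat X^\zeta(\theta)=X(\theta_i)$ for $\theta_{i-1/2}<\theta\le\theta_{i+1/2}$, $0\le i\le M$ (values at the endpoints $c_1,d_1$ being those of the continuous extensions). For $n=3$: take a suitable partition of $\Theta$ with size parameter $\zeta>0$, and let $\hat F^\zeta,\hat X^\zeta$ be piecewise constant interpolations of $F,X$. In both cases $\|F-\hat F^\zeta\|_{L^\infty(\Theta)}\le C'\zeta|F|_{W^{1,\infty}(\Theta)}$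 and $\|X-\hat X^\zeta\|_{L^\infty(\Theta)^n}\le C'\zeta|X|_{W^{1,\infty}(\Theta)^n}$ with a constant $C'$ (for $n=3$ this is the only assumption on the partition). Define $$f^{\varepsilon,\zeta}(x)=\int_\Theta\hat F^\zeta(\theta)\,\delta^\varepsilon(x-\hat X^\zeta(\theta))\,d\theta,$$ identified with the functional $\varphi\mapsto\int_\Omega f^{\varepsilon,\zeta}\cdot\varphi\,dx$. For $n=2$ this is $f^{\varepsilon,\zeta}(x)=\sum_{i=0}^MF(\theta_i)\,\delta^\varepsilon(x-X(\theta_i))\,\zeta_i$.
   Formalization: C may also depend on |Θ|, ‖F‖_{L^∞(Θ)} and, for n=3, on C'; F and X are taken in W^{1,∞}(Θ). As stated the claim fails: for F=λe₁ constant and δ^ε=0 the right side is independent of λ, the left side is proportional to λ; growing circles show that |Θ| is needed. *)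

theory Defs
  imports "HOL-Analysis.Analysis" "HOL-Probability.Essential_Supremum"
begin

section \<open>Lebesgue and Sobolev spaces\<close>

text \<open>Exponents are extended reals in \<open>[1, \<infinity>]\<close>. Elements of the function spaces are represented by
  functions, not by classes modulo null sets. Vector-valued functions are treated directly: with
  values in \<open>real^'n\<close>, the spaces are the \<open>n\<close>-fold products of the scalar ones. All domains \<open>S\<close> are
  open sets. The norms are real-valued and meaningful only on the corresponding space.\<close>

definition Lp_space ::
  "ennreal \<Rightarrow> 'a::euclidean_space set \<Rightarrow> ('a \<Rightarrow> 'b::euclidean_space) set" where
  "Lp_space s S = {u. u \<in> borel_measurable (lebesgue_on S) \<and>
     (if s = \<infinity> then \<exists>c. AE x in lebesgue_on S. norm (u x) \<le> c
      else integrable (lebesgue_on S) (\<lambda>x. norm (u x) powr enn2real s))}"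

definition Lp_norm ::
  "ennreal \<Rightarrow> 'a::euclidean_space set \<Rightarrow> ('a \<Rightarrow> 'b::euclidean_space) \<Rightarrow> real" where
  "Lp_norm s S u =
     (if s = \<infinity> then enn2real (esssup (lebesgue_on S) (\<lambda>x. ennreal (norm (u x))))
      else (\<integral>x. norm (u x) powr enn2real s \<partial>lebesgue_on S) powr (1 / enn2real s))"

definition dir_deriv ::
  "'a::euclidean_space \<Rightarrow> ('a \<Rightarrow> 'b::euclidean_space) \<Rightarrow> 'a \<Rightarrow> 'b" where
  "dir_deriv b u x = frechet_derivative u (at x) b"

primrec Ck_on ::
  "nat \<Rightarrow> 'a::euclidean_space set \<Rightarrow> ('a \<Rightarrow> 'b::euclidean_space) \<Rightarrow> bool" where
  "Ck_on 0 S u \<longleftrightarrow> continuous_on S u"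
| "Ck_on (Suc k) S u \<longleftrightarrow>
     (\<forall>x\<in>S. u differentiable (at x)) \<and> (\<forall>b\<in>Basis. Ck_on k S (dir_deriv b u))"

definition test_functions ::
  "'a::euclidean_space set \<Rightarrow> ('a \<Rightarrow> 'b::euclidean_space) set" where
  "test_functions S = {\<phi>. (\<forall>k. Ck_on k UNIV \<phi>) \<and>
     compact (closure {x. \<phi> x \<noteq> 0}) \<and> closure {x. \<phi> x \<noteq> 0} \<subseteq> S}"

definition locally_integrable ::
  "'a::euclidean_space set \<Rightarrow> ('a \<Rightarrow> 'b::euclidean_space) \<Rightarrow> bool" where
  "locally_integrable S u \<longleftrightarrow> (\<forall>K. compact K \<and> K \<subseteq> S \<longrightarrow> integrable (lebesgue_on K) u)"

definition has_weak_deriv ::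
  "'a::euclidean_space set \<Rightarrow> 'a \<Rightarrow> ('a \<Rightarrow> 'b::euclidean_space) \<Rightarrow> ('a \<Rightarrow> 'b) \<Rightarrow> bool" where
  "has_weak_deriv S b u v \<longleftrightarrow> locally_integrable S u \<and> locally_integrable S v \<and>
     (\<forall>\<psi> \<in> (test_functions S :: ('a \<Rightarrow> real) set).
        (\<integral>x. dir_deriv b \<psi> x *\<^sub>R u x \<partial>lebesgue_on S) = - (\<integral>x. \<psi> x *\<^sub>R v x \<partial>lebesgue_on S))"

text \<open>The weak derivative is unique up to null sets.\<close>

definition weak_deriv ::
  "'a::euclidean_space set \<Rightarrow> 'a \<Rightarrow> ('a \<Rightarrow> 'b::euclidean_space) \<Rightarrow> ('a \<Rightarrow> 'b)" where
  "weak_deriv S b u = (SOME v. has_weak_deriv S b u v)"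

definition W1 ::
  "ennreal \<Rightarrow> 'a::euclidean_space set \<Rightarrow> ('a \<Rightarrow> 'b::euclidean_space) set" where
  "W1 s S = {u. u \<in> Lp_space s S \<and> (\<forall>b\<in>Basis. \<exists>v \<in> Lp_space s S. has_weak_deriv S b u v)}"

definition W1_seminorm ::
  "ennreal \<Rightarrow> 'a::euclidean_space set \<Rightarrow> ('a \<Rightarrow> 'b::euclidean_space) \<Rightarrow> real" where
  "W1_seminorm s S u = (\<Sum>b\<in>Basis. Lp_norm s S (weak_deriv S b u))"

definition W1_norm ::
  "ennreal \<Rightarrow> 'a::euclidean_space set \<Rightarrow> ('a \<Rightarrow> 'b::euclidean_space) \<Rightarrow> real" where
  "W1_norm s S u = Lp_norm s S u + W1_seminorm s S u"

text \<open>Zero boundary values. This is meant for \<open>s > n\<close>, where elements of \<open>W\<^sup>1\<^sup>,\<^sup>s\<close> have continuous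
  representatives, so that the trace is the restriction of the continuous representative. For
  \<open>s = \<infinity>\<close> the space is strictly larger than the norm closure of the test functions.\<close>

definition W1_0 ::
  "ennreal \<Rightarrow> 'a::euclidean_space set \<Rightarrow> ('a \<Rightarrow> 'b::euclidean_space) set" where
  "W1_0 s S = {v \<in> W1 s S. \<exists>u. continuous_on (closure S) u \<and> (\<forall>x \<in> frontier S. u x = 0) \<and>
     (AE x in lebesgue_on S. v x = u x)}"

text \<open>With \<open>1/p + 1/s = 1\<close>, the dual of \<open>W1_0 s S\<close> is \<open>W\<^sup>-\<^sup>1\<^sup>,\<^sup>p\<close>. A bounded functional takes the same
  value on functions that agree almost everywhere. Values outside \<open>W1_0 s S\<close> are irrelevant.\<close>

definition W1_dual ::
  "ennreal \<Rightarrow> 'a::euclidean_space set \<Rightarrow> (('a \<Rightarrow> 'b::euclidean_space) \<Rightarrow> real) set" where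
  "W1_dual s S = {g.
     (\<forall>\<phi> \<in> W1_0 s S. \<forall>\<psi> \<in> W1_0 s S. g (\<lambda>x. \<phi> x + \<psi> x) = g \<phi> + g \<psi>) \<and>
     (\<forall>a. \<forall>\<phi> \<in> W1_0 s S. g (\<lambda>x. a *\<^sub>R \<phi> x) = a * g \<phi>) \<and>
     (\<exists>B. \<forall>\<phi> \<in> W1_0 s S. \<bar>g \<phi>\<bar> \<le> B * W1_norm s S \<phi>)}"

definition W1_dual_norm ::
  "ennreal \<Rightarrow> 'a::euclidean_space set \<Rightarrow> (('a \<Rightarrow> 'b::euclidean_space) \<Rightarrow> real) \<Rightarrow> ereal" where
  "W1_dual_norm s S g = (SUP \<phi> \<in> {\<phi> \<in> W1_0 s S. W1_norm s S \<phi> \<le> 1}. ereal \<bar>g \<phi>\<bar>)"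


section \<open>The immersed boundary\<close>

definition polyhedral_domain :: "'a::euclidean_space set \<Rightarrow> bool" where
  "polyhedral_domain S \<longleftrightarrow> S \<noteq> {} \<and> connected S \<and>
     (\<exists>\<P>. finite \<P> \<and> (\<forall>P\<in>\<P>. polytope P) \<and> S = interior (\<Union>\<P>))"

definition simple_closed_curve :: "(real^2) set \<Rightarrow> bool" where
  "simple_closed_curve G \<longleftrightarrow>
     (\<exists>g. simple_path g \<and> pathfinish g = pathstart g \<and> path_image g = G)"

text \<open>A closed surface is a nonempty compact connected set that is locally homeomorphic to the plane.\<close>

definition simple_closed_surface :: "(real^3) set \<Rightarrow> bool" where
  "simple_closed_surface G \<longleftrightarrow> G \<noteq> {} \<and> compact G \<and> connected G \<and>
     (\<forall>x\<in>G. \<exists>U (V :: (real^2) set). openin (top_of_set G) U \<and> x \<in> U \<and> open V \<and> U homeomorphic V)"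

text \<open>The parameter domain of a closed curve or surface is open, so the image of the parametrization
  need not be closed (one point of the curve, or a meridian of a sphere, is missing). The immersed
  boundary is therefore the closure of the image.\<close>

definition immersed_set :: "'t set \<Rightarrow> ('t \<Rightarrow> 'a::euclidean_space) \<Rightarrow> 'a set" where
  "immersed_set \<Theta> X = closure (X ` \<Theta>)"

definition divides_domain :: "'a::euclidean_space set \<Rightarrow> 'a set \<Rightarrow> bool" where
  "divides_domain G \<Omega> \<longleftrightarrow> G \<subseteq> \<Omega> \<and> setdist G (frontier \<Omega>) > 0 \<and>
     (\<exists>\<Omega>\<^sub>0 \<Omega>\<^sub>1. \<Omega>\<^sub>0 \<noteq> \<Omega>\<^sub>1 \<and> components (\<Omega> - G) = {\<Omega>\<^sub>0, \<Omega>\<^sub>1})"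

definition jacobian2 :: "(real \<Rightarrow> real^2) \<Rightarrow> real \<Rightarrow> real" where
  "jacobian2 X t = sqrt ((dir_deriv 1 X t $ 1)\<^sup>2 + (dir_deriv 1 X t $ 2)\<^sup>2)"

definition minor3 :: "(real \<times> real \<Rightarrow> real^3) \<Rightarrow> real \<times> real \<Rightarrow> 3 \<Rightarrow> 3 \<Rightarrow> real" where
  "minor3 X t i j =
     dir_deriv (1, 0) X t $ i * dir_deriv (0, 1) X t $ j
     - dir_deriv (0, 1) X t $ i * dir_deriv (1, 0) X t $ j"

definition jacobian3 :: "(real \<times> real \<Rightarrow> real^3) \<Rightarrow> real \<times> real \<Rightarrow> real" where
  "jacobian3 X t = sqrt ((minor3 X t 2 3)\<^sup>2 + (minor3 X t 3 1)\<^sup>2 + (minor3 X t 1 2)\<^sup>2)"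


section \<open>The immersed boundary force and its regularization\<close>

definition force_on_tests ::
  "'t::euclidean_space set \<Rightarrow> ('t \<Rightarrow> 'a::euclidean_space) \<Rightarrow> ('t \<Rightarrow> 'a) \<Rightarrow> ('a \<Rightarrow> 'a) \<Rightarrow> real" where
  "force_on_tests \<Theta> X F \<phi> = (\<integral>t. F t \<bullet> \<phi> (X t) \<partial>lebesgue_on \<Theta>)"

text \<open>Extension of a functional \<open>f\<^sub>0\<close> from test functions to an element \<open>f\<close> of the dual of
  \<open>W1_0 s \<Omega>\<close>. For \<open>n < s < \<infinity>\<close> and bounded \<open>\<Omega>\<close> the test functions are norm dense and the first two conditions
  determine \<open>f\<close>. For \<open>s = \<infinity>\<close> they are not norm dense, and extension by continuity refers to uniform
  convergence with a common bound on the \<open>W\<^sup>1\<^sup>,\<^sup>\<infinity>\<close> norms.\<close>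

definition extends_by_continuity ::
  "ennreal \<Rightarrow> 'a::euclidean_space set \<Rightarrow> (('a \<Rightarrow> 'b::euclidean_space) \<Rightarrow> real) \<Rightarrow>
   (('a \<Rightarrow> 'b) \<Rightarrow> real) \<Rightarrow> bool" where
  "extends_by_continuity s \<Omega> f\<^sub>0 f \<longleftrightarrow>
     f \<in> W1_dual s \<Omega> \<and>
     (\<forall>\<phi> \<in> test_functions \<Omega>. f \<phi> = f\<^sub>0 \<phi>) \<and>
     (s = \<infinity> \<longrightarrow> (\<forall>\<phi> \<in> W1_0 \<infinity> \<Omega>. \<forall>\<Phi> :: nat \<Rightarrow> 'a \<Rightarrow> 'b.
        (\<forall>k. \<Phi> k \<in> test_functions \<Omega>) \<and>
        bounded (range (\<lambda>k. W1_norm \<infinity> \<Omega> (\<Phi> k))) \<and>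
        (\<lambda>k. Lp_norm \<infinity> \<Omega> (\<lambda>x. \<Phi> k x - \<phi> x)) \<longlonglongrightarrow> 0
        \<longrightarrow> (\<lambda>k. f (\<Phi> k)) \<longlonglongrightarrow> f \<phi>))"

definition regularized_force ::
  "'t::euclidean_space set \<Rightarrow> ('a \<Rightarrow> real) \<Rightarrow> ('t \<Rightarrow> 'a::euclidean_space) \<Rightarrow> ('t \<Rightarrow> 'a) \<Rightarrow> 'a \<Rightarrow> 'a" where
  "regularized_force \<Theta> \<delta> Xh Fh x = (\<integral>t. \<delta> (x - Xh t) *\<^sub>R Fh t \<partial>lebesgue_on \<Theta>)"

definition functional_of ::
  "'a::euclidean_space set \<Rightarrow> ('a \<Rightarrow> 'b::euclidean_space) \<Rightarrow> ('a \<Rightarrow> 'b) \<Rightarrow> real" where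
  "functional_of \<Omega> g \<phi> = (\<integral>x. g x \<bullet> \<phi> x \<partial>lebesgue_on \<Omega>)"

text \<open>Continuous extension of \<open>g\<close> from the open set \<open>S\<close> to its closure.\<close>

definition cont_ext ::
  "'a::euclidean_space set \<Rightarrow> ('a \<Rightarrow> 'b::euclidean_space) \<Rightarrow> 'a \<Rightarrow> 'b" where
  "cont_ext S g x = Lim (at x within S) g"

definition grid :: "real \<Rightarrow> real \<Rightarrow> nat \<Rightarrow> (nat \<Rightarrow> real) \<Rightarrow> bool" where
  "grid c d M \<tau> \<longleftrightarrow> \<tau> 0 = c \<and> \<tau> M = d \<and> (\<forall>i<M. \<tau> i < \<tau> (Suc i))"

text \<open>\<open>half_node M \<tau> i\<close> is \<open>\<theta>\<close> with index \<open>i - 1/2\<close>, for \<open>0 \<le> i \<le> M + 1\<close>.\<close>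

definition half_node :: "nat \<Rightarrow> (nat \<Rightarrow> real) \<Rightarrow> nat \<Rightarrow> real" where
  "half_node M \<tau> i = (if i = 0 then \<tau> 0 else if i = Suc M then \<tau> M else (\<tau> i + \<tau> (i - 1)) / 2)"

definition mesh_size :: "nat \<Rightarrow> (nat \<Rightarrow> real) \<Rightarrow> real" where
  "mesh_size M \<tau> = Max ((\<lambda>i. half_node M \<tau> (Suc i) - half_node M \<tau> i) ` {0..M})"

definition grid_interp ::
  "real \<Rightarrow> real \<Rightarrow> nat \<Rightarrow> (nat \<Rightarrow> real) \<Rightarrow> (real \<Rightarrow> 'b::euclidean_space) \<Rightarrow> real \<Rightarrow> 'b" where
  "grid_interp c d M \<tau> g t =
     (\<Sum>i=0..M. indicat_real {half_node M \<tau> i <.. half_node M \<tau> (Suc i)} t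
                 *\<^sub>R cont_ext {c<..<d} g (\<tau> i))"

text \<open>\<open>gh\<close> is constant on each cell, with value that of \<open>g\<close> at some node of the closed cell.\<close>

definition piecewise_const_interp ::
  "'t::euclidean_space set \<Rightarrow> 't set set \<Rightarrow> ('t \<Rightarrow> 'b::euclidean_space) \<Rightarrow> ('t \<Rightarrow> 'b) \<Rightarrow> bool" where
  "piecewise_const_interp \<Theta> \<T> g gh \<longleftrightarrow>
     finite \<T> \<and> partition_on \<Theta> \<T> \<and> \<T> \<subseteq> sets lebesgue \<and>
     (\<forall>T\<in>\<T>. \<exists>\<xi> \<in> closure T. \<forall>t\<in>T. gh t = cont_ext \<Theta> g \<xi>)"

end

theory Submission
  imports Defs
begin

text \<open>
  The estimate is proved for test functions and carried over to \<open>W\<^sup>1\<^sup>,\<^sup>s\<^sub>0\<close> by approximation, where \<open>s > n\<close>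
  is the exponent conjugate to \<open>p\<close>. Put \<open>\<alpha> = 1 - n + n/p = 1 - n/s > 0\<close>. For a test function \<open>\<psi>\<close>,
  Fubini's theorem writes the difference of the two forces at \<open>\<psi>\<close> as the integral over \<open>\<Theta>\<close> of
  \<open>F \<bullet> \<psi>(X) - Fh \<bullet> \<integral> \<delta>(y) \<psi>(Xh + y) dy\<close>, and this integrand is the sum of

    \<^item> \<open>(F - Fh) \<bullet> \<psi>(X)\<close> and \<open>Fh \<bullet> (\<psi>(X) - \<psi>(Xh))\<close>, the errors of numerical integration,
    \<^item> \<open>(1 - \<integral>\<delta>) Fh \<bullet> \<psi>(Xh)\<close>, the error in the mass of \<open>\<delta>\<close>,
    \<^item> \<open>Fh \<bullet> \<integral> \<delta>(y) (\<psi>(Xh) - \<psi>(Xh + y)) dy\<close>, the error of spreading the force.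

  The last term is the heart of the matter (\<open>weighted_increment_le\<close>). The increment of \<open>\<psi>\<close> from \<open>x\<close> to
  \<open>x + y\<close> is the integral over \<open>\<tau> \<in> [0, 1]\<close> of the derivative of \<open>\<psi>\<close> at \<open>x + \<tau>y\<close> in direction \<open>y\<close>.
  For fixed \<open>\<tau>\<close>, Hoelder's inequality separates \<open>y \<delta>(y)\<close> in \<open>L\<^sup>p\<close> from the gradient in \<open>L\<^sup>s\<close>; the
  substitution \<open>y \<mapsto> x + \<tau>y\<close> costs a factor \<open>\<tau>\<close> to the power \<open>-n/s = \<alpha> - 1\<close>, which is integrable.
  The same inequality with the indicator of a ball in the place of \<open>\<delta>\<close> bounds the mean oscillation
  of \<open>\<psi>\<close> on the ball. This gives Morrey's inequalities (\<open>Morrey_Hoelder\<close>, \<open>Morrey_sup\<close>), that is, the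
  Hoelder exponent \<open>\<alpha>\<close> and the sup bound that control the remaining terms. Test functions live on the
  whole space, so all constants depend on \<open>n\<close> and \<open>p\<close> alone and not on \<open>\<Omega>\<close>.

  For the approximation (locale \<open>W1_0_function\<close>), let \<open>u\<close> be the continuous representative of \<open>\<phi>\<close>,
  extended by zero, and \<open>u\<^sub>h\<close> its mollification. The test functions are \<open>\<Phi> = \<eta> G(u\<^sub>h / \<eta>)\<close>, where the
  smooth map \<open>G\<close> vanishes on the unit ball and approaches the identity at infinity. If \<open>h\<close> is small
  compared with the modulus of continuity of \<open>u\<close> at level \<open>\<eta>\<close>, then \<open>\<Phi>\<close> vanishes near the boundary
  of \<open>\<Omega>\<close>, and wherever \<open>\<Phi> \<noteq> 0\<close> the mollifier sees only points of \<open>\<Omega>\<close>; hence the gradient of \<open>\<Phi>\<close>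
  is \<open>DG(u\<^sub>h / \<eta>)\<close> applied to the mollified weak gradient of \<open>\<phi>\<close>. Since \<open>\<bar>DG\<bar> \<le> 7\<close> and mollification
  contracts \<open>L\<^sup>s\<close>, the norms grow at most by the factor 7. For \<open>s < \<infinity>\<close> the gradients converge in
  \<open>L\<^sup>s\<close> to the weak gradient restricted to \<open>{u \<noteq> 0}\<close>. That limit is again a weak gradient of \<open>\<phi>\<close>,
  so by uniqueness it is the weak gradient, the approximation converges in norm, and bounded
  functionals pass to the limit. For \<open>s = \<infinity>\<close>, uniform convergence with bounded norms is the mode of
  convergence in which the force is extended by continuity.
\<close>

section \<open>Calculus of smooth functions\<close>

lemma dir_deriv_eq:
  assumes "(u has_derivative u') (at x)"
  shows "dir_deriv b u x = u' b"
  using frechet_derivative_at[OF assms] by (simp add: dir_deriv_def)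

lemma has_derivative_dir_deriv:
  fixes u :: "'a::euclidean_space \<Rightarrow> 'b::euclidean_space"
  assumes "u differentiable (at x)"
  shows "(u has_derivative (\<lambda>h. \<Sum>b\<in>Basis. (h \<bullet> b) *\<^sub>R dir_deriv b u x)) (at x)"
proof -
  have D: "(u has_derivative frechet_derivative u (at x)) (at x)"
    using assms frechet_derivative_works by blast
  then interpret bounded_linear "frechet_derivative u (at x)"
    by (rule has_derivative_bounded_linear)
  have "frechet_derivative u (at x) h = (\<Sum>b\<in>Basis. (h \<bullet> b) *\<^sub>R dir_deriv b u x)" for h
    unfolding dir_deriv_def
    by (subst euclidean_representation[symmetric, of h]) (simp only: sum scaleR)
  then have "frechet_derivative u (at x) = (\<lambda>h. \<Sum>b\<in>Basis. (h \<bullet> b) *\<^sub>R dir_deriv b u x)" by blast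
  then show ?thesis using D by simp
qed

lemma Ck_on_continuous: "Ck_on k S u \<Longrightarrow> continuous_on S u"
  by (cases k) (auto intro!: continuous_at_imp_continuous_on differentiable_imp_continuous_within)

lemma Ck_on_Suc_imp: "Ck_on (Suc k) S u \<Longrightarrow> Ck_on k S u"
proof (induction k arbitrary: u)
  case 0 then show ?case using Ck_on_continuous[of "Suc 0"] by simp
next
  case (Suc k) then show ?case by simp
qed

lemma Ck_on_Suc_UNIV_I:
  assumes "\<And>x. (u has_derivative u' x) (at x)" and "\<And>b. b \<in> Basis \<Longrightarrow> Ck_on k UNIV (\<lambda>x. u' x b)"
  shows "Ck_on (Suc k) UNIV u"
proof -
  have "dir_deriv b u = (\<lambda>x. u' x b)" for b
    using assms(1) by (auto simp: dir_deriv_eq)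
  then show ?thesis using assms by (auto simp: differentiable_def)
qed

lemma Ck_on_const: "Ck_on k UNIV (\<lambda>x. c)"
proof (induction k arbitrary: c)
  case (Suc k)
  show ?case by (rule Ck_on_Suc_UNIV_I[where u' = "\<lambda>x h. 0"]) (auto simp: Suc)
qed simp

lemma Ck_on_bounded_linear: "bounded_linear f \<Longrightarrow> Ck_on k UNIV f"
proof (cases k)
  case (Suc k)
  assume "bounded_linear f"
  then show ?thesis unfolding Suc
    by (intro Ck_on_Suc_UNIV_I[where u' = "\<lambda>x. f"]) (auto simp: Ck_on_const bounded_linear_imp_has_derivative)
qed (simp add: linear_continuous_on)

lemma Ck_on_add:
  "Ck_on k UNIV u \<Longrightarrow> Ck_on k UNIV v \<Longrightarrow> Ck_on k UNIV (\<lambda>x. u x + v x)"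
proof (induction k arbitrary: u v)
  case (Suc k)
  have C: "Ck_on k UNIV (\<lambda>x. frechet_derivative u (at x) b + frechet_derivative v (at x) b)" if "b \<in> Basis" for b
    using Suc.prems that by (intro Suc.IH) (auto simp: dir_deriv_def[abs_def])
  show ?case
    by (rule Ck_on_Suc_UNIV_I[where u' = "\<lambda>x h. frechet_derivative u (at x) h + frechet_derivative v (at x) h"])
      (use Suc C in \<open>auto intro!: derivative_eq_intros dest: frechet_derivative_works[THEN iffD1]\<close>)
qed (auto intro: continuous_intros)

lemma Ck_on_bilinear:
  fixes u :: "'a::euclidean_space \<Rightarrow> 'b::euclidean_space" and v :: "'a \<Rightarrow> 'c::euclidean_space"
  assumes "bounded_bilinear B"
  shows "Ck_on k UNIV u \<Longrightarrow> Ck_on k UNIV v \<Longrightarrow> Ck_on k UNIV (\<lambda>x. B (u x) (v x))"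
proof (induction k arbitrary: u v)
  case 0 then show ?case by (auto intro: bounded_bilinear.continuous_on[OF assms])
next
  case (Suc k)
  have "Ck_on k UNIV u" "Ck_on k UNIV v" using Suc.prems Ck_on_Suc_imp by blast+
  moreover have "Ck_on k UNIV (\<lambda>x. frechet_derivative u (at x) b)" "Ck_on k UNIV (\<lambda>x. frechet_derivative v (at x) b)"
    if "b \<in> Basis" for b
    using Suc.prems that by (auto simp: dir_deriv_def[abs_def])
  ultimately have C: "Ck_on k UNIV (\<lambda>x. B (u x) (frechet_derivative v (at x) b) + B (frechet_derivative u (at x) b) (v x))"
    if "b \<in> Basis" for b
    using that by (intro Ck_on_add Suc.IH) auto
  show ?case
    by (rule Ck_on_Suc_UNIV_I[where u' = "\<lambda>x h. B (u x) (frechet_derivative v (at x) h) + B (frechet_derivative u (at x) h) (v x)"])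
      (use Suc C in \<open>auto intro!: bounded_bilinear.FDERIV[OF assms] dest: frechet_derivative_works[THEN iffD1]\<close>)
qed

lemmas Ck_on_scaleR = Ck_on_bilinear[OF bounded_bilinear_scaleR]
lemmas Ck_on_inner = Ck_on_bilinear[OF bounded_bilinear_inner]

lemma Ck_on_compose_real:
  fixes g :: "real \<Rightarrow> real" and u :: "'a::euclidean_space \<Rightarrow> real"
  shows "Ck_on k UNIV g \<Longrightarrow> Ck_on k UNIV u \<Longrightarrow> Ck_on k UNIV (\<lambda>x. g (u x))"
proof (induction k arbitrary: g)
  case 0 then show ?case by (auto intro: continuous_on_compose2[of UNIV g])
next
  case (Suc k)
  have D: "((\<lambda>x. g (u x)) has_derivative (\<lambda>h. frechet_derivative u (at x) h *\<^sub>R dir_deriv 1 g (u x))) (at x)" for x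
  proof -
    have "(g has_derivative (\<lambda>h. h *\<^sub>R dir_deriv 1 g (u x))) (at (u x))"
      using has_derivative_dir_deriv[of g "u x"] Suc.prems by auto
    moreover have "(u has_derivative frechet_derivative u (at x)) (at x)"
      using Suc.prems by (auto dest: frechet_derivative_works[THEN iffD1])
    ultimately show ?thesis
      using has_derivative_compose[of u "frechet_derivative u (at x)" x UNIV g] by blast
  qed
  have "Ck_on k UNIV (\<lambda>x. dir_deriv 1 g (u x))"
    by (rule Suc.IH[OF _ Ck_on_Suc_imp[OF Suc.prems(2)]]) (use Suc.prems(1) in auto)
  moreover have "Ck_on k UNIV (\<lambda>x. frechet_derivative u (at x) b)" if "b \<in> Basis" for b
    using Suc.prems that by (auto simp: dir_deriv_def[abs_def])
  ultimately have "Ck_on k UNIV (\<lambda>x. frechet_derivative u (at x) b *\<^sub>R dir_deriv 1 g (u x))" if "b \<in> Basis" for b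
    using that by (intro Ck_on_scaleR)
  with D show ?case by (rule Ck_on_Suc_UNIV_I)
qed

subsection \<open>A flat function\<close>

text \<open>The function \<open>exp (-1/t)\<close>, flat at the origin, together with its multiples by negative powers of \<open>t\<close>.
  Differentiation maps the family into its linear span, so one induction over all \<open>m\<close> proves smoothness.\<close>

definition flat :: "nat \<Rightarrow> real \<Rightarrow> real" where
  "flat m t = (if t \<le> 0 then 0 else exp (- (1 / t)) / t ^ m)"

text \<open>With \<open>x = 1/t\<close> this is \<open>x\<^sup>m \<le> m! exp x\<close>, a single term of the exponential series.\<close>

lemma flat_bound: "\<bar>flat m t\<bar> \<le> fact m"
proof (cases "t \<le> 0")
  case False
  define x where "x = 1 / t"
  have x: "x > 0" using False by (simp add: x_def)
  have "x ^ m / fact m \<le> exp x"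
  proof -
    have "(\<Sum>n\<in>{m}. x ^ n /\<^sub>R fact n) \<le> (\<Sum>n. x ^ n /\<^sub>R fact n)"
      using x by (intro sum_le_suminf summable_exp_generic) auto
    then show ?thesis by (simp add: exp_def divide_inverse mult.commute)
  qed
  then have "x ^ m * exp (- x) \<le> fact m"
    by (simp add: exp_minus field_simps)
  moreover have "flat m t = x ^ m * exp (- x)"
    using False by (simp add: flat_def x_def field_simps)
  ultimately show ?thesis using x by simp
qed (simp add: flat_def)

lemma flat_nonneg: "0 \<le> flat m t"
  by (simp add: flat_def)

lemma flat_has_derivative:
  "(flat m has_real_derivative flat (m + 2) t - real m * flat (m + 1) t) (at t)"
proof (cases "t = 0")
  case True
  have "(\<lambda>y. (flat m y - flat m 0) / (y - 0)) \<midarrow>0\<rightarrow> 0"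
  proof (rule Lim_null_comparison)
    show "\<forall>\<^sub>F y in at 0. norm ((flat m y - flat m 0) / (y - 0)) \<le> fact (m + 2) * \<bar>y\<bar>"
    proof (rule always_eventually, intro allI)
      fix y
      show "norm ((flat m y - flat m 0) / (y - 0)) \<le> fact (m + 2) * \<bar>y\<bar>"
      proof (cases "y \<le> 0")
        case False
        have "(flat m y - flat m 0) / (y - 0) = flat (m + 2) y * y"
          using False by (simp add: flat_def power2_eq_square field_simps)
        then show ?thesis
          using flat_bound[of "m + 2" y] False by (simp only: real_norm_def abs_mult) (intro mult_right_mono, auto)
      qed (simp add: flat_def mult_nonneg_nonpos)
    qed
    show "((\<lambda>y::real. fact (m + 2) * \<bar>y\<bar>) \<longlongrightarrow> 0) (at 0)"
      by (auto intro!: tendsto_eq_intros)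
  qed
  then show ?thesis
    using True by (simp add: has_field_derivative_iff flat_def)
next
  case False
  show ?thesis
  proof (cases "t > 0")
    case True
    have "((\<lambda>t. exp (- (1 / t)) / t ^ m) has_real_derivative flat (m + 2) t - real m * flat (m + 1) t) (at t)"
      using True
      apply (auto intro!: derivative_eq_intros simp: flat_def)
      apply (cases m)
       apply (auto simp: field_simps power2_eq_square)
      done
    then show ?thesis
      by (rule has_field_derivative_transform_within_open[where S = "{0<..}"]) (use True in \<open>auto simp: flat_def\<close>)
  next
    case neg: False
    have "((\<lambda>t. 0) has_real_derivative flat (m + 2) t - real m * flat (m + 1) t) (at t)"
      using neg by (simp add: flat_def)
    then show ?thesis
      by (rule has_field_derivative_transform_within_open[where S = "{..<0}"]) (use neg False in \<open>auto simp: flat_def\<close>)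
  qed
qed

lemma Ck_on_flat: "Ck_on k UNIV (flat m)"
proof (induction k arbitrary: m)
  case 0 then show ?case
    using flat_has_derivative[of m] by (auto intro!: continuous_at_imp_continuous_on DERIV_isCont)
next
  case (Suc k)
  have "Ck_on k UNIV (\<lambda>t. flat (m + 2) t + (- real m) *\<^sub>R flat (m + 1) t)"
    by (intro Ck_on_add Ck_on_scaleR Ck_on_const Suc)
  then show ?case
    by (intro Ck_on_Suc_UNIV_I[where u' = "\<lambda>t h. (flat (m + 2) t - real m * flat (m + 1) t) * h"])
      (use flat_has_derivative in \<open>auto simp: has_field_derivative_def\<close>)
qed

subsection \<open>Cutting off small vectors\<close>

text \<open>A smooth map that annihilates the unit ball and differs from the identity by a bounded amount. Rescaled
  to \<open>\<eta> trim (w / \<eta>)\<close> it removes the values of size at most \<open>\<eta>\<close> from a function without creating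
  large derivatives.\<close>

definition trim :: "'a::euclidean_space \<Rightarrow> 'a" where
  "trim w = flat 0 (w \<bullet> w - 1) *\<^sub>R w"

definition trim_deriv :: "'a::euclidean_space \<Rightarrow> 'a \<Rightarrow> 'a" where
  "trim_deriv w h = flat 0 (w \<bullet> w - 1) *\<^sub>R h + (2 * (w \<bullet> h) * flat 2 (w \<bullet> w - 1)) *\<^sub>R w"

lemma trim_has_derivative: "(trim has_derivative trim_deriv w) (at w)"
proof -
  have "((\<lambda>w. flat 0 (w \<bullet> w - 1)) has_derivative (\<lambda>h. (2 * (w \<bullet> h)) * flat 2 (w \<bullet> w - 1))) (at w)"
  proof -
    have "((\<lambda>w. w \<bullet> w - 1) has_derivative (\<lambda>h. 2 * (w \<bullet> h))) (at w)"
      by (auto intro!: derivative_eq_intros simp: inner_commute)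
    moreover have "(flat 0 has_derivative (\<lambda>h. h * flat 2 (w \<bullet> w - 1))) (at (w \<bullet> w - 1))"
      using flat_has_derivative[of 0 "w \<bullet> w - 1"]
      by (simp add: has_field_derivative_def mult.commute[of _ "flat _ _"] numeral_2_eq_2)
    ultimately show ?thesis
      by (rule has_derivative_compose)
  qed
  from has_derivative_scaleR[OF this has_derivative_ident] show ?thesis
    unfolding trim_def trim_deriv_def by (simp add: id_def)
qed

lemma Ck_on_trim_compose:
  fixes u :: "'a::euclidean_space \<Rightarrow> 'b::euclidean_space"
  assumes "Ck_on k UNIV u"
  shows "Ck_on k UNIV (\<lambda>x. trim (u x))"
proof -
  have "Ck_on k UNIV (\<lambda>x. flat 0 (u x \<bullet> u x + (-1)))"
    by (rule Ck_on_compose_real[OF Ck_on_flat]) (intro Ck_on_add Ck_on_inner Ck_on_const assms)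
  then show ?thesis
    unfolding trim_def using assms by (intro Ck_on_scaleR) auto
qed

lemma trim_small: "norm w \<le> 1 \<Longrightarrow> trim w = 0" "norm w \<le> 1 \<Longrightarrow> trim_deriv w h = 0"
  by (auto simp: trim_def trim_deriv_def flat_def dot_square_norm power_le_one_iff)

lemma flat_0_le: "flat 0 t \<le> 1"
  using flat_bound[of 0 t] by simp

lemma norm_trim_le: "norm (trim w) \<le> norm w"
  using flat_0_le[of "w \<bullet> w - 1"] flat_nonneg[of 0 "w \<bullet> w - 1"]
  by (simp add: trim_def mult_left_le_one_le)

lemma flat_0_ge: "t > 0 \<Longrightarrow> 1 - 1 / t \<le> flat 0 t"
  using exp_ge_add_one_self[of "- (1 / t)"] by (simp add: flat_def)

lemma trim_minus: "trim w - w = (flat 0 (w \<bullet> w - 1) - 1) *\<^sub>R w"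
  by (simp add: trim_def scaleR_diff_left)

lemma norm_trim_diff_le: "norm (trim w - w) \<le> 2"
proof (cases "norm w \<le> 2")
  case True
  have "norm (trim w - w) = \<bar>flat 0 (w \<bullet> w - 1) - 1\<bar> * norm w"
    by (simp add: trim_minus)
  also have "\<dots> \<le> 1 * 2"
    using flat_0_le[of "w \<bullet> w - 1"] flat_nonneg[of 0 "w \<bullet> w - 1"] True by (intro mult_mono) auto
  finally show ?thesis by simp
next
  case False
  define r where "r = norm w"
  have r: "r > 2" "w \<bullet> w = r\<^sup>2" using False by (auto simp: r_def dot_square_norm)
  have t: "r\<^sup>2 - 1 \<ge> r" using r mult_right_mono[of 2 r r] unfolding power2_eq_square by linarith
  have "norm (trim w - w) = \<bar>flat 0 (r\<^sup>2 - 1) - 1\<bar> * r"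
    by (simp add: trim_minus r flip: r_def)
  also have "\<dots> \<le> (1 / r) * r"
  proof (intro mult_right_mono)
    have "1 / (r\<^sup>2 - 1) \<le> 1 / r" using t r by (intro divide_left_mono) auto
    then show "\<bar>flat 0 (r\<^sup>2 - 1) - 1\<bar> \<le> 1 / r"
      using flat_0_ge[of "r\<^sup>2 - 1"] flat_0_le[of "r\<^sup>2 - 1"] t r by auto
  qed (use r in auto)
  finally show ?thesis using r by simp
qed

text \<open>Since \<open>(norm w)\<^sup>2\<close> is the argument plus one, multiplying by it lowers the power of the argument.\<close>

lemma flat_2_inner:
  assumes "w \<bullet> w > 1"
  shows "flat 2 (w \<bullet> w - 1) * (norm w)\<^sup>2 = flat 1 (w \<bullet> w - 1) + flat 2 (w \<bullet> w - 1)"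
proof -
  define t where "t = w \<bullet> w - 1"
  have t: "t > 0" "(norm w)\<^sup>2 = t + 1" using assms by (auto simp: t_def dot_square_norm)
  show ?thesis
    unfolding t_def[symmetric] t(2) using t(1) by (simp add: flat_def field_simps power2_eq_square)
qed

text \<open>The constant is \<open>1 + 2 * (1! + 2!)\<close>: the first summand of the derivative has norm at most \<open>norm h\<close>,
  and in the second one the two factors \<open>norm w\<close> are absorbed by \<open>flat_2_inner\<close> and \<open>flat_bound\<close>.\<close>

lemma norm_trim_deriv_le: "norm (trim_deriv w h) \<le> 7 * norm h"
proof (cases "w \<bullet> w \<le> 1")
  case True
  then show ?thesis using trim_small(2)[of w h] by (simp add: dot_square_norm power_le_one_iff)
next
  case False
  define t where "t = w \<bullet> w - 1"
  have "norm (trim_deriv w h) \<le> norm (flat 0 t *\<^sub>R h) + norm ((2 * (w \<bullet> h) * flat 2 t) *\<^sub>R w)"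
    unfolding trim_deriv_def t_def by (rule norm_triangle_ineq)
  also have "norm (flat 0 t *\<^sub>R h) \<le> norm h"
    using flat_0_le[of t] flat_nonneg[of 0 t] by (simp add: mult_left_le_one_le)
  also have "norm ((2 * (w \<bullet> h) * flat 2 t) *\<^sub>R w) = 2 * \<bar>w \<bullet> h\<bar> * flat 2 t * norm w"
    using flat_nonneg[of 2 t] by (simp add: abs_mult)
  also have "\<dots> \<le> 2 * (norm w * norm h) * flat 2 t * norm w"
    using flat_nonneg[of 2 t] by (intro mult_right_mono mult_left_mono Cauchy_Schwarz_ineq2) auto
  also have "\<dots> = 2 * norm h * (flat 2 t * (norm w)\<^sup>2)"
    by (simp add: power2_eq_square)
  also have "\<dots> = 2 * norm h * (flat 1 t + flat 2 t)"
    using flat_2_inner[of w] False by (simp add: t_def)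
  also have "\<dots> \<le> 2 * norm h * (1 + 2)"
    using flat_bound[of 1 t] flat_bound[of 2 t] by (intro mult_left_mono add_mono) (auto simp: numeral_2_eq_2)
  finally show ?thesis by simp
qed

text \<open>Where a function does not vanish, the rescaled cut-off becomes invisible in the limit, also for derivatives.\<close>

lemma trim_deriv_tendsto:
  fixes w :: "nat \<Rightarrow> 'a::euclidean_space"
  assumes w: "filterlim (\<lambda>n. norm (w n)) at_top sequentially"
  shows "(\<lambda>n. trim_deriv (w n) h) \<longlonglongrightarrow> h"
proof -
  define t where "t n = w n \<bullet> w n - 1" for n
  have t: "filterlim t at_top sequentially"
  proof -
    have "filterlim (\<lambda>n. -1 + norm (w n) * norm (w n)) at_top sequentially"
      by (rule filterlim_tendsto_add_at_top[OF tendsto_const filterlim_at_top_mult_at_top[OF w w]])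
    then show ?thesis by (simp add: t_def[abs_def] dot_square_norm power2_eq_square)
  qed
  have i: "(\<lambda>n. 1 / t n) \<longlonglongrightarrow> 0"
    using t by (rule tendsto_divide_0[OF tendsto_const filterlim_at_top_imp_at_infinity])
  have pos: "\<forall>\<^sub>F n in sequentially. t n > 0"
    using t by (simp add: filterlim_at_top_dense)
  have f: "(\<lambda>n. flat m (t n)) \<longlonglongrightarrow> exp (- 0) * 0 ^ m" for m
  proof (rule Lim_transform_eventually)
    show "(\<lambda>n. exp (- (1 / t n)) * (1 / t n) ^ m) \<longlonglongrightarrow> exp (- 0) * 0 ^ m"
      by (rule tendsto_mult[OF tendsto_exp[OF tendsto_minus[OF i]] tendsto_power[OF i]])
    show "\<forall>\<^sub>F n in sequentially. exp (- (1 / t n)) * (1 / t n) ^ m = flat m (t n)"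
      using pos by eventually_elim (auto simp: flat_def power_one_over)
  qed
  have "(\<lambda>n. flat 0 (t n) *\<^sub>R h) \<longlonglongrightarrow> 1 *\<^sub>R h"
    using tendsto_scaleR[OF f[of 0] tendsto_const[of h]] by simp
  moreover have "(\<lambda>n. (2 * (w n \<bullet> h) * flat 2 (t n)) *\<^sub>R w n) \<longlonglongrightarrow> 0"
  proof (rule Lim_null_comparison)
    show "(\<lambda>n. 2 * norm h * (flat 1 (t n) + flat 2 (t n))) \<longlonglongrightarrow> 0"
      using tendsto_mult_left[OF tendsto_add[OF f[of 1] f[of 2]], of "2 * norm h"] by simp
    show "\<forall>\<^sub>F n in sequentially. norm ((2 * (w n \<bullet> h) * flat 2 (t n)) *\<^sub>R w n) \<le> 2 * norm h * (flat 1 (t n) + flat 2 (t n))"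
      using pos
    proof eventually_elim
      case (elim n)
      have "norm ((2 * (w n \<bullet> h) * flat 2 (t n)) *\<^sub>R w n) = 2 * \<bar>w n \<bullet> h\<bar> * flat 2 (t n) * norm (w n)"
        using flat_nonneg[of 2 "t n"] by (simp add: abs_mult)
      also have "\<dots> \<le> 2 * (norm (w n) * norm h) * flat 2 (t n) * norm (w n)"
        using flat_nonneg[of 2 "t n"] by (intro mult_right_mono mult_left_mono Cauchy_Schwarz_ineq2) auto
      also have "\<dots> = 2 * norm h * (flat 2 (t n) * (norm (w n))\<^sup>2)"
        by (simp add: power2_eq_square)
      also have "\<dots> = 2 * norm h * (flat 1 (t n) + flat 2 (t n))"
        using flat_2_inner[of "w n"] elim by (simp add: t_def)
      finally show ?case by simp
    qed
  qed
  ultimately have "(\<lambda>n. flat 0 (t n) *\<^sub>R h + (2 * (w n \<bullet> h) * flat 2 (t n)) *\<^sub>R w n) \<longlonglongrightarrow> 1 *\<^sub>R h + 0"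
    by (rule tendsto_add)
  then show ?thesis by (simp add: trim_deriv_def t_def)
qed

subsection \<open>Convolution with a smooth kernel\<close>

definition conv :: "('a::euclidean_space \<Rightarrow> real) \<Rightarrow> ('a \<Rightarrow> 'b::euclidean_space) \<Rightarrow> 'a \<Rightarrow> 'b" where
  "conv \<eta> u x = (\<integral>y. \<eta> (x - y) *\<^sub>R u y \<partial>lborel)"

lemma integrable_continuous_bounded_support:
  fixes f :: "'a::euclidean_space \<Rightarrow> 'b::euclidean_space"
  assumes "continuous_on UNIV f" and "\<And>x. x \<notin> cbox a c \<Longrightarrow> f x = 0"
  shows "integrable lborel f"
proof -
  have "set_integrable lborel (cbox a c) f"
    unfolding set_integrable_def
    by (rule borel_integrable_compact) (auto intro: continuous_on_subset[OF assms(1)])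
  moreover have "(\<lambda>x. indicator (cbox a c) x *\<^sub>R f x) = f"
    using assms(2) by (auto simp: indicator_def)
  ultimately show ?thesis by (simp add: set_integrable_def)
qed

lemma conv_eq_integral:
  fixes \<eta> :: "'a::euclidean_space \<Rightarrow> real" and u :: "'a \<Rightarrow> 'b::euclidean_space" and x :: 'a
  assumes "continuous_on UNIV \<eta>" "continuous_on UNIV u" "\<And>y. y \<notin> cbox a c \<Longrightarrow> u y = 0"
  shows "conv \<eta> u x = integral (cbox a c) (\<lambda>y. \<eta> (x - y) *\<^sub>R u y)"
proof -
  have c: "continuous_on UNIV (\<lambda>y. \<eta> (x - y) *\<^sub>R u y)"
    by (intro continuous_intros continuous_on_compose2[OF assms(1)] assms(2)) auto
  have "integrable lborel (\<lambda>y. \<eta> (x - y) *\<^sub>R u y)"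
    by (rule integrable_continuous_bounded_support[OF c, of a c]) (use assms in auto)
  then have "((\<lambda>y. \<eta> (x - y) *\<^sub>R u y) has_integral conv \<eta> u x) UNIV"
    unfolding conv_def by (rule has_integral_integral_lborel)
  then have "((\<lambda>y. if y \<in> cbox a c then \<eta> (x - y) *\<^sub>R u y else 0) has_integral conv \<eta> u x) UNIV"
    by (rule has_integral_eq[rotated]) (use assms in auto)
  then show ?thesis
    by (simp add: has_integral_restrict_UNIV integral_unique)
qed

text \<open>Differentiation under the integral sign. The bounded support of \<open>u\<close> turns the convolution into an
  integral over a fixed box, on which the integrand is continuously differentiable in \<open>x\<close>.\<close>

lemma conv_has_derivative:
  fixes \<eta> :: "'a::euclidean_space \<Rightarrow> real" and u :: "'a \<Rightarrow> 'b::euclidean_space" and x :: 'a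
  assumes \<eta>: "Ck_on 1 UNIV \<eta>" and u: "continuous_on UNIV u" "\<And>y. y \<notin> cbox a c \<Longrightarrow> u y = 0"
  shows "\<exists>D. (conv \<eta> u has_derivative D) (at x) \<and> (\<forall>b\<in>Basis. D b = conv (dir_deriv b \<eta>) u x)"
proof -
  have c\<eta>: "continuous_on UNIV \<eta>" using Ck_on_continuous[OF \<eta>] .
  have cd: "continuous_on UNIV (dir_deriv b \<eta>)" if "b \<in> Basis" for b using \<eta> that by simp
  define f where "f x y h = (\<Sum>b\<in>Basis. (h \<bullet> b) * dir_deriv b \<eta> (x - y)) *\<^sub>R u y" for x y :: 'a and h :: 'a
  have df: "((\<lambda>x. \<eta> (x - y) *\<^sub>R u y) has_derivative f x y) (at x)" for x y
  proof -
    have "(\<eta> has_derivative (\<lambda>h. \<Sum>b\<in>Basis. (h \<bullet> b) *\<^sub>R dir_deriv b \<eta> (x - y))) (at (x - y))"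
      using \<eta> by (intro has_derivative_dir_deriv) auto
    moreover have "((\<lambda>x. x - y) has_derivative (\<lambda>h. h)) (at x)"
      by (auto intro!: derivative_eq_intros)
    ultimately have "((\<lambda>x. \<eta> (x - y)) has_derivative (\<lambda>h. \<Sum>b\<in>Basis. (h \<bullet> b) *\<^sub>R dir_deriv b \<eta> (x - y))) (at x)"
      using has_derivative_compose by blast
    then show ?thesis
      unfolding f_def real_scaleR_def by (rule has_derivative_scaleR_left)
  qed
  have bl: "bounded_linear (f x y)" for x y
    by (rule has_derivative_bounded_linear[OF df])
  define fx where "fx x y = Blinfun (f x y)" for x y
  have fx: "blinfun_apply (fx x y) = f x y" for x y
    by (simp add: fx_def bounded_linear_Blinfun_apply bl)
  have fb: "f x y b = dir_deriv b \<eta> (x - y) *\<^sub>R u y" if "b \<in> Basis" for x y b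
    using that by (simp add: f_def inner_Basis if_distrib[of "\<lambda>z. z * _"] cong: if_cong)
  have cont: "continuous_on (UNIV \<times> cbox a c) (\<lambda>(x, y). fx x y)"
  proof (rule continuous_on_blinfun_componentwise)
    fix b :: 'a assume b: "b \<in> Basis"
    have "continuous_on (UNIV \<times> cbox a c) (\<lambda>z. dir_deriv b \<eta> (fst z - snd z) *\<^sub>R u (snd z))"
      by (intro continuous_intros continuous_on_compose2[OF cd[OF b]] continuous_on_compose2[OF u(1)]) auto
    then show "continuous_on (UNIV \<times> cbox a c) (\<lambda>z. blinfun_apply (case z of (x, y) \<Rightarrow> fx x y) b)"
      by (simp add: case_prod_unfold fx fb[OF b])
  qed
  have D: "((\<lambda>x. integral (cbox a c) (\<lambda>y. \<eta> (x - y) *\<^sub>R u y)) has_derivative integral (cbox a c) (fx x)) (at x within UNIV)"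
  proof (rule leibniz_rule)
    fix x y :: 'a assume "x \<in> UNIV" "y \<in> cbox a c"
    show "((\<lambda>x. \<eta> (x - y) *\<^sub>R u y) has_derivative blinfun_apply (fx x y)) (at x within UNIV)"
      using df by (simp add: fx)
  next
    show "(\<lambda>y. \<eta> (x - y) *\<^sub>R u y) integrable_on cbox a c" for x
      by (intro integrable_continuous continuous_intros continuous_on_compose2[OF c\<eta>] continuous_on_subset[OF u(1)]) auto
  qed (use cont in auto)
  have eq: "conv \<eta> u = (\<lambda>x. integral (cbox a c) (\<lambda>y. \<eta> (x - y) *\<^sub>R u y))"
    using conv_eq_integral[OF c\<eta> u] by auto
  have int: "fx x integrable_on cbox a c"
  proof (rule integrable_continuous)
    have "continuous_on (cbox a c) (\<lambda>y. (x, y))"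
      by (intro continuous_intros)
    from continuous_on_compose2[OF cont this] show "continuous_on (cbox a c) (fx x)"
      by auto
  qed
  have "integral (cbox a c) (fx x) b = conv (dir_deriv b \<eta>) u x" if b: "b \<in> Basis" for b
  proof -
    have "integral (cbox a c) (fx x) b = integral (cbox a c) ((\<lambda>g. blinfun_apply g b) \<circ> fx x)"
      by (rule integral_linear[OF int, symmetric]) (rule blinfun.bounded_linear_left)
    also have "\<dots> = conv (dir_deriv b \<eta>) u x"
      using conv_eq_integral[OF cd[OF b] u] by (simp add: o_def fx fb[OF b])
    finally show ?thesis .
  qed
  with D show ?thesis unfolding eq by auto
qed

lemma Ck_on_conv:
  fixes u :: "'a::euclidean_space \<Rightarrow> 'b::euclidean_space"
  assumes u: "continuous_on UNIV u" "\<And>y. y \<notin> cbox a c \<Longrightarrow> u y = 0"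
  shows "Ck_on k UNIV \<eta> \<Longrightarrow> Ck_on k UNIV (conv \<eta> u)"
proof (induction k arbitrary: \<eta>)
  case 0
  then have \<eta>: "continuous_on UNIV \<eta>" by simp
  have "continuous_on UNIV (\<lambda>x. integral (cbox a c) (\<lambda>y. \<eta> (x - y) *\<^sub>R u y))"
    by (rule integral_continuous_on_param) (auto simp: case_prod_unfold intro!: continuous_intros
        continuous_on_compose2[OF \<eta>] continuous_on_compose2[OF u(1)])
  then show ?case using conv_eq_integral[OF \<eta> u] by (simp add: fun_eq_iff cong: continuous_on_cong)
next
  case (Suc k)
  have 1: "Ck_on 1 UNIV \<eta>"
    using Suc.prems by (auto dest: Ck_on_continuous)
  have "\<forall>x. \<exists>D. (conv \<eta> u has_derivative D) (at x) \<and> (\<forall>b\<in>Basis. D b = conv (dir_deriv b \<eta>) u x)"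
    using conv_has_derivative[OF 1 u] by blast
  from choice[OF this] obtain D where D: "\<And>x. (conv \<eta> u has_derivative D x) (at x)"
    "\<And>x b. b \<in> Basis \<Longrightarrow> D x b = conv (dir_deriv b \<eta>) u x"
    by blast
  show ?case
    by (rule Ck_on_Suc_UNIV_I[OF D(1)]) (use D(2) Suc in auto)
qed

section \<open>Hoelder's inequality and affine changes of variables\<close>

text \<open>The numbers \<open>A\<close> and \<open>B\<close> need only dominate the norms. Young's inequality is applied with \<open>a > A\<close> and
  \<open>b > B\<close>, followed by \<open>a \<rightarrow> A\<close> and \<open>b \<rightarrow> B\<close>, so no norm by which one divides can be zero.\<close>

lemma nn_integral_Holder:
  fixes f g :: "'a \<Rightarrow> real"
  assumes pq: "p > 1" "q > 1" "1 / p + 1 / q = 1"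
    and [measurable]: "f \<in> borel_measurable M" "g \<in> borel_measurable M"
    and nonneg: "\<And>x. 0 \<le> f x" "\<And>x. 0 \<le> g x" "0 \<le> A" "0 \<le> B"
    and f: "(\<integral>\<^sup>+x. ennreal (f x powr p) \<partial>M) \<le> ennreal (A powr p)"
    and g: "(\<integral>\<^sup>+x. ennreal (g x powr q) \<partial>M) \<le> ennreal (B powr q)"
  shows "(\<integral>\<^sup>+x. ennreal (f x * g x) \<partial>M) \<le> ennreal (A * B)"
proof -
  have le: "(\<integral>\<^sup>+x. ennreal (f x * g x) \<partial>M) \<le> ennreal (a * b)" if ab: "a > A" "b > B" for a b
  proof -
    have pos: "a > 0" "b > 0" using ab nonneg by linarith+
    have "f x * g x \<le> a * b / p / a powr p * f x powr p + a * b / q / b powr q * g x powr q" for x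
    proof -
      have "(f x / a) * (g x / b) \<le> (f x / a) powr p / p + (g x / b) powr q / q"
        using nonneg pos pq by (intro Youngs_inequality) auto
      then have "a * b * ((f x / a) * (g x / b)) \<le> a * b * ((f x / a) powr p / p + (g x / b) powr q / q)"
        using pos by (intro mult_left_mono) auto
      also have "\<dots> = a * b / p / a powr p * f x powr p + a * b / q / b powr q * g x powr q"
        using nonneg pos by (simp add: powr_divide distrib_left mult.commute[of "a powr p"] mult.commute[of "b powr q"])
      finally show ?thesis using pos by simp
    qed
    then have "(\<integral>\<^sup>+x. ennreal (f x * g x) \<partial>M)
      \<le> (\<integral>\<^sup>+x. ennreal (a * b / p / a powr p) * ennreal (f x powr p) + ennreal (a * b / q / b powr q) * ennreal (g x powr q) \<partial>M)"
      using pos pq by (intro nn_integral_mono) (simp flip: ennreal_mult ennreal_plus add: ennreal_leI)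
    also have "\<dots> = ennreal (a * b / p / a powr p) * (\<integral>\<^sup>+x. ennreal (f x powr p) \<partial>M)
        + ennreal (a * b / q / b powr q) * (\<integral>\<^sup>+x. ennreal (g x powr q) \<partial>M)"
      by (simp add: nn_integral_add nn_integral_cmult)
    also have "\<dots> \<le> ennreal (a * b / p / a powr p) * ennreal (a powr p) + ennreal (a * b / q / b powr q) * ennreal (b powr q)"
      using ab nonneg pq by (intro add_mono mult_left_mono order_trans[OF f] order_trans[OF g] ennreal_leI powr_mono2) auto
    also have "\<dots> = ennreal (a * b / p + a * b / q)"
      using pos pq by (simp flip: ennreal_mult ennreal_plus)
    also have "a * b / p + a * b / q = a * b * (1 / p + 1 / q)"
      by (simp add: distrib_left)
    finally show ?thesis using pq by simp
  qed
  have "(\<lambda>n. ennreal ((A + inverse (real (Suc n))) * (B + inverse (real (Suc n))))) \<longlonglongrightarrow> ennreal ((A + 0) * (B + 0))"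
    by (intro tendsto_ennrealI tendsto_mult tendsto_add tendsto_const LIMSEQ_inverse_real_of_nat)
  then have "(\<integral>\<^sup>+x. ennreal (f x * g x) \<partial>M) \<le> ennreal ((A + 0) * (B + 0))"
    by (rule LIMSEQ_le_const) (auto intro!: le)
  then show ?thesis by simp
qed

lemma nn_integral_lborel_affine:
  fixes f :: "'a::euclidean_space \<Rightarrow> ennreal"
  assumes [measurable]: "f \<in> borel_measurable borel" and c: "c \<noteq> 0"
  shows "(\<integral>\<^sup>+x. f x \<partial>lborel) = ennreal (\<bar>c\<bar> ^ DIM('a)) * (\<integral>\<^sup>+x. f (t + c *\<^sub>R x) \<partial>lborel)"
  by (subst lborel_affine[OF c, of t]) (simp add: nn_integral_density nn_integral_distr nn_integral_cmult ennreal_power)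

lemma integral_lborel_affine:
  fixes f :: "'a::euclidean_space \<Rightarrow> 'b::euclidean_space"
  assumes [measurable]: "f \<in> borel_measurable borel" and c: "c \<noteq> 0"
  shows "(\<integral>x. f x \<partial>lborel) = \<bar>c\<bar> ^ DIM('a) *\<^sub>R (\<integral>x. f (t + c *\<^sub>R x) \<partial>lborel)"
  by (subst lborel_affine[OF c, of t]) (simp add: integral_density integral_distr)

lemma nn_integral_lborel_reflect:
  fixes f :: "'a::euclidean_space \<Rightarrow> ennreal"
  assumes "f \<in> borel_measurable borel"
  shows "(\<integral>\<^sup>+x. f (t - x) \<partial>lborel) = (\<integral>\<^sup>+x. f x \<partial>lborel)"
  using nn_integral_lborel_affine[OF assms, of "-1" t] by simp

lemma nn_integral_lborel_shift:
  fixes f :: "'a::euclidean_space \<Rightarrow> ennreal"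
  assumes "f \<in> borel_measurable borel"
  shows "(\<integral>\<^sup>+x. f (t + x) \<partial>lborel) = (\<integral>\<^sup>+x. f x \<partial>lborel)"
  using nn_integral_lborel_affine[OF assms, of "1" t] by simp

lemma integral_lborel_reflect:
  fixes f :: "'a::euclidean_space \<Rightarrow> 'b::euclidean_space"
  assumes "f \<in> borel_measurable borel"
  shows "(\<integral>x. f (t - x) \<partial>lborel) = (\<integral>x. f x \<partial>lborel)"
  using integral_lborel_affine[OF assms, of "-1" t] by simp

lemma integral_lborel_shift:
  fixes f :: "'a::euclidean_space \<Rightarrow> 'b::euclidean_space"
  assumes "f \<in> borel_measurable borel"
  shows "(\<integral>x. f (t + x) \<partial>lborel) = (\<integral>x. f x \<partial>lborel)"
  using integral_lborel_affine[OF assms, of "1" t] by simp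

section \<open>Mollification\<close>

text \<open>Smooth, and for \<open>h > 0\<close> positive exactly on the open ball of radius \<open>h\<close> about the origin.\<close>

definition bump :: "real \<Rightarrow> 'a::euclidean_space \<Rightarrow> real" where
  "bump h z = flat 0 (1 - (z \<bullet> z) / h\<^sup>2)"

definition moll :: "real \<Rightarrow> 'a::euclidean_space \<Rightarrow> real" where
  "moll h z = bump h z / (\<integral>y. bump h (y::'a) \<partial>lborel)"

lemma Ck_on_bump: "Ck_on k UNIV (bump h)"
proof -
  have "Ck_on k UNIV (\<lambda>z::'a. 1 + (- 1 / h\<^sup>2) *\<^sub>R (z \<bullet> z))"
    by (intro Ck_on_add Ck_on_scaleR Ck_on_inner Ck_on_const Ck_on_bounded_linear bounded_linear_ident)
  from Ck_on_compose_real[OF Ck_on_flat this] show ?thesis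
    by (simp add: bump_def[abs_def])
qed

lemma Ck_on_moll: "Ck_on k UNIV (moll h)"
proof -
  have "Ck_on k UNIV (\<lambda>z::'a. (1 / (\<integral>y. bump h (y::'a) \<partial>lborel)) *\<^sub>R bump h z)"
    by (intro Ck_on_scaleR Ck_on_const Ck_on_bump)
  then show ?thesis by (simp add: moll_def[abs_def])
qed

lemma continuous_moll: "continuous_on UNIV (moll h)"
  using Ck_on_moll[of 0] by simp

lemma moll_measurable[measurable]: "moll h \<in> borel_measurable borel"
  by (intro borel_measurable_continuous_onI continuous_moll)

lemma bump_outside: "h > 0 \<Longrightarrow> norm z \<ge> h \<Longrightarrow> bump h z = 0"
  by (simp add: bump_def flat_def dot_square_norm power_mono)

lemma bump_nonneg: "0 \<le> bump h z"
  by (simp add: bump_def flat_nonneg)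

lemma bump_integrable:
  assumes "h > 0" shows "integrable lborel (bump h :: 'a::euclidean_space \<Rightarrow> real)"
proof -
  obtain a c :: 'a where "cball 0 h \<subseteq> cbox a c"
    using bounded_subset_cbox_symmetric[of "cball 0 h"] by (metis bounded_cball)
  then have "bump h x = 0" if "x \<notin> cbox a c" for x
    using that bump_outside[OF assms, of x] by (force simp: subset_iff)
  then show ?thesis
    using Ck_on_bump[of 0] by (intro integrable_continuous_bounded_support) auto
qed

lemma bump_integral_pos:
  assumes "h > 0" shows "(\<integral>y. bump h (y::'a::euclidean_space) \<partial>lborel) > 0"
proof (rule ccontr)
  assume "\<not> ?thesis"
  moreover have "(\<integral>y. bump h (y::'a) \<partial>lborel) \<ge> 0"
    by (intro Bochner_Integration.integral_nonneg bump_nonneg)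
  ultimately have "(\<integral>y. bump h (y::'a) \<partial>lborel) = 0"
    by linarith
  then have "AE y in lborel. bump h (y::'a) = 0"
    using integral_nonneg_eq_0_iff_AE[OF bump_integrable[OF assms, where 'a='a]] by (simp add: bump_nonneg)
  moreover have "bump h y \<noteq> 0" if "y \<in> ball 0 h" for y :: 'a
  proof -
    have "(norm y)\<^sup>2 < h\<^sup>2" using that by (intro power_strict_mono) auto
    then have "y \<bullet> y / h\<^sup>2 < 1" using assms by (simp add: dot_square_norm)
    then show ?thesis by (simp add: bump_def flat_def)
  qed
  ultimately have "AE y in lborel. (y::'a) \<notin> ball 0 h"
    by (auto elim!: eventually_mono)
  then have "emeasure lborel (ball (0::'a) h) = 0"
    by (subst (asm) AE_iff_null_sets[symmetric]) auto
  moreover have "emeasure lborel (ball (0::'a) h) > 0"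
    using assms by (simp add: emeasure_ball ennreal_zero_less_mult_iff)
  ultimately show False by simp
qed

lemma moll_nonneg: "h > 0 \<Longrightarrow> 0 \<le> moll h z"
  using bump_integral_pos[of h, where 'a='a] by (simp add: moll_def bump_nonneg)

lemma moll_outside: "h > 0 \<Longrightarrow> norm z \<ge> h \<Longrightarrow> moll h z = 0"
  by (simp add: moll_def bump_outside)

lemma moll_integrable: "h > 0 \<Longrightarrow> integrable lborel (moll h)"
  by (simp add: moll_def[abs_def] bump_integrable)

lemma moll_integral: "h > 0 \<Longrightarrow> (\<integral>z. moll h (z::'a::euclidean_space) \<partial>lborel) = 1"
  using bump_integral_pos[of h, where 'a='a] by (simp add: moll_def)

lemma moll_nn_integral: "h > 0 \<Longrightarrow> (\<integral>\<^sup>+z. ennreal (moll h (z::'a::euclidean_space)) \<partial>lborel) = 1"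
  by (subst nn_integral_eq_integral) (auto simp: moll_integrable moll_integral moll_nonneg)

lemma moll_nn_integral_reflect:
  fixes x y :: "'a::euclidean_space"
  shows "h > 0 \<Longrightarrow> (\<integral>\<^sup>+y. ennreal (moll h (x - y)) \<partial>lborel) = 1"
  "h > 0 \<Longrightarrow> (\<integral>\<^sup>+x. ennreal (moll h (x - y)) \<partial>lborel) = 1"
  using nn_integral_lborel_reflect[of "\<lambda>z. ennreal (moll h z)" x]
    nn_integral_lborel_shift[of "\<lambda>z. ennreal (moll h z)" "- y"] moll_nn_integral[of h, where 'a='a]
  by simp_all

lemma norm_conv_le:
  "ennreal (norm (conv \<eta> w x)) \<le> (\<integral>\<^sup>+y. ennreal (\<bar>\<eta> (x - y)\<bar> * norm (w y)) \<partial>lborel)"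
proof (cases "integrable lborel (\<lambda>y. \<eta> (x - y) *\<^sub>R w y)")
  case True
  from integral_norm_bound_ennreal[OF this] show ?thesis by (simp add: conv_def)
qed (simp add: conv_def not_integrable_integral_eq)

text \<open>Jensen's inequality for the probability density \<open>y \<mapsto> moll h (x - y)\<close>. It follows from Hoelder's
  inequality by distributing the density over both factors with the exponents \<open>1/q\<close> and \<open>1/s\<close>.\<close>

lemma conv_moll_powr_le:
  fixes w :: "'a::euclidean_space \<Rightarrow> 'b::euclidean_space"
  assumes h: "h > 0" and s: "s \<ge> 1" and [measurable]: "w \<in> borel_measurable borel"
  shows "ennreal (norm (conv (moll h) w x) powr s) \<le> (\<integral>\<^sup>+y. ennreal (moll h (x - y) * norm (w y) powr s) \<partial>lborel)"
proof (cases "s = 1")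
  case True
  then show ?thesis using norm_conv_le[of "moll h" w x] by (simp add: moll_nonneg[OF h])
next
  case False
  then have s: "s > 1" using s by simp
  define q where "q = s / (s - 1)"
  have q: "q > 1" "1 / q + 1 / s = 1" using s by (auto simp: q_def field_simps)
  show ?thesis
  proof (cases "(\<integral>\<^sup>+y. ennreal (moll h (x - y) * norm (w y) powr s) \<partial>lborel)" rule: ennreal_cases)
    case (real R)
    have "(\<integral>\<^sup>+y. ennreal (moll h (x - y) powr (1 / q) * (moll h (x - y) powr (1 / s) * norm (w y))) \<partial>lborel) \<le> ennreal (1 * R powr (1 / s))"
    proof (rule nn_integral_Holder[OF q(1) s q(2)])
      show "(\<integral>\<^sup>+y. ennreal ((moll h (x - y) powr (1 / q)) powr q) \<partial>lborel) \<le> ennreal (1 powr q)"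
        using q moll_nn_integral_reflect(1)[OF h, of x] by (simp add: powr_powr moll_nonneg[OF h])
      have "(moll h (x - y) powr (1 / s) * norm (w y)) powr s = moll h (x - y) * norm (w y) powr s" for y
        using s by (simp add: powr_mult powr_powr moll_nonneg[OF h])
      then show "(\<integral>\<^sup>+y. ennreal ((moll h (x - y) powr (1 / s) * norm (w y)) powr s) \<partial>lborel) \<le> ennreal ((R powr (1 / s)) powr s)"
        using real s by (simp add: powr_powr)
    qed (auto simp: real)
    moreover have "moll h (x - y) powr (1 / q) * (moll h (x - y) powr (1 / s) * norm (w y)) = moll h (x - y) * norm (w y)" for y
      using q by (simp add: mult.assoc[symmetric] powr_add[symmetric] moll_nonneg[OF h])
    ultimately have "(\<integral>\<^sup>+y. ennreal (\<bar>moll h (x - y)\<bar> * norm (w y)) \<partial>lborel) \<le> ennreal (R powr (1 / s))"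
      by (simp only: abs_of_nonneg[OF moll_nonneg[OF h]] mult_1)
    then have "ennreal (norm (conv (moll h) w x)) \<le> ennreal (R powr (1 / s))"
      using norm_conv_le order_trans by blast
    then have "norm (conv (moll h) w x) powr s \<le> (R powr (1 / s)) powr s"
      using s by (intro powr_mono2) (auto simp: ennreal_le_iff)
    then show ?thesis using real s by (simp add: powr_powr ennreal_leI)
  qed simp
qed

lemma conv_measurable[measurable]:
  assumes [measurable]: "\<eta> \<in> borel_measurable borel" "w \<in> borel_measurable borel"
  shows "conv \<eta> w \<in> borel_measurable borel"
proof -
  have "(\<lambda>x. \<integral>y. \<eta> (x - y) *\<^sub>R w y \<partial>lborel) \<in> borel_measurable lborel"
    by measurable
  then show ?thesis by (simp add: conv_def[abs_def])
qed

text \<open>Integrate Jensen's inequality over \<open>x\<close> and exchange the integrals: the kernel has mass one in \<open>x\<close> as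
  well as in \<open>y\<close>. So mollification contracts every \<open>L\<^sup>s\<close> norm.\<close>

lemma nn_integral_conv_moll_le:
  fixes w :: "'a::euclidean_space \<Rightarrow> 'b::euclidean_space"
  assumes h: "h > 0" and s: "s \<ge> 1" and [measurable]: "w \<in> borel_measurable borel"
  shows "(\<integral>\<^sup>+x. ennreal (norm (conv (moll h) w x) powr s) \<partial>lborel) \<le> (\<integral>\<^sup>+y. ennreal (norm (w y) powr s) \<partial>lborel)"
proof -
  have "(\<integral>\<^sup>+x. ennreal (norm (conv (moll h) w x) powr s) \<partial>lborel)
    \<le> (\<integral>\<^sup>+x. (\<integral>\<^sup>+y. ennreal (moll h (x - y) * norm (w y) powr s) \<partial>lborel) \<partial>lborel)"
    by (intro nn_integral_mono conv_moll_powr_le assms)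
  also have "\<dots> = (\<integral>\<^sup>+y. (\<integral>\<^sup>+x. ennreal (moll h (x - y) * norm (w y) powr s) \<partial>lborel) \<partial>lborel)"
    by (rule lborel_pair.Fubini'[symmetric]) measurable
  also have "\<dots> = (\<integral>\<^sup>+y. ennreal (norm (w y) powr s) \<partial>lborel)"
    by (simp add: ennreal_mult moll_nonneg[OF h] nn_integral_multc moll_nn_integral_reflect(2)[OF h])
  finally show ?thesis .
qed

text \<open>A weighted mean of values within \<open>e\<close> of \<open>u x\<close> is within \<open>e\<close> of \<open>u x\<close>.\<close>

lemma norm_conv_moll_diff_le:
  fixes u :: "'a::euclidean_space \<Rightarrow> 'b::euclidean_space"
  assumes h: "h > 0" and u: "continuous_on UNIV u" "\<And>y. y \<notin> cbox a c \<Longrightarrow> u y = 0"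
    and e: "\<And>y. norm (x - y) < h \<Longrightarrow> norm (u y - u x) \<le> e"
  shows "norm (conv (moll h) u x - u x) \<le> e"
proof -
  have i1: "integrable lborel (\<lambda>y. moll h (x - y) *\<^sub>R u y)"
    by (rule integrable_continuous_bounded_support[where a=a and c=c])
      (use u in \<open>auto intro!: continuous_intros continuous_on_compose2[OF continuous_moll]\<close>)
  have m: "integrable lborel (\<lambda>y. moll h (x - y))"
    using moll_nn_integral_reflect(1)[OF h, of x]
    by (intro integrableI_nonneg) (auto simp: moll_nonneg[OF h])
  have i2: "integrable lborel (\<lambda>y. moll h (x - y) *\<^sub>R u x)"
    using m by simp
  have m1: "(\<integral>y. moll h (x - y) \<partial>lborel) = 1"
    using integral_lborel_reflect[of "moll h" x] by (simp add: moll_integral[OF h])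
  have "conv (moll h) u x - u x = (\<integral>y. moll h (x - y) *\<^sub>R u y \<partial>lborel) - (\<integral>y. moll h (x - y) *\<^sub>R u x \<partial>lborel)"
    using m m1 by (simp add: conv_def)
  also have "\<dots> = (\<integral>y. moll h (x - y) *\<^sub>R (u y - u x) \<partial>lborel)"
    by (simp only: Bochner_Integration.integral_diff[OF i1 i2, symmetric] scaleR_diff_right)
  also have "norm \<dots> \<le> (\<integral>y. norm (moll h (x - y) *\<^sub>R (u y - u x)) \<partial>lborel)"
    by (rule integral_norm_bound)
  also have "\<dots> \<le> (\<integral>y. moll h (x - y) * e \<partial>lborel)"
  proof (rule integral_mono)
    show "integrable lborel (\<lambda>y. norm (moll h (x - y) *\<^sub>R (u y - u x)))"
      using Bochner_Integration.integrable_diff[OF i1 i2]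
      by (intro integrable_norm) (simp add: scaleR_diff_right)
    show "norm (moll h (x - y) *\<^sub>R (u y - u x)) \<le> moll h (x - y) * e" for y
      using e[of y] moll_outside[OF h, of "x - y"] moll_nonneg[OF h, of "x - y"]
      by (cases "norm (x - y) < h") (auto intro!: mult_left_mono)
  qed (use m in auto)
  also have "\<dots> = e" using m1 by simp
  finally show ?thesis .
qed

lemma conv_moll_outside:
  assumes "h > 0" "\<And>y. norm (x - y) < h \<Longrightarrow> u y = 0"
  shows "conv (moll h) u x = 0"
proof -
  have "(\<lambda>y. moll h (x - y) *\<^sub>R u y) = (\<lambda>y. 0)"
  proof
    show "moll h (x - y) *\<^sub>R u y = 0" for y
      using assms moll_outside[of h "x - y"] by (cases "norm (x - y) < h") auto
  qed
  then show ?thesis by (simp add: conv_def)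
qed

lemma integrable_moll_scaleR:
  fixes w :: "'a::euclidean_space \<Rightarrow> 'b::euclidean_space"
  assumes h: "h > 0" and w: "integrable lborel w"
  shows "integrable lborel (\<lambda>y. moll h (x - y) *\<^sub>R w y)"
proof -
  have "bounded (moll h ` (UNIV :: 'a set))"
  proof -
    have "moll h ` (UNIV::'a set) \<subseteq> insert 0 (moll h ` cball (0::'a) h)"
    proof (rule image_subsetI)
      fix z :: 'a
      show "moll h z \<in> insert 0 (moll h ` cball (0::'a) h)"
        using moll_outside[OF h, of z] by (cases "norm z \<le> h") auto
    qed
    moreover have "bounded (insert 0 (moll h ` cball (0::'a) h))"
      using compact_continuous_image[OF continuous_on_subset[OF continuous_moll] compact_cball[of "0::'a" h]]
      by (simp add: compact_imp_bounded)
    ultimately show ?thesis using bounded_subset by blast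
  qed
  then obtain C where C: "\<And>z::'a. \<bar>moll h z\<bar> \<le> C"
    by (auto simp: bounded_iff)
  have "w \<in> borel_measurable lborel" using w by auto
  then have [measurable]: "w \<in> borel_measurable borel" by simp
  show ?thesis
  proof (rule Bochner_Integration.integrable_bound)
    show "integrable lborel (\<lambda>y. C * norm (w y))" using w by auto
    show "AE y in lborel. norm (moll h (x - y) *\<^sub>R w y) \<le> norm (C * norm (w y))"
    proof (rule AE_I2)
      fix y
      have "\<bar>moll h (x - y)\<bar> * norm (w y) \<le> C * norm (w y)" using C by (intro mult_right_mono) auto
      then show "norm (moll h (x - y) *\<^sub>R w y) \<le> norm (C * norm (w y))" by simp
    qed
  qed measurable
qed

lemma powr_sum3_le:
  fixes a b c s :: real
  assumes "a \<ge> 0" "b \<ge> 0" "c \<ge> 0" "s \<ge> 0"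
  shows "(a + b + c) powr s \<le> 3 powr s * (a powr s + b powr s + c powr s)"
proof -
  define m where "m = max a (max b c)"
  have "(a + b + c) powr s \<le> (3 * m) powr s"
    using assms by (intro powr_mono2) (auto simp: m_def)
  also have "\<dots> = 3 powr s * m powr s"
    using assms by (simp add: powr_mult m_def)
  also have "m powr s \<le> a powr s + b powr s + c powr s"
    by (auto simp: m_def max_def)
  finally show ?thesis by simp
qed

lemma norm_sum3_powr_le:
  fixes a b c :: "'b::euclidean_space"
  assumes s: "s \<ge> 0"
  shows "ennreal (norm (a + b + c) powr s)
    \<le> ennreal (3 powr s) * (ennreal (norm a powr s) + ennreal (norm b powr s) + ennreal (norm c powr s))"
proof -
  have "norm (a + b + c) powr s \<le> (norm a + norm b + norm c) powr s"
    using s norm_triangle_ineq[of "a + b" c] norm_triangle_ineq[of a b] by (intro powr_mono2) auto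
  also have "\<dots> \<le> 3 powr s * (norm a powr s + norm b powr s + norm c powr s)"
    using s by (intro powr_sum3_le) auto
  finally show ?thesis
    by (simp flip: ennreal_mult ennreal_plus add: ennreal_leI)
qed

text \<open>Projection onto a ball, which truncates the values of a vector-valued function continuously.\<close>

definition clip :: "real \<Rightarrow> 'b::euclidean_space \<Rightarrow> 'b" where
  "clip R w = closest_point (cball 0 R) w"

lemma clip_props:
  fixes w :: "'b::euclidean_space"
  assumes "R \<ge> 0"
  shows norm_clip_le: "norm (clip R w) \<le> R" and clip_self: "norm w \<le> R \<Longrightarrow> clip R w = w"
    and norm_clip_le2: "norm (clip R w) \<le> norm w" and continuous_clip: "continuous_on S (clip R :: 'b \<Rightarrow> 'b)"
proof -
  have ne: "cball (0::'b) R \<noteq> {}" using assms by auto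
  show "norm (clip R w) \<le> R"
    using closest_point_in_set[OF closed_cball ne, of w] by (simp add: clip_def)
  show self: "norm w \<le> R \<Longrightarrow> clip R w = w" for w :: 'b
    by (simp add: clip_def closest_point_self)
  show "continuous_on S (clip R :: 'b \<Rightarrow> 'b)"
    unfolding clip_def[abs_def] by (rule continuous_on_closest_point) (use ne in auto)
  show "norm (clip R w) \<le> norm w"
    using closest_point_lipschitz[OF convex_cball closed_cball ne, of w 0] self[of 0] assms
    by (simp add: clip_def)
qed

text \<open>Two applications of dominated convergence. First the values are truncated, dominated by \<open>w\<close> itself. Then
  the truncated function is an almost everywhere limit of continuous functions; truncating these
  and cutting them off outside a ball makes a constant on the ball a common majorant.\<close>

lemma Lp_dense_continuous:
  fixes w :: "'a::euclidean_space \<Rightarrow> 'b::euclidean_space"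
  assumes w[measurable]: "w \<in> borel_measurable borel" and R0: "R0 > 0" "\<And>x. norm x \<ge> R0 \<Longrightarrow> w x = 0"
    and s: "s \<ge> 1" and fin: "(\<integral>\<^sup>+x. ennreal (norm (w x) powr s) \<partial>lborel) < \<infinity>" and e: "e > 0"
  shows "\<exists>c. continuous_on UNIV c \<and> (\<forall>x. norm x \<ge> R0 + 1 \<longrightarrow> c x = 0) \<and>
    (\<integral>\<^sup>+x. ennreal (norm (w x - c x) powr s) \<partial>lborel) \<le> ennreal e"
proof -
  define d where "d = e / (2 * 3 powr s)"
  have d: "d > 0" using e by (simp add: d_def)
  have s0: "s > 0" using s by simp
  have clipm[measurable]: "(clip (real n) :: 'b \<Rightarrow> 'b) \<in> borel_measurable borel" for n :: nat
    by (intro borel_measurable_continuous_onI continuous_clip) auto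
  have "(\<lambda>n. \<integral>\<^sup>+x. ennreal (norm (w x - clip (real n) (w x)) powr s) \<partial>lborel) \<longlonglongrightarrow> (\<integral>\<^sup>+x. 0 \<partial>(lborel :: 'a measure))"
  proof (rule nn_integral_dominated_convergence[where w = "\<lambda>x. ennreal (2 powr s) * ennreal (norm (w x) powr s)"])
    show "(\<integral>\<^sup>+x. ennreal (2 powr s) * ennreal (norm (w x) powr s) \<partial>lborel) < \<infinity>"
      using fin by (simp add: nn_integral_cmult ennreal_mult_less_top)
    show "AE x in lborel. ennreal (norm (w x - clip (real j) (w x)) powr s) \<le> ennreal (2 powr s) * ennreal (norm (w x) powr s)" for j
    proof (rule AE_I2)
      fix x
      have "norm (w x - clip (real j) (w x)) \<le> norm (w x) + norm (clip (real j) (w x))"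
        by (rule norm_triangle_ineq4)
      also have "\<dots> \<le> 2 * norm (w x)" using norm_clip_le2[of "real j" "w x"] by simp
      finally have "norm (w x - clip (real j) (w x)) powr s \<le> (2 * norm (w x)) powr s"
        using s0 by (intro powr_mono2) auto
      then show "ennreal (norm (w x - clip (real j) (w x)) powr s) \<le> ennreal (2 powr s) * ennreal (norm (w x) powr s)"
        by (simp add: powr_mult ennreal_leI flip: ennreal_mult)
    qed
    show "AE x in lborel. (\<lambda>i. ennreal (norm (w x - clip (real i) (w x)) powr s)) \<longlonglongrightarrow> 0"
    proof (rule AE_I2)
      fix x
      obtain N where N: "norm (w x) \<le> real N" using real_arch_simple by blast
      have "\<forall>\<^sub>F i in sequentially. ennreal (norm (w x - clip (real i) (w x)) powr s) = 0"
        using eventually_ge_at_top[of N]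
      proof eventually_elim
        case (elim i)
        then have "clip (real i) (w x) = w x" using N by (intro clip_self) auto
        then show ?case by simp
      qed
      then show "(\<lambda>i. ennreal (norm (w x - clip (real i) (w x)) powr s)) \<longlonglongrightarrow> 0"
        by (rule tendsto_eventually)
    qed
  qed measurable
  then have "(\<lambda>n. \<integral>\<^sup>+x. ennreal (norm (w x - clip (real n) (w x)) powr s) \<partial>lborel) \<longlonglongrightarrow> 0"
    by simp
  from order_tendstoD(2)[OF this, of "ennreal d"]
  have "\<forall>\<^sub>F n in sequentially. (\<integral>\<^sup>+x. ennreal (norm (w x - clip (real n) (w x)) powr s) \<partial>lborel) < ennreal d"
    using d by simp
  then obtain n where n: "(\<integral>\<^sup>+x. ennreal (norm (w x - clip (real n) (w x)) powr s) \<partial>lborel) < ennreal d"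
    by (auto simp: eventually_sequentially)
  define v where "v x = clip (real n) (w x)" for x
  have [measurable]: "v \<in> borel_measurable borel" unfolding v_def[abs_def] by measurable
  have "v measurable_on UNIV"
    by (intro lebesgue_measurable_imp_measurable_on) (auto simp: measurable_completion)
  then obtain N g where N: "negligible N" and g: "\<And>m. continuous_on UNIV (g m)"
    and lim: "\<And>x. x \<notin> N \<Longrightarrow> (\<lambda>m. g m x) \<longlonglongrightarrow> v x"
    by (auto simp: measurable_on_def)
  define \<theta> where "\<theta> x = max 0 (min 1 (R0 + 1 - norm x))" for x :: 'a
  define c where "c m x = \<theta> x *\<^sub>R clip (real n) (g m x)" for m x
  have \<theta>: "0 \<le> \<theta> x" "\<theta> x \<le> 1" for x by (auto simp: \<theta>_def)
  have \<theta>v: "\<theta> x *\<^sub>R v x = v x" for x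
  proof (cases "norm x \<ge> R0")
    case True then show ?thesis using R0 clip_self[of "real n" "0::'b"] by (simp add: v_def)
  qed (simp add: \<theta>_def)
  have cc: "continuous_on UNIV (c m)" for m
    unfolding c_def \<theta>_def by (intro continuous_intros continuous_on_compose2[OF continuous_clip g]) auto
  have c0: "c m x = 0" if "norm x \<ge> R0 + 1" for m x
    using that by (simp add: c_def \<theta>_def)
  have cm: "(\<lambda>x. c m x) \<in> borel_measurable borel" for m
    using cc by (intro borel_measurable_continuous_onI)
  have "(\<lambda>m. \<integral>\<^sup>+x. ennreal (norm (v x - c m x) powr s) \<partial>lborel) \<longlonglongrightarrow> (\<integral>\<^sup>+x. 0 \<partial>(lborel :: 'a measure))"
  proof (rule nn_integral_dominated_convergence[where w = "\<lambda>x. ennreal ((2 * real n) powr s) * indicator (cball 0 (R0 + 1)) x"])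
    show "(\<integral>\<^sup>+x. ennreal ((2 * real n) powr s) * indicator (cball (0::'a) (R0 + 1)) x \<partial>lborel) < \<infinity>"
      using emeasure_lborel_cball_finite[of "0::'a" "R0 + 1"]
      by (simp add: nn_integral_cmult_indicator ennreal_mult_less_top)
    show "AE x in lborel. ennreal (norm (v x - c j x) powr s) \<le> ennreal ((2 * real n) powr s) * indicator (cball 0 (R0 + 1)) x" for j
    proof (rule AE_I2)
      fix x
      have "norm (v x - c j x) \<le> norm (v x) + norm (c j x)" by (rule norm_triangle_ineq4)
      also have "norm (v x) \<le> real n" by (simp add: v_def norm_clip_le)
      also have "norm (c j x) \<le> 1 * real n"
        unfolding c_def norm_scaleR using \<theta>[of x] by (intro mult_mono norm_clip_le) auto
      finally have "norm (v x - c j x) powr s \<le> (2 * real n) powr s"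
        using s0 by (intro powr_mono2) auto
      moreover have "v x - c j x = 0" if "\<not> norm x \<le> R0 + 1"
        using that c0[of x j] \<theta>v[of x] by (auto simp: \<theta>_def)
      ultimately show "ennreal (norm (v x - c j x) powr s) \<le> ennreal ((2 * real n) powr s) * indicator (cball 0 (R0 + 1)) x"
        by (auto simp: indicator_def ennreal_leI)
    qed
    have "AE x in lebesgue. x \<notin> N"
      using N by (simp add: negligible_iff_null_sets AE_not_in)
    then have "AE x in lborel. x \<notin> N" by (simp add: AE_completion_iff)
    then show "AE x in lborel. (\<lambda>m. ennreal (norm (v x - c m x) powr s)) \<longlonglongrightarrow> 0"
    proof eventually_elim
      case (elim x)
      have "(\<lambda>m. clip (real n) (g m x)) \<longlonglongrightarrow> clip (real n) (v x)"
        using continuous_on_tendsto_compose[OF continuous_clip[of "real n" UNIV] lim[OF elim]] by simp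
      moreover have "clip (real n) (v x) = v x" by (intro clip_self) (auto simp: v_def norm_clip_le)
      ultimately have "(\<lambda>m. c m x) \<longlonglongrightarrow> \<theta> x *\<^sub>R v x" unfolding c_def by (intro tendsto_scaleR tendsto_const) simp
      then have "(\<lambda>m. norm (v x - c m x) powr s) \<longlonglongrightarrow> norm (v x - v x) powr s"
        unfolding \<theta>v using s0 by (intro tendsto_powr' tendsto_norm tendsto_diff tendsto_const) auto
      from tendsto_ennrealI[OF this] show ?case by simp
    qed
    show "(\<lambda>x. ennreal (norm (v x - c i x) powr s)) \<in> borel_measurable lborel" for i
    proof -
      have [measurable]: "(\<lambda>x. v x - c i x) \<in> borel_measurable borel"
        by (intro borel_measurable_diff cm) simp
      show ?thesis by (simp add: borel_measurable_norm)
    qed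
    show "(\<lambda>x. ennreal ((2 * real n) powr s) * indicator (cball (0::'a) (R0 + 1)) x) \<in> borel_measurable lborel"
      by (intro borel_measurable_times_ennreal borel_measurable_const borel_measurable_indicator) simp
  qed simp
  then have "(\<lambda>m. \<integral>\<^sup>+x. ennreal (norm (v x - c m x) powr s) \<partial>lborel) \<longlonglongrightarrow> 0"
    by simp
  from order_tendstoD(2)[OF this, of "ennreal d"]
  have "\<forall>\<^sub>F m in sequentially. (\<integral>\<^sup>+x. ennreal (norm (v x - c m x) powr s) \<partial>lborel) < ennreal d"
    using d by simp
  then obtain m where m: "(\<integral>\<^sup>+x. ennreal (norm (v x - c m x) powr s) \<partial>lborel) < ennreal d"
    by (auto simp: eventually_sequentially)
  have "(\<integral>\<^sup>+x. ennreal (norm (w x - c m x) powr s) \<partial>lborel)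
    \<le> (\<integral>\<^sup>+x. ennreal (3 powr s) * (ennreal (norm (w x - v x) powr s) + ennreal (norm (v x - c m x) powr s)) \<partial>lborel)"
  proof (rule nn_integral_mono)
    show "ennreal (norm (w x - c m x) powr s)
      \<le> ennreal (3 powr s) * (ennreal (norm (w x - v x) powr s) + ennreal (norm (v x - c m x) powr s))" for x
      using s0 norm_sum3_powr_le[of s "w x - v x" "v x - c m x" 0] by simp
  qed
  also have "\<dots> = ennreal (3 powr s) * ((\<integral>\<^sup>+x. ennreal (norm (w x - v x) powr s) \<partial>lborel) + (\<integral>\<^sup>+x. ennreal (norm (v x - c m x) powr s) \<partial>lborel))"
  proof -
    have "(\<lambda>x. ennreal (norm (v x - c m x) powr s)) \<in> borel_measurable lborel"
    proof -
      have [measurable]: "(\<lambda>x. v x - c m x) \<in> borel_measurable borel"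
        by (intro borel_measurable_diff cm) simp
      show ?thesis by (simp add: borel_measurable_norm)
    qed
    then show ?thesis by (simp add: nn_integral_cmult nn_integral_add)
  qed
  also have "\<dots> \<le> ennreal (3 powr s) * (ennreal d + ennreal d)"
    using n m by (intro mult_left_mono add_mono) (auto simp: v_def)
  also have "\<dots> = ennreal e"
    using d by (simp flip: ennreal_plus ennreal_mult) (simp add: d_def)
  finally show ?thesis using cc c0 by blast
qed

text \<open>On the support, \<open>norm w \<le> 1 + norm w powr s\<close>.\<close>

lemma integrable_Lp_bounded_support:
  fixes w :: "'a::euclidean_space \<Rightarrow> 'b::euclidean_space"
  assumes [measurable]: "w \<in> borel_measurable borel" and R0: "\<And>x. norm x \<ge> R0 \<Longrightarrow> w x = 0"
    and s: "s \<ge> 1" and fin: "(\<integral>\<^sup>+x. ennreal (norm (w x) powr s) \<partial>lborel) < \<infinity>"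
  shows "integrable lborel w"
proof (rule integrableI_bounded)
  have "(\<integral>\<^sup>+x. ennreal (norm (w x)) \<partial>lborel) \<le> (\<integral>\<^sup>+x. indicator (cball 0 R0) x + ennreal (norm (w x) powr s) \<partial>lborel)"
  proof (rule nn_integral_mono)
    fix x
    have "norm (w x) \<le> norm (w x) powr s" if "norm (w x) > 1"
      using that s powr_mono[of 1 s "norm (w x)"] by simp
    then have "norm (w x) \<le> indicator (cball 0 R0) x + norm (w x) powr s"
      using R0[of x] by (cases "norm (w x) > 1"; cases "norm x \<ge> R0") (auto simp: indicator_def add_increasing2)
    then have "ennreal (norm (w x)) \<le> ennreal (indicator (cball 0 R0) x + norm (w x) powr s)"
      by (rule ennreal_leI)
    then show "ennreal (norm (w x)) \<le> indicator (cball 0 R0) x + ennreal (norm (w x) powr s)"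
      by (simp add: ennreal_plus ennreal_indicator)
  qed
  also have "\<dots> < \<infinity>"
    using fin emeasure_lborel_cball_finite[of "0::'a" R0] by (subst nn_integral_add) (auto intro!: borel_measurable_indicator)
  finally show "(\<integral>\<^sup>+x. ennreal (norm (w x)) \<partial>lborel) < \<infinity>" .
qed simp

text \<open>For a continuous \<open>c\<close> close to \<open>w\<close> in \<open>L\<^sup>s\<close>, the difference splits into the mollification of \<open>w - c\<close>,
  the mollification error of \<open>c\<close>, and \<open>c - w\<close>. Contractivity bounds the first term, uniform
  continuity and bounded support the second.\<close>

lemma mollification_tendsto:
  fixes w :: "'a::euclidean_space \<Rightarrow> 'b::euclidean_space"
  assumes w[measurable]: "w \<in> borel_measurable borel" and R0: "R0 > 0" "\<And>x. norm x \<ge> R0 \<Longrightarrow> w x = 0"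
    and s: "s \<ge> 1" and fin: "(\<integral>\<^sup>+x. ennreal (norm (w x) powr s) \<partial>lborel) < \<infinity>"
    and h: "\<And>k::nat. h k > 0" "h \<longlonglongrightarrow> 0"
  shows "(\<lambda>k. \<integral>\<^sup>+x. ennreal (norm (conv (moll (h k)) w x - w x) powr s) \<partial>lborel) \<longlonglongrightarrow> 0"
proof (rule order_tendstoI)
  fix a :: ennreal assume "0 < a"
  then obtain e where e: "e > 0" "ennreal e < a"
  proof (cases a rule: ennreal_cases)
    case (real r)
    then show ?thesis using \<open>0 < a\<close> that[of "r / 2"] by (simp add: ennreal_less_iff)
  next
    case top
    then show ?thesis using that[of 1] by simp
  qed
  define d where "d = e / (3 * 3 powr s)"
  have d: "d > 0" using e by (simp add: d_def)
  obtain c where c: "continuous_on UNIV c" "\<And>x. norm x \<ge> R0 + 1 \<Longrightarrow> c x = 0"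
    and wc: "(\<integral>\<^sup>+x. ennreal (norm (w x - c x) powr s) \<partial>lborel) \<le> ennreal d"
    using Lp_dense_continuous[OF w R0 s fin d] by blast
  have [measurable]: "c \<in> borel_measurable borel"
    using c(1) by (intro borel_measurable_continuous_onI)
  define B where "B = cball (0::'a) (R0 + 2)"
  obtain a1 c1 :: 'a where box: "cball 0 (R0 + 2) \<subseteq> cbox a1 c1"
    using bounded_subset_cbox_symmetric[of "cball 0 (R0 + 2)"] by (metis bounded_cball)
  have c0: "c y = 0" if "y \<notin> cbox a1 c1" for y
    using that box c(2)[of y] by (force simp: subset_iff)
  define V where "V = measure lborel B"
  have V: "emeasure lborel B = ennreal V"
    unfolding V_def B_def using emeasure_lborel_cball_finite[of "0::'a" "R0 + 2"] by (intro emeasure_eq_ennreal_measure) auto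
  define r where "r = (d / (V + 1)) powr (1 / s)"
  have V0: "V \<ge> 0" by (simp add: V_def)
  have r: "r > 0" "r powr s = d / (V + 1)" using d s V0 by (auto simp: r_def powr_powr)
  have "uniformly_continuous_on B c"
    unfolding B_def by (intro compact_uniformly_continuous continuous_on_subset[OF c(1)]) auto
  then obtain \<mu> where \<mu>: "\<mu> > 0" "\<And>x y. x \<in> B \<Longrightarrow> y \<in> B \<Longrightarrow> dist y x < \<mu> \<Longrightarrow> dist (c y) (c x) < r"
    unfolding uniformly_continuous_on_def using r(1) by metis
  have "\<forall>\<^sub>F k in sequentially. h k < min 1 \<mu>"
    using order_tendstoD(2)[OF h(2), of "min 1 \<mu>"] \<mu>(1) by simp
  then show "\<forall>\<^sub>F k in sequentially. (\<integral>\<^sup>+x. ennreal (norm (conv (moll (h k)) w x - w x) powr s) \<partial>lborel) < a"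
  proof eventually_elim
    case (elim k)
    note hk = h(1)[of k]
    have iw: "integrable lborel w" by (rule integrable_Lp_bounded_support[OF w R0(2) s fin])
    have ic: "integrable lborel c" by (rule integrable_continuous_bounded_support[OF c(1) c0])
    have lin: "conv (moll (h k)) w x = conv (moll (h k)) (\<lambda>y. w y - c y) x + conv (moll (h k)) c x" for x
      unfolding conv_def scaleR_diff_right
      using integrable_moll_scaleR[OF hk iw] integrable_moll_scaleR[OF hk ic] by simp
    have near: "norm (conv (moll (h k)) c x - c x) powr s \<le> d / (V + 1) * indicator B x" for x
    proof (cases "x \<in> B")
      case True
      have "norm (conv (moll (h k)) c x - c x) \<le> r"
      proof (rule norm_conv_moll_diff_le[OF hk c(1) c0])
        fix y assume y: "norm (x - y) < h k"
        show "norm (c y - c x) \<le> r"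
        proof (cases "y \<in> B")
          case yB: True
          with \<mu>(2)[OF True yB] y elim show ?thesis by (auto simp: dist_norm norm_minus_commute)
        next
          case False
          then have "norm y > R0 + 2" by (simp add: B_def)
          moreover have "norm x \<ge> R0 + 1"
            using norm_triangle_ineq2[of y x] y elim calculation by (simp add: norm_minus_commute)
          ultimately show ?thesis using c(2) r by simp
        qed
      qed
      then have "norm (conv (moll (h k)) c x - c x) powr s \<le> r powr s" using s by (intro powr_mono2) auto
      then show ?thesis using r True by simp
    next
      case False
      then have x: "norm x > R0 + 2" by (simp add: B_def)
      have "conv (moll (h k)) c x = 0"
      proof (rule conv_moll_outside[OF hk])
        fix y assume "norm (x - y) < h k"
        then have "norm y \<ge> R0 + 1" using norm_triangle_ineq2[of x y] x elim by simp
        then show "c y = 0" by (rule c(2))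
      qed
      then show ?thesis using c(2)[of x] x False by simp
    qed
    have "(\<integral>\<^sup>+x. ennreal (norm (conv (moll (h k)) w x - w x) powr s) \<partial>lborel)
      \<le> (\<integral>\<^sup>+x. ennreal (3 powr s) * (ennreal (norm (conv (moll (h k)) (\<lambda>y. w y - c y) x) powr s)
          + ennreal (d / (V + 1)) * indicator B x + ennreal (norm (w x - c x) powr s)) \<partial>lborel)"
    proof (rule nn_integral_mono)
      fix x
      have eq: "conv (moll (h k)) w x - w x = conv (moll (h k)) (\<lambda>y. w y - c y) x + (conv (moll (h k)) c x - c x) + (c x - w x)"
        unfolding lin by simp
      have i: "ennreal (d / (V + 1)) * indicator B x = ennreal (d / (V + 1) * indicator B x)"
        by (simp add: indicator_def)
      show "ennreal (norm (conv (moll (h k)) w x - w x) powr s) \<le> ennreal (3 powr s) * (ennreal (norm (conv (moll (h k)) (\<lambda>y. w y - c y) x) powr s)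
          + ennreal (d / (V + 1)) * indicator B x + ennreal (norm (w x - c x) powr s))"
        unfolding eq i using s
        by (intro order_trans[OF norm_sum3_powr_le] mult_left_mono add_mono ennreal_leI near) (auto simp: norm_minus_commute)
    qed
    also have "\<dots> = ennreal (3 powr s) * ((\<integral>\<^sup>+x. ennreal (norm (conv (moll (h k)) (\<lambda>y. w y - c y) x) powr s) \<partial>lborel)
        + ennreal (d / (V + 1)) * emeasure lborel B + (\<integral>\<^sup>+x. ennreal (norm (w x - c x) powr s) \<partial>lborel))"
    proof -
      have m2: "(\<lambda>x. ennreal (d / (V + 1)) * indicator B x) \<in> borel_measurable lborel"
        unfolding B_def
        by (intro borel_measurable_times_ennreal borel_measurable_const borel_measurable_indicator) simp
      have m3: "(\<lambda>x. ennreal (norm (w x - c x) powr s)) \<in> borel_measurable lborel"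
        "(\<lambda>x. ennreal (norm (conv (moll (h k)) (\<lambda>y. w y - c y) x) powr s)) \<in> borel_measurable lborel"
        by measurable
      have "B \<in> sets lborel" by (simp add: B_def)
      then show ?thesis
        using m2 m3 by (simp add: nn_integral_cmult nn_integral_add borel_measurable_add nn_integral_cmult_indicator)
    qed
    also have "\<dots> \<le> ennreal (3 powr s) * (ennreal d + ennreal d + ennreal d)"
    proof (intro mult_left_mono add_mono)
      show "(\<integral>\<^sup>+x. ennreal (norm (conv (moll (h k)) (\<lambda>y. w y - c y) x) powr s) \<partial>lborel) \<le> ennreal d"
        by (rule order_trans[OF nn_integral_conv_moll_le[OF hk s] wc]) measurable
      show "ennreal (d / (V + 1)) * emeasure lborel B \<le> ennreal d"
        unfolding V using d V0 by (simp flip: ennreal_mult add: ennreal_leI field_simps)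
    qed (use wc in auto)
    also have "\<dots> = ennreal e"
      using d by (simp flip: ennreal_plus ennreal_mult) (simp add: d_def)
    finally show ?case using e(2) by (rule le_less_trans)
  qed
qed simp

section \<open>Lebesgue measure on subsets\<close>

lemma open_in_lebesgue: "open S \<Longrightarrow> S \<in> sets lebesgue"
  by (simp add: borel_open sets_completionI_sets)

lemma integral_lebesgue_on:
  fixes f :: "'a::euclidean_space \<Rightarrow> 'b::euclidean_space"
  assumes "S \<in> sets lebesgue"
  shows "(\<integral>x. f x \<partial>lebesgue_on S) = (\<integral>x. indicator S x *\<^sub>R f x \<partial>lebesgue)"
  using assms by (simp add: integral_restrict_space)

lemma integral_lebesgue_on_eq_lborel:
  fixes f :: "'a::euclidean_space \<Rightarrow> 'b::euclidean_space"
  assumes "S \<in> sets lebesgue" and "\<And>x. x \<notin> S \<Longrightarrow> f x = 0" and "f \<in> borel_measurable borel"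
  shows "(\<integral>x. f x \<partial>lebesgue_on S) = (\<integral>x. f x \<partial>lborel)"
proof -
  have "(\<lambda>x. indicator S x *\<^sub>R f x) = f" using assms(2) by (auto simp: indicator_def)
  then show ?thesis
    using assms by (simp add: integral_lebesgue_on integral_completion)
qed

lemma nn_integral_lebesgue_on:
  assumes "S \<in> sets lebesgue"
  shows "(\<integral>\<^sup>+x. f x \<partial>lebesgue_on S) = (\<integral>\<^sup>+x. f x * indicator S x \<partial>lborel)"
  using assms by (simp add: nn_integral_restrict_space nn_integral_completion)

lemma lebesgue_measurable_borel_rep:
  fixes f :: "'a::euclidean_space \<Rightarrow> 'b::euclidean_space"
  assumes f: "f \<in> borel_measurable lebesgue"
  shows "\<exists>g\<in>borel_measurable borel. AE x in lborel. f x = g x"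
proof -
  have "\<forall>b\<in>Basis. \<exists>g\<in>borel_measurable lborel. AE x in lborel. f x \<bullet> b = g x"
  proof
    fix b :: 'b
    have "(\<lambda>x. f x \<bullet> b) \<in> borel_measurable lebesgue" using f by (intro borel_measurable_inner) auto
    then show "\<exists>g\<in>borel_measurable lborel. AE x in lborel. f x \<bullet> b = g x"
      by (rule completion_ex_borel_measurable_real)
  qed
  then have "\<exists>g. \<forall>b\<in>Basis. g b \<in> borel_measurable lborel \<and> (AE x in lborel. f x \<bullet> b = g b x)"
    unfolding Bex_def by (rule bchoice)
  then obtain g where g: "\<And>b. b \<in> Basis \<Longrightarrow> g b \<in> borel_measurable lborel"
    "\<And>b. b \<in> Basis \<Longrightarrow> AE x in lborel. f x \<bullet> b = g b x"
    by blast
  have "AE x in lborel. \<forall>b\<in>Basis. f x \<bullet> b = g b x"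
    unfolding AE_finite_all[OF finite_Basis] using g(2) by blast
  then have ae: "AE x in lborel. f x = (\<Sum>b\<in>Basis. g b x *\<^sub>R b)"
  proof eventually_elim
    case (elim x)
    have "f x = (\<Sum>b\<in>Basis. (f x \<bullet> b) *\<^sub>R b)" by (simp only: euclidean_representation)
    also have "\<dots> = (\<Sum>b\<in>Basis. g b x *\<^sub>R b)" using elim by (intro sum.cong) auto
    finally show ?case .
  qed
  have meas: "(\<lambda>x. \<Sum>b\<in>Basis. g b x *\<^sub>R b) \<in> borel_measurable borel"
  proof (rule borel_measurable_sum)
    fix b :: 'b assume "b \<in> Basis"
    then have [measurable]: "g b \<in> borel_measurable borel" using g(1)[of b] by simp
    show "(\<lambda>x. g b x *\<^sub>R b) \<in> borel_measurable borel" by measurable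
  qed
  show ?thesis by (rule bexI[where x = "\<lambda>x. \<Sum>b\<in>Basis. g b x *\<^sub>R b"]) (use ae meas in simp_all)
qed

section \<open>Test functions and weak derivatives\<close>

lemma test_function_Ck: "\<psi> \<in> test_functions S \<Longrightarrow> Ck_on k UNIV \<psi>"
  by (simp add: test_functions_def)

lemma test_function_continuous: "\<psi> \<in> test_functions S \<Longrightarrow> continuous_on UNIV \<psi>"
  using test_function_Ck[of \<psi> S 0] by simp

lemma dir_deriv_test_continuous: "\<psi> \<in> test_functions S \<Longrightarrow> b \<in> Basis \<Longrightarrow> continuous_on UNIV (dir_deriv b \<psi>)"
  using test_function_Ck[of \<psi> S 1] by simp

lemma dir_deriv_outside_support:
  fixes \<psi> :: "'a::euclidean_space \<Rightarrow> 'b::euclidean_space"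
  assumes x: "x \<notin> closure {x. \<psi> x \<noteq> 0}"
  shows "\<psi> x = 0" "dir_deriv b \<psi> x = 0"
proof -
  define T where "T = closure {x. \<psi> x \<noteq> 0}"
  have T: "open (- T)" "x \<in> - T" using x by (auto simp: T_def)
  have z: "\<psi> y = 0" if "y \<in> - T" for y
  proof (rule ccontr)
    assume "\<psi> y \<noteq> 0"
    then have "y \<in> {x. \<psi> x \<noteq> 0}" by simp
    then have "y \<in> T" unfolding T_def by (rule closure_subset[THEN subsetD])
    then show False using that by simp
  qed
  show "\<psi> x = 0" by (rule z[OF T(2)])
  have "((\<lambda>x. 0) has_derivative (\<lambda>h. 0)) (at x)" by simp
  then have "(\<psi> has_derivative (\<lambda>h. 0)) (at x)"
    by (rule has_derivative_transform_within_open[OF _ T]) (simp add: z)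
  then show "dir_deriv b \<psi> x = 0" by (simp add: dir_deriv_eq)
qed

lemma test_function_outside:
  "\<psi> \<in> test_functions S \<Longrightarrow> x \<notin> S \<Longrightarrow> \<psi> x = 0"
  "\<psi> \<in> test_functions S \<Longrightarrow> x \<notin> S \<Longrightarrow> dir_deriv b \<psi> x = 0"
  using dir_deriv_outside_support(1)[of x \<psi>] dir_deriv_outside_support(2)[of x \<psi> b]
  unfolding test_functions_def by blast+

lemma test_function_box:
  fixes \<psi> :: "'a::euclidean_space \<Rightarrow> 'b::euclidean_space"
  assumes "\<psi> \<in> test_functions S"
  shows "\<exists>a c. \<forall>x. x \<notin> cbox a c \<longrightarrow> \<psi> x = 0 \<and> (\<forall>b. dir_deriv b \<psi> x = 0)"
proof -
  have "bounded (closure {x. \<psi> x \<noteq> 0})"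
    using assms by (auto simp: test_functions_def compact_imp_bounded)
  then obtain a where "closure {x. \<psi> x \<noteq> 0} \<subseteq> cbox (- a) a"
    using bounded_subset_cbox_symmetric by blast
  then show ?thesis using dir_deriv_outside_support[of _ \<psi>] by blast
qed

lemma Ck_on_reflect: "Ck_on k UNIV \<eta> \<Longrightarrow> Ck_on k UNIV (\<lambda>y. \<eta> (x - y))"
proof (induction k arbitrary: \<eta>)
  case 0 then show ?case by (auto intro!: continuous_intros continuous_on_compose2[of UNIV \<eta>])
next
  case (Suc k)
  have "((\<lambda>y. \<eta> (x - y)) has_derivative (\<lambda>h. frechet_derivative \<eta> (at (x - y)) (- h))) (at y)" for y
  proof -
    have "((\<lambda>y. x - y) has_derivative (\<lambda>h. - h)) (at y)" by (auto intro!: derivative_eq_intros)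
    moreover have "(\<eta> has_derivative frechet_derivative \<eta> (at (x - y))) (at (x - y))"
      using Suc.prems by (auto dest: frechet_derivative_works[THEN iffD1])
    ultimately show ?thesis using has_derivative_compose[of "\<lambda>y. x - y" uminus y UNIV \<eta>] by blast
  qed
  moreover have "Ck_on k UNIV (\<lambda>y. frechet_derivative \<eta> (at (x - y)) (- b))" if b: "b \<in> Basis" for b
  proof -
    have "linear (frechet_derivative \<eta> (at z))" for z
      using Suc.prems by (intro linear_frechet_derivative) auto
    then have "frechet_derivative \<eta> (at z) (- b) = (- 1) *\<^sub>R dir_deriv b \<eta> z" for z
      by (simp add: dir_deriv_def linear_neg)
    moreover have "Ck_on k UNIV (\<lambda>y. (- 1) *\<^sub>R dir_deriv b \<eta> (x - y))"
      using Suc.prems b by (intro Ck_on_scaleR Ck_on_const Suc.IH) auto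
    ultimately show ?thesis by simp
  qed
  ultimately show ?case by (rule Ck_on_Suc_UNIV_I)
qed

lemma dir_deriv_reflect:
  assumes "\<eta> differentiable (at (x - y))"
  shows "dir_deriv b (\<lambda>y. \<eta> (x - y)) y = - dir_deriv b \<eta> (x - y)"
proof -
  have D: "(\<eta> has_derivative frechet_derivative \<eta> (at (x - y))) (at (x - y))"
    using assms by (simp add: frechet_derivative_works[THEN iffD1])
  have "((\<lambda>y. x - y) has_derivative uminus) (at y)" by (auto intro!: derivative_eq_intros)
  from has_derivative_compose[OF this D]
  have "dir_deriv b (\<lambda>y. \<eta> (x - y)) y = frechet_derivative \<eta> (at (x - y)) (- b)"
    by (rule dir_deriv_eq)
  then show ?thesis
    using linear_frechet_derivative[OF assms] by (simp add: dir_deriv_def linear_neg)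
qed

lemma moll_test_function:
  assumes h: "h > 0" and sub: "cball x h \<subseteq> S"
  shows "(\<lambda>y. moll h (x - y)) \<in> test_functions S"
proof -
  have "{y. moll h (x - y) \<noteq> 0} \<subseteq> cball x h"
  proof
    fix y assume "y \<in> {y. moll h (x - y) \<noteq> 0}"
    then show "y \<in> cball x h"
      using moll_outside[OF h, of "x - y"] by (cases "h \<le> norm (x - y)") (auto simp: dist_norm)
  qed
  then have *: "closure {y. moll h (x - y) \<noteq> 0} \<subseteq> cball x h"
    by (rule closure_minimal) simp
  then have "bounded (closure {y. moll h (x - y) \<noteq> 0})"
    by (rule bounded_subset[rotated]) simp
  then have "compact (closure {y. moll h (x - y) \<noteq> 0})"
    by (simp add: compact_eq_bounded_closed)
  then show ?thesis
    using * sub by (auto simp: test_functions_def intro!: Ck_on_reflect Ck_on_moll)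
qed

text \<open>By translation invariance all difference quotients of \<open>k\<close> have integral zero. They converge to the
  derivative, dominated by its maximum on a neighbourhood of the support.\<close>

lemma integral_dir_deriv_zero:
  fixes k :: "'a::euclidean_space \<Rightarrow> 'b::euclidean_space"
  assumes k: "Ck_on 1 UNIV k" and supp: "\<And>x. x \<notin> cbox a c \<Longrightarrow> k x = 0" and b: "b \<in> Basis"
  shows "(\<integral>x. dir_deriv b k x \<partial>lborel) = 0"
proof -
  have ck: "continuous_on UNIV k" by (rule Ck_on_continuous[OF k])
  then have [measurable]: "k \<in> borel_measurable borel" by (rule borel_measurable_continuous_onI)
  have ik: "integrable lborel k" by (rule integrable_continuous_bounded_support[OF ck supp])
  have cd: "continuous_on UNIV (dir_deriv b k)" using k b by simp
  have D: "(k has_derivative frechet_derivative k (at x)) (at x)" for x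
    using k by (simp add: frechet_derivative_works[symmetric])
  define q where "q n x = real (Suc n) *\<^sub>R (k (x + inverse (real (Suc n)) *\<^sub>R b) - k x)" for n x
  obtain r where r: "r > 0" "cbox a c \<subseteq> cball 0 r"
    using bounded_cbox[of a c] by (auto simp: bounded_pos subset_iff)
  define B where "B = cball (0::'a) (r + 1)"
  have "compact (dir_deriv b k ` cball 0 (r + 2))"
    by (intro compact_continuous_image continuous_on_subset[OF cd]) auto
  then obtain L where L: "\<And>x. norm x \<le> r + 2 \<Longrightarrow> norm (dir_deriv b k x) \<le> L"
    using compact_imp_bounded by (force simp: bounded_iff)
  have "norm (dir_deriv b k 0) \<le> L" using L[of 0] r by simp
  then have L0: "L \<ge> 0" by (meson norm_ge_zero order_trans)
  \<comment> \<open>the steps of the difference quotients have length at most one, hence the enlarged ball\<close>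
  have qb: "norm (q n x) \<le> L * indicator B x" for n x
  proof (cases "x \<in> B")
    case True
    define t where "t = inverse (real (Suc n))"
    have t: "0 < t" "t \<le> 1" "t * real (Suc n) = 1" by (auto simp: t_def inverse_le_1_iff)
    have "norm (k (x + t *\<^sub>R b) - k (x + 0 *\<^sub>R b)) \<le> L * norm (t - 0)"
    proof (rule differentiable_bound[where S = "{0..1}" and f = "\<lambda>s. k (x + s *\<^sub>R b)" and f' = "\<lambda>s h. frechet_derivative k (at (x + s *\<^sub>R b)) (h *\<^sub>R b)"])
      fix s :: real assume s: "s \<in> {0..1}"
      have "((\<lambda>s. x + s *\<^sub>R b) has_derivative (\<lambda>h. h *\<^sub>R b)) (at s within {0..1})"
        by (auto intro!: derivative_eq_intros)
      from has_derivative_compose[OF this D]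
      show "((\<lambda>s. k (x + s *\<^sub>R b)) has_derivative (\<lambda>h. frechet_derivative k (at (x + s *\<^sub>R b)) (h *\<^sub>R b))) (at s within {0..1})" .
      have "norm (x + s *\<^sub>R b) \<le> r + 1 + 1"
        using True s b by (intro order_trans[OF norm_triangle_ineq] add_mono) (auto simp: B_def)
      then have *: "norm (dir_deriv b k (x + s *\<^sub>R b)) \<le> L" by (intro L) simp
      have "frechet_derivative k (at (x + s *\<^sub>R b)) (h *\<^sub>R b) = h *\<^sub>R dir_deriv b k (x + s *\<^sub>R b)" for h
        using linear_frechet_derivative[of k "at (x + s *\<^sub>R b)"] k by (simp add: dir_deriv_def linear_scale)
      then show "onorm (\<lambda>h. frechet_derivative k (at (x + s *\<^sub>R b)) (h *\<^sub>R b)) \<le> L"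
        using * L0 by (intro onorm_le) (simp add: mult.commute[of L] mult_left_mono)
    qed (use t in auto)
    then have "norm (k (x + t *\<^sub>R b) - k x) \<le> L * t" using t by simp
    then have "real (Suc n) * norm (k (x + t *\<^sub>R b) - k x) \<le> real (Suc n) * (L * t)"
      by (intro mult_left_mono) auto
    also have "\<dots> = L" using t(3) by (simp add: mult.commute mult.left_commute)
    finally show ?thesis using True by (simp add: q_def t_def)
  next
    case False
    then have x: "norm x > r + 1" by (simp add: B_def)
    then have "k x = 0" using r by (intro supp) auto
    moreover have "norm x - 1 \<le> norm (x + inverse (real (Suc n)) *\<^sub>R b)"
      proof -
      have "norm (inverse (real (Suc n)) *\<^sub>R b) \<le> 1" using b by (simp add: inverse_le_1_iff)
      then show ?thesis using norm_diff_ineq[of x "inverse (real (Suc n)) *\<^sub>R b"] by linarith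
    qed
    then have "k (x + inverse (real (Suc n)) *\<^sub>R b) = 0" using r x by (intro supp) auto
    ultimately show ?thesis using False by (simp add: q_def)
  qed
  have qint: "(\<integral>x. q n x \<partial>lborel) = 0" for n
  proof -
    have "(\<lambda>x. k (inverse (real (Suc n)) *\<^sub>R b + x)) \<in> borel_measurable lborel" by measurable
    moreover have "(\<integral>\<^sup>+x. ennreal (norm (k (inverse (real (Suc n)) *\<^sub>R b + x))) \<partial>lborel) < \<infinity>"
      using ik nn_integral_lborel_shift[of "\<lambda>x. ennreal (norm (k x))" "inverse (real (Suc n)) *\<^sub>R b"]
      by (simp add: integrable_iff_bounded)
    ultimately have "integrable lborel (\<lambda>x. k (inverse (real (Suc n)) *\<^sub>R b + x))"
      by (rule integrableI_bounded)
    then have i2: "integrable lborel (\<lambda>x. k (x + inverse (real (Suc n)) *\<^sub>R b))"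
      by (simp only: add.commute)
    have "(\<integral>x. k (inverse (real (Suc n)) *\<^sub>R b + x) \<partial>lborel) = (\<integral>x. k x \<partial>lborel)"
      by (rule integral_lborel_shift) measurable
    then have "(\<integral>x. k (x + inverse (real (Suc n)) *\<^sub>R b) \<partial>lborel) = (\<integral>x. k x \<partial>lborel)"
      by (simp only: add.commute)
    then have "(\<integral>x. k (x + inverse (real (Suc n)) *\<^sub>R b) - k x \<partial>lborel) = 0"
      by (simp only: Bochner_Integration.integral_diff[OF i2 ik] diff_self)
    then show ?thesis by (simp only: q_def integral_scaleR_right scaleR_zero_right)
  qed
  have "(\<lambda>n. \<integral>x. q n x \<partial>lborel) \<longlonglongrightarrow> (\<integral>x. dir_deriv b k x \<partial>lborel)"
  proof (rule integral_dominated_convergence[where w = "\<lambda>x. L * indicator B x"])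
    show "dir_deriv b k \<in> borel_measurable lborel"
      using borel_measurable_continuous_onI[OF cd] by simp
    show "q n \<in> borel_measurable lborel" for n
      unfolding q_def[abs_def] by measurable
    show "integrable lborel (\<lambda>x. L * indicator B x)"
      unfolding B_def using emeasure_lborel_cball_finite[of "0::'a" "r + 1"]
      by (intro integrable_mult_right integrable_real_indicator) auto
    show "AE x in lborel. (\<lambda>n. q n x) \<longlonglongrightarrow> dir_deriv b k x"
    proof (rule AE_I2)
      fix x
      define t where "t n = inverse (real (Suc n)) *\<^sub>R b" for n
      have "(\<lambda>h. norm (k (x + h) - k x - frechet_derivative k (at x) h) / norm h) \<midarrow>0\<rightarrow> 0"
        using D[of x] by (simp add: has_derivative_at)
      moreover have "filterlim t (at 0) sequentially"
      proof -
        have "t \<longlonglongrightarrow> 0 *\<^sub>R b"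
          unfolding t_def by (intro tendsto_scaleR LIMSEQ_inverse_real_of_nat tendsto_const)
        moreover have "t n \<noteq> 0" for n using b nonzero_Basis[OF b] by (simp add: t_def)
        ultimately show ?thesis by (simp add: filterlim_at)
      qed
      ultimately have lim: "(\<lambda>n. norm (k (x + t n) - k x - frechet_derivative k (at x) (t n)) / norm (t n)) \<longlonglongrightarrow> 0"
        by (rule filterlim_compose)
      have eq: "norm (k (x + t n) - k x - frechet_derivative k (at x) (t n)) / norm (t n) = norm (q n x - dir_deriv b k x)" for n
      proof -
        have "frechet_derivative k (at x) (t n) = inverse (real (Suc n)) *\<^sub>R dir_deriv b k x"
          using linear_frechet_derivative[of k "at x"] k by (simp add: dir_deriv_def linear_scale t_def)
        then have "q n x - dir_deriv b k x = real (Suc n) *\<^sub>R (k (x + t n) - k x - frechet_derivative k (at x) (t n))"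
          by (simp add: q_def t_def scaleR_diff_right)
        moreover have "norm (t n) = inverse (real (Suc n))" using b by (simp add: t_def)
        ultimately show ?thesis by (simp add: divide_inverse mult.commute)
      qed
      from lim have "(\<lambda>n. norm (q n x - dir_deriv b k x)) \<longlonglongrightarrow> 0" unfolding eq .
      then show "(\<lambda>n. q n x) \<longlonglongrightarrow> dir_deriv b k x"
        by (simp add: tendsto_norm_zero_iff LIM_zero_iff)
    qed
  qed (use qb in auto)
  then show ?thesis by (simp add: qint LIMSEQ_const_iff)
qed

text \<open>For products of a function on \<open>S\<close> with a test function \<open>\<zeta>\<close> or with one of its derivatives: \<open>S\<close> and the
  complement of \<open>T\<close> form an open cover on whose members continuity is clear.\<close>

lemma continuous_zero_extension:
  fixes \<zeta> :: "'a::euclidean_space \<Rightarrow> real" and w :: "'a \<Rightarrow> 'b::euclidean_space"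
  assumes S: "open S" and T: "closed T" "T \<subseteq> S" and z: "continuous_on UNIV \<zeta>" "\<And>x. x \<notin> T \<Longrightarrow> \<zeta> x = 0"
    and w: "continuous_on S w"
  shows "continuous_on UNIV (\<lambda>x. if x \<in> S then \<zeta> x *\<^sub>R w x else 0)" (is "continuous_on _ ?f")
proof -
  have "continuous_on S ?f"
  proof (subst continuous_on_cong[OF refl])
    show "continuous_on S (\<lambda>x. \<zeta> x *\<^sub>R w x)"
      by (intro continuous_on_scaleR continuous_on_subset[OF z(1)] w) auto
  qed auto
  moreover have "continuous_on (- T) ?f"
  proof (subst continuous_on_cong[OF refl])
    show "continuous_on (- T) (\<lambda>x. 0 :: 'b)" by simp
  qed (use z(2) in auto)
  ultimately have "continuous_on (S \<union> - T) ?f"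
    using S T by (intro continuous_on_open_Un) auto
  moreover have "S \<union> - T = UNIV" using T by auto
  ultimately show ?thesis by simp
qed

lemma test_function_product:
  fixes \<psi> :: "'a::euclidean_space \<Rightarrow> real" and u :: "'a \<Rightarrow> 'b::euclidean_space"
  assumes S: "open S" and u: "Ck_on 1 S u" and \<psi>: "\<psi> \<in> test_functions S"
  defines "k \<equiv> \<lambda>x. if x \<in> S then \<psi> x *\<^sub>R u x else 0"
  shows "Ck_on 1 UNIV k"
    and "b \<in> Basis \<Longrightarrow> dir_deriv b k = (\<lambda>x. (if x \<in> S then \<psi> x *\<^sub>R dir_deriv b u x else 0) + (if x \<in> S then dir_deriv b \<psi> x *\<^sub>R u x else 0))"
    and "b \<in> Basis \<Longrightarrow> continuous_on UNIV (\<lambda>x. if x \<in> S then \<psi> x *\<^sub>R dir_deriv b u x else 0)"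
    and "b \<in> Basis \<Longrightarrow> continuous_on UNIV (\<lambda>x. if x \<in> S then dir_deriv b \<psi> x *\<^sub>R u x else 0)"
proof -
  define T where "T = closure {x. \<psi> x \<noteq> 0}"
  have T: "closed T" "T \<subseteq> S" using \<psi> by (auto simp: T_def test_functions_def)
  have out: "\<psi> x = 0" "dir_deriv b \<psi> x = 0" if "x \<notin> T" for x b
    using that dir_deriv_outside_support[of x \<psi>] by (auto simp: T_def)
  have cu: "continuous_on S u" by (rule Ck_on_continuous[OF u])
  have D: "(k has_derivative (\<lambda>h. if x \<in> S then \<psi> x *\<^sub>R frechet_derivative u (at x) h + frechet_derivative \<psi> (at x) h *\<^sub>R u x else 0)) (at x)" for x
  proof (cases "x \<in> S")
    case True
    have "(u has_derivative frechet_derivative u (at x)) (at x)" "(\<psi> has_derivative frechet_derivative \<psi> (at x)) (at x)"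
      using u True test_function_Ck[OF \<psi>, of 1] by (auto simp: frechet_derivative_works[symmetric])
    then have "((\<lambda>x. \<psi> x *\<^sub>R u x) has_derivative (\<lambda>h. \<psi> x *\<^sub>R frechet_derivative u (at x) h + frechet_derivative \<psi> (at x) h *\<^sub>R u x)) (at x)"
      by (intro has_derivative_scaleR)
    then have "(k has_derivative (\<lambda>h. \<psi> x *\<^sub>R frechet_derivative u (at x) h + frechet_derivative \<psi> (at x) h *\<^sub>R u x)) (at x)"
      by (rule has_derivative_transform_within_open[OF _ S True]) (simp add: k_def)
    then show ?thesis using True by simp
  next
    case False
    have "((\<lambda>x. 0 :: 'b) has_derivative (\<lambda>h. 0)) (at x)" by simp
    then have "(k has_derivative (\<lambda>h. 0)) (at x)"
      by (rule has_derivative_transform_within_open[where s = "- T"]) (use T False out in \<open>auto simp: k_def\<close>)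
    then show ?thesis using False by simp
  qed
  show dk: "dir_deriv b k = (\<lambda>x. (if x \<in> S then \<psi> x *\<^sub>R dir_deriv b u x else 0) + (if x \<in> S then dir_deriv b \<psi> x *\<^sub>R u x else 0))" for b
  proof
    show "dir_deriv b k x = (if x \<in> S then \<psi> x *\<^sub>R dir_deriv b u x else 0) + (if x \<in> S then dir_deriv b \<psi> x *\<^sub>R u x else 0)" for x
      using dir_deriv_eq[OF D, of b x] by (simp add: dir_deriv_def)
  qed
  show c1: "continuous_on UNIV (\<lambda>x. if x \<in> S then \<psi> x *\<^sub>R dir_deriv b u x else 0)" if "b \<in> Basis" for b
    using u that by (intro continuous_zero_extension[OF S T test_function_continuous[OF \<psi>]] out) auto
  show c2: "continuous_on UNIV (\<lambda>x. if x \<in> S then dir_deriv b \<psi> x *\<^sub>R u x else 0)" if "b \<in> Basis" for b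
    by (intro continuous_zero_extension[OF S T dir_deriv_test_continuous[OF \<psi> that]] out cu)
  show "Ck_on 1 UNIV k"
  proof -
    have "k differentiable (at x)" for x using D[of x] by (auto simp: differentiable_def)
    moreover have "continuous_on UNIV (dir_deriv b k)" if "b \<in> Basis" for b
      unfolding dk by (intro continuous_on_add c1 c2 that)
    ultimately show ?thesis by simp
  qed
qed

lemma continuous_on_locally_integrable:
  assumes "continuous_on S u"
  shows "locally_integrable S u"
  unfolding locally_integrable_def
proof (intro allI impI)
  fix K assume K: "compact K \<and> K \<subseteq> S"
  then have "continuous_on K u" using assms continuous_on_subset by blast
  with K have "integrable lborel (\<lambda>x. indicator K x *\<^sub>R u x)"
    by (intro borel_integrable_compact) auto
  then have "integrable lebesgue (\<lambda>x. indicator K x *\<^sub>R u x)"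
    by (simp add: integrable_completion borel_measurable_integrable)
  moreover have "K \<in> sets lebesgue" using K by (intro lmeasurable_compact[THEN fmeasurableD]) auto
  ultimately show "integrable (lebesgue_on K) u"
    by (simp add: integrable_restrict_space)
qed

text \<open>Integration by parts: the product of \<open>u\<close> with a test function, extended by zero, is continuously
  differentiable with bounded support, so the integral of its derivative vanishes.\<close>

lemma has_weak_deriv_classical:
  fixes u :: "'a::euclidean_space \<Rightarrow> 'b::euclidean_space"
  assumes S: "open S" and u: "Ck_on 1 S u" and b: "b \<in> Basis"
  shows "has_weak_deriv S b u (dir_deriv b u)"
  unfolding has_weak_deriv_def
proof (intro conjI ballI)
  show "locally_integrable S u" by (rule continuous_on_locally_integrable[OF Ck_on_continuous[OF u]])
  show "locally_integrable S (dir_deriv b u)" using u b by (intro continuous_on_locally_integrable) simp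
  fix \<psi> :: "'a \<Rightarrow> real" assume \<psi>: "\<psi> \<in> test_functions S"
  obtain a c where box: "\<And>x. x \<notin> cbox a c \<Longrightarrow> \<psi> x = 0 \<and> (\<forall>b. dir_deriv b \<psi> x = 0)"
    using test_function_box[OF \<psi>] by blast
  define k where "k x = (if x \<in> S then \<psi> x *\<^sub>R u x else 0)" for x
  define f where "f x = (if x \<in> S then \<psi> x *\<^sub>R dir_deriv b u x else 0)" for x
  define g where "g x = (if x \<in> S then dir_deriv b \<psi> x *\<^sub>R u x else 0)" for x
  note P1 = test_function_product(1)[OF S u \<psi>, folded k_def[abs_def]]
  note P2 = test_function_product(2)[OF S u \<psi> b, folded k_def[abs_def] f_def g_def]
  note P3 = test_function_product(3)[OF S u \<psi> b, folded f_def[abs_def]]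
  note P4 = test_function_product(4)[OF S u \<psi> b, folded g_def[abs_def]]
  have fi: "integrable lborel f"
    by (rule integrable_continuous_bounded_support[OF P3, of a c]) (use box in \<open>simp add: f_def\<close>)
  have ig: "integrable lborel g"
    by (rule integrable_continuous_bounded_support[OF P4, of a c]) (use box in \<open>simp add: g_def\<close>)
  have "(\<integral>x. dir_deriv b k x \<partial>lborel) = 0"
    by (rule integral_dir_deriv_zero[OF P1 _ b, of a c]) (use box in \<open>simp add: k_def\<close>)
  then have "(\<integral>x. f x + g x \<partial>lborel) = 0"
    unfolding P2 .
  then have sum0: "(\<integral>x. f x \<partial>lborel) + (\<integral>x. g x \<partial>lborel) = 0"
    using fi ig by simp
  have S': "S \<in> sets lebesgue" by (rule open_in_lebesgue[OF S])
  have "(\<integral>x. dir_deriv b \<psi> x *\<^sub>R u x \<partial>lebesgue_on S) = (\<integral>x. g x \<partial>lebesgue_on S)"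
    by (intro Bochner_Integration.integral_cong) (auto simp: g_def)
  also have "\<dots> = (\<integral>x. g x \<partial>lborel)"
    by (rule integral_lebesgue_on_eq_lborel[OF S' _ borel_measurable_continuous_onI[OF P4]]) (simp add: g_def)
  finally have 1: "(\<integral>x. dir_deriv b \<psi> x *\<^sub>R u x \<partial>lebesgue_on S) = (\<integral>x. g x \<partial>lborel)" .
  have "(\<integral>x. \<psi> x *\<^sub>R dir_deriv b u x \<partial>lebesgue_on S) = (\<integral>x. f x \<partial>lebesgue_on S)"
    by (intro Bochner_Integration.integral_cong) (auto simp: f_def)
  also have "\<dots> = (\<integral>x. f x \<partial>lborel)"
    by (rule integral_lebesgue_on_eq_lborel[OF S' _ borel_measurable_continuous_onI[OF P3]]) (simp add: f_def)
  finally show "(\<integral>x. dir_deriv b \<psi> x *\<^sub>R u x \<partial>lebesgue_on S) = - (\<integral>x. \<psi> x *\<^sub>R dir_deriv b u x \<partial>lebesgue_on S)"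
    using 1 sum0 by (simp add: eq_neg_iff_add_eq_0 add.commute)
qed

text \<open>The fundamental lemma of the calculus of variations. A mollification of \<open>g\<close> at a point \<open>x\<close> tests \<open>g\<close> against
  a translated mollifier, so it vanishes as soon as the ball of radius \<open>h\<close> about \<open>x\<close> lies in \<open>S\<close>.
  Since mollifications converge in \<open>L\<^sup>1\<close>, the function \<open>g\<close> is zero almost everywhere near each point
  of \<open>S\<close>, and local negligibility implies negligibility.\<close>

lemma fundamental_lemma:
  fixes g :: "'a::euclidean_space \<Rightarrow> 'b::euclidean_space"
  assumes S: "open S" and g: "locally_integrable S g"
    and zero: "\<And>\<psi> :: 'a \<Rightarrow> real. \<psi> \<in> test_functions S \<Longrightarrow> (\<integral>x. \<psi> x *\<^sub>R g x \<partial>lebesgue_on S) = 0"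
  shows "AE x in lebesgue_on S. g x = 0"
proof -
  have ball: "\<exists>r>0. negligible {x \<in> ball x0 r. g x \<noteq> 0} \<and> ball x0 r \<subseteq> S" if x0: "x0 \<in> S" for x0
  proof -
    obtain e where e: "e > 0" "cball x0 e \<subseteq> S" using S x0 by (meson open_contains_cball)
    define r where "r = e / 2"
    have r: "r > 0" "cball x0 (2 * r) \<subseteq> S" using e by (auto simp: r_def)
    \<comment> \<open>on the ball of radius \<open>r\<close>, mollifiers of width at most \<open>r\<close> only see \<open>K\<close>\<close>
    define K where "K = cball x0 (2 * r)"
    have K: "compact K" "K \<subseteq> S" "K \<in> sets lebesgue" using r by (auto simp: K_def intro: lmeasurable_compact[THEN fmeasurableD])
    have "integrable (lebesgue_on K) g" using g K by (auto simp: locally_integrable_def)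
    then have i1: "integrable lebesgue (\<lambda>x. indicator K x *\<^sub>R g x)"
      using K by (simp add: integrable_restrict_space)
    obtain g0 where g0: "g0 \<in> borel_measurable borel" "AE x in lborel. indicator K x *\<^sub>R g x = g0 x"
      using lebesgue_measurable_borel_rep[OF borel_measurable_integrable[OF i1]] by blast
    define g1 where "g1 x = indicator K x *\<^sub>R g0 x" for x
    have Kb: "K \<in> sets borel" by (simp add: K_def)
    have g1m: "g1 \<in> borel_measurable borel"
      unfolding g1_def[abs_def] by (intro borel_measurable_scaleR borel_measurable_indicator Kb g0(1))
    have ae1: "AE x in lborel. indicator K x *\<^sub>R g x = g1 x"
      using g0(2) by eventually_elim (auto simp: g1_def indicator_def)
    define R0 where "R0 = norm x0 + 2 * r + 1"
    have R0: "R0 > 0" "\<And>x. norm x \<ge> R0 \<Longrightarrow> g1 x = 0"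
    proof -
      show "R0 > 0" using r norm_ge_zero[of x0] unfolding R0_def by linarith
      fix x :: 'a assume "norm x \<ge> R0"
      then have "x \<notin> K" using norm_triangle_sub[of x x0] by (auto simp: K_def R0_def dist_norm norm_minus_commute)
      then show "g1 x = 0" by (simp add: g1_def)
    qed
    have "(\<integral>\<^sup>+x. ennreal (norm (g1 x) powr 1) \<partial>lborel) = (\<integral>\<^sup>+x. ennreal (norm (indicator K x *\<^sub>R g x)) \<partial>lborel)"
    proof (rule nn_integral_cong_AE)
      show "AE x in lborel. ennreal (norm (g1 x) powr 1) = ennreal (norm (indicator K x *\<^sub>R g x))"
        using ae1 by eventually_elim (simp del: norm_scaleR)
    qed
    also have "\<dots> = (\<integral>\<^sup>+x. ennreal (norm (indicator K x *\<^sub>R g x)) \<partial>lebesgue)"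
      by (simp only: nn_integral_completion)
    also have "\<dots> < \<infinity>" using i1 unfolding integrable_iff_bounded by simp
    finally have fin: "(\<integral>\<^sup>+x. ennreal (norm (g1 x) powr 1) \<partial>lborel) < \<infinity>" .
    define h where "h n = r * inverse (real (Suc n))" for n
    have h: "h n > 0" "h n \<le> r" for n
      using r by (auto simp: h_def inverse_le_1_iff mult_left_le)
    have "h \<longlonglongrightarrow> r * 0" unfolding h_def by (intro tendsto_mult tendsto_const LIMSEQ_inverse_real_of_nat)
    then have h0: "h \<longlonglongrightarrow> 0" by simp
    have conv0: "conv (moll (h n)) g1 x = 0" if x: "x \<in> ball x0 r" for n x
    proof -
      have sub: "cball x (h n) \<subseteq> K"
      proof
        fix y assume "y \<in> cball x (h n)"
        then show "y \<in> K" using h(2)[of n] x dist_triangle[of x0 y x] by (auto simp: K_def dist_commute)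
      qed
      have t: "(\<lambda>y. moll (h n) (x - y)) \<in> test_functions S"
        by (rule moll_test_function[OF h(1)]) (use sub K in blast)
      have m0: "moll (h n) (x - y) = 0" if "y \<notin> K" for y
        using moll_outside[OF h(1), of n "x - y"] sub that by (auto simp: dist_norm subset_iff) (meson not_le less_imp_le)
      have mm: "(\<lambda>y. moll (h n) (x - y)) \<in> borel_measurable borel" by measurable
      have "0 = (\<integral>y. moll (h n) (x - y) *\<^sub>R g y \<partial>lebesgue_on S)" using zero[OF t] by simp
      also have "\<dots> = (\<integral>y. indicator S y *\<^sub>R (moll (h n) (x - y) *\<^sub>R g y) \<partial>lebesgue)"
        by (rule integral_lebesgue_on[OF open_in_lebesgue[OF S]])
      also have "\<dots> = (\<integral>y. moll (h n) (x - y) *\<^sub>R (indicator K y *\<^sub>R g y) \<partial>lebesgue)"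
        by (intro Bochner_Integration.integral_cong) (use m0 K in \<open>auto simp: indicator_def\<close>)
      also have "\<dots> = (\<integral>y. moll (h n) (x - y) *\<^sub>R g1 y \<partial>lebesgue)"
      proof (rule integral_cong_AE)
        have mm': "(\<lambda>y. moll (h n) (x - y)) \<in> borel_measurable lebesgue" using mm by (simp add: measurable_completion)
        show "(\<lambda>y. moll (h n) (x - y) *\<^sub>R (indicator K y *\<^sub>R g y)) \<in> borel_measurable lebesgue"
          by (rule borel_measurable_scaleR[OF mm' borel_measurable_integrable[OF i1]])
        show "(\<lambda>y. moll (h n) (x - y) *\<^sub>R g1 y) \<in> borel_measurable lebesgue"
          using g1m by (intro borel_measurable_scaleR[OF mm']) (simp add: measurable_completion)
        show "AE y in lebesgue. moll (h n) (x - y) *\<^sub>R (indicator K y *\<^sub>R g y) = moll (h n) (x - y) *\<^sub>R g1 y"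
          using ae1[THEN AE_completion] by eventually_elim simp
      qed
      also have "\<dots> = conv (moll (h n)) g1 x"
        unfolding conv_def using mm g1m by (intro integral_completion borel_measurable_scaleR) simp_all
      finally show ?thesis by simp
    qed
    have bb: "ball x0 r \<in> sets lborel" by simp
    have le: "(\<integral>\<^sup>+x. ennreal (norm (g1 x)) * indicator (ball x0 r) x \<partial>lborel) \<le> (\<integral>\<^sup>+x. ennreal (norm (conv (moll (h n)) g1 x - g1 x) powr 1) \<partial>lborel)" for n
    proof (rule nn_integral_mono)
      show "ennreal (norm (g1 x)) * indicator (ball x0 r) x \<le> ennreal (norm (conv (moll (h n)) g1 x - g1 x) powr 1)" for x
        using conv0[of x n] by (cases "x \<in> ball x0 r") auto
    qed
    have "(\<lambda>n. \<integral>\<^sup>+x. ennreal (norm (conv (moll (h n)) g1 x - g1 x) powr 1) \<partial>lborel) \<longlonglongrightarrow> 0"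
      by (rule mollification_tendsto[OF g1m R0 _ fin h(1) h0]) auto
    then have "(\<integral>\<^sup>+x. ennreal (norm (g1 x)) * indicator (ball x0 r) x \<partial>lborel) \<le> 0"
      by (rule LIMSEQ_le_const) (use le in blast)
    then have "(\<integral>\<^sup>+x. ennreal (norm (g1 x)) * indicator (ball x0 r) x \<partial>lborel) = 0" by simp
    moreover have gm: "(\<lambda>x. ennreal (norm (g1 x)) * indicator (ball x0 r) x) \<in> borel_measurable lborel"
    proof -
      have "(\<lambda>x. ennreal (norm (g1 x))) \<in> borel_measurable lborel" using g1m by simp
      then show ?thesis by (rule borel_measurable_times_ennreal) (rule borel_measurable_indicator[OF bb])
    qed
    ultimately have "AE x in lborel. ennreal (norm (g1 x)) * indicator (ball x0 r) x = 0"
      by (simp add: nn_integral_0_iff_AE)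
    with ae1 have "AE x in lborel. \<not> (x \<in> ball x0 r \<and> g x \<noteq> 0)"
    proof eventually_elim
      case (elim x)
      have "x \<in> ball x0 r \<Longrightarrow> x \<in> K" using r by (auto simp: K_def)
      then show ?case using elim by (auto simp: indicator_def)
    qed
    then have "AE x in lebesgue. x \<notin> {x \<in> ball x0 r. g x \<noteq> 0}"
      by (rule AE_mp[OF AE_completion]) auto
    then obtain N where "N \<in> null_sets lebesgue" "{x \<in> ball x0 r. g x \<noteq> 0} \<subseteq> N"
      unfolding eventually_ae_filter by auto
    then have "negligible {x \<in> ball x0 r. g x \<noteq> 0}"
      using negligible_iff_null_sets negligible_subset by blast
    then show ?thesis using r K by (auto simp: K_def intro!: exI[of _ r])
  qed
  have "negligible {x \<in> S. g x \<noteq> 0}"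
  proof (subst locally_negligible_alt, rule ballI)
    fix x0 assume x0: "x0 \<in> {x \<in> S. g x \<noteq> 0}"
    then obtain r where r: "r > 0" "negligible {x \<in> ball x0 r. g x \<noteq> 0}" "ball x0 r \<subseteq> S" using ball by blast
    have "openin (top_of_set {x \<in> S. g x \<noteq> 0}) ({x \<in> S. g x \<noteq> 0} \<inter> ball x0 r)"
      by (intro openin_open_Int) simp
    moreover have "negligible ({x \<in> S. g x \<noteq> 0} \<inter> ball x0 r)"
      by (rule negligible_subset[OF r(2)]) auto
    ultimately show "\<exists>U. openin (top_of_set {x \<in> S. g x \<noteq> 0}) U \<and> x0 \<in> U \<and> negligible U"
      using x0 r(1) by (intro exI[of _ "{x \<in> S. g x \<noteq> 0} \<inter> ball x0 r"]) auto
  qed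
  then have "{x \<in> S. g x \<noteq> 0} \<in> null_sets lebesgue" by (simp add: negligible_iff_null_sets)
  then have "AE x in lebesgue. x \<notin> {x \<in> S. g x \<noteq> 0}" by (rule AE_not_in)
  then show ?thesis
    by (subst AE_restrict_space_iff) (auto simp: open_in_lebesgue[OF S] elim: eventually_mono)
qed

lemma integrable_cutoff_scaleR:
  fixes \<psi> :: "'a::euclidean_space \<Rightarrow> real" and z :: "'a \<Rightarrow> 'b::euclidean_space"
  assumes S: "open S" and K: "compact K" "K \<subseteq> S" and c: "continuous_on UNIV \<psi>"
    and out: "\<And>x. x \<notin> K \<Longrightarrow> \<psi> x = 0" and z: "locally_integrable S z"
  shows "integrable (lebesgue_on S) (\<lambda>x. \<psi> x *\<^sub>R z x)"
proof -
  have Ks: "K \<in> sets lebesgue" using K(1) by (rule lmeasurable_compact[THEN fmeasurableD])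
  have i: "integrable lebesgue (\<lambda>x. indicator K x *\<^sub>R z x)"
    using z K Ks by (auto simp: locally_integrable_def integrable_restrict_space)
  obtain C where C: "\<And>x. x \<in> K \<Longrightarrow> \<bar>\<psi> x\<bar> \<le> C"
    using compact_imp_bounded[OF compact_continuous_image[OF continuous_on_subset[OF c] K(1)]] by (auto simp: bounded_iff)
  have eq: "indicator S x *\<^sub>R (\<psi> x *\<^sub>R z x) = \<psi> x *\<^sub>R (indicator K x *\<^sub>R z x)" for x
    using K(2) out[of x] by (cases "x \<in> K") (auto simp: indicator_def)
  have "integrable lebesgue (\<lambda>x. \<psi> x *\<^sub>R (indicator K x *\<^sub>R z x))"
  proof (rule Bochner_Integration.integrable_bound)
    show "integrable lebesgue (\<lambda>x. C * norm (indicator K x *\<^sub>R z x))" using i by (intro integrable_mult_right integrable_norm)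
    have "\<psi> \<in> borel_measurable lebesgue"
      using borel_measurable_continuous_onI[OF c] by (simp add: measurable_completion)
    then show "(\<lambda>x. \<psi> x *\<^sub>R (indicator K x *\<^sub>R z x)) \<in> borel_measurable lebesgue"
      by (rule borel_measurable_scaleR[OF _ borel_measurable_integrable[OF i]])
    show "AE x in lebesgue. norm (\<psi> x *\<^sub>R (indicator K x *\<^sub>R z x)) \<le> norm (C * norm (indicator K x *\<^sub>R z x))"
    proof (rule AE_I2)
      show "norm (\<psi> x *\<^sub>R (indicator K x *\<^sub>R z x)) \<le> norm (C * norm (indicator K x *\<^sub>R z x))" for x
        using C[of x] by (cases "x \<in> K") (auto simp: abs_mult intro!: mult_right_mono)
    qed
  qed
  then have "integrable lebesgue (\<lambda>x. indicator S x *\<^sub>R (\<psi> x *\<^sub>R z x))" unfolding eq .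
  then show ?thesis using open_in_lebesgue[OF S] by (subst integrable_restrict_space) auto
qed

lemma integrable_test_scaleR:
  fixes \<psi> :: "'a::euclidean_space \<Rightarrow> real" and z :: "'a \<Rightarrow> 'b::euclidean_space"
  assumes S: "open S" and \<psi>: "\<psi> \<in> test_functions S" and z: "locally_integrable S z"
  shows "integrable (lebesgue_on S) (\<lambda>x. \<psi> x *\<^sub>R z x)"
    and "b \<in> Basis \<Longrightarrow> integrable (lebesgue_on S) (\<lambda>x. dir_deriv b \<psi> x *\<^sub>R z x)"
proof -
  define K where "K = closure {x. \<psi> x \<noteq> 0}"
  have K: "compact K" "K \<subseteq> S" using \<psi> by (auto simp: K_def test_functions_def)
  note out = dir_deriv_outside_support[of _ \<psi>, folded K_def]
  show "integrable (lebesgue_on S) (\<lambda>x. \<psi> x *\<^sub>R z x)"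
    by (rule integrable_cutoff_scaleR[OF S K test_function_continuous[OF \<psi>] out(1) z])
  show "integrable (lebesgue_on S) (\<lambda>x. dir_deriv b \<psi> x *\<^sub>R z x)" if "b \<in> Basis"
    by (rule integrable_cutoff_scaleR[OF S K dir_deriv_test_continuous[OF \<psi> that] out(2) z])
qed

lemma weak_deriv_unique:
  fixes u :: "'a::euclidean_space \<Rightarrow> 'b::euclidean_space"
  assumes S: "open S" and v: "has_weak_deriv S b u v" and w: "has_weak_deriv S b u w"
  shows "AE x in lebesgue_on S. v x = w x"
proof -
  have li: "locally_integrable S v" "locally_integrable S w" using v w by (auto simp: has_weak_deriv_def)
  have "AE x in lebesgue_on S. v x - w x = 0"
  proof (rule fundamental_lemma[OF S])
    show "locally_integrable S (\<lambda>x. v x - w x)" using li by (auto simp: locally_integrable_def)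
    fix \<psi> :: "'a \<Rightarrow> real" assume \<psi>: "\<psi> \<in> test_functions S"
    have "(\<integral>x. \<psi> x *\<^sub>R v x \<partial>lebesgue_on S) = (\<integral>x. \<psi> x *\<^sub>R w x \<partial>lebesgue_on S)"
      using v w \<psi> by (simp add: has_weak_deriv_def)
    then show "(\<integral>x. \<psi> x *\<^sub>R (v x - w x) \<partial>lebesgue_on S) = 0"
      using integrable_test_scaleR(1)[OF S \<psi> li(1)] integrable_test_scaleR(1)[OF S \<psi> li(2)] by (simp add: scaleR_diff_right)
  qed
  then show ?thesis by simp
qed

lemma weak_deriv_AE:
  assumes "open S" "has_weak_deriv S b u v"
  shows "AE x in lebesgue_on S. weak_deriv S b u x = v x" and "has_weak_deriv S b u (weak_deriv S b u)"
proof -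
  show "has_weak_deriv S b u (weak_deriv S b u)"
    unfolding weak_deriv_def using assms(2) by (rule someI[of "\<lambda>v. has_weak_deriv S b u v"])
  from weak_deriv_unique[OF assms(1) this assms(2)]
  show "AE x in lebesgue_on S. weak_deriv S b u x = v x" .
qed

section \<open>Lebesgue norms\<close>

lemma Lp_norm_nonneg: "0 \<le> Lp_norm t S v"
  by (simp add: Lp_norm_def)

text \<open>Norm bounds on the whole space, treating finite and infinite exponents alike. A bound is easier to
  transport through pointwise estimates and convolutions than the norm, whose value is meaningful
  only for members of the space.\<close>

definition Lp_bound :: "ennreal \<Rightarrow> ('a::euclidean_space \<Rightarrow> 'b::euclidean_space) \<Rightarrow> real \<Rightarrow> bool" where
  "Lp_bound t v c \<longleftrightarrow>
    (if t = \<infinity> then AE x in lborel. norm (v x) \<le> c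
     else (\<integral>\<^sup>+x. ennreal (norm (v x) powr enn2real t) \<partial>lborel) \<le> ennreal (c powr enn2real t))"

lemma enn2real_ge_1:
  assumes "1 \<le> t" "t \<noteq> \<infinity>" shows "1 \<le> enn2real t"
proof -
  have "enn2real 1 \<le> enn2real t" using assms by (intro enn2real_mono) (auto simp: less_top)
  then show ?thesis by simp
qed

lemma measurable_lebesgue_on_iff:
  fixes v :: "'a::euclidean_space \<Rightarrow> 'b::euclidean_space"
  assumes "S \<in> sets lebesgue"
  shows "v \<in> borel_measurable (lebesgue_on S) \<longleftrightarrow> (\<lambda>x. indicator S x *\<^sub>R v x) \<in> borel_measurable lebesgue"
  using assms by (intro borel_measurable_restrict_space_iff) auto

lemma AE_lebesgue_on_iff:
  assumes "S \<in> sets lebesgue"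
  shows "(AE x in lebesgue_on S. P x) \<longleftrightarrow> (AE x in lborel. x \<in> S \<longrightarrow> P x)"
  using assms by (subst AE_restrict_space_iff) (auto simp: AE_completion_iff)

lemma Lp_norm_infinity_AE:
  assumes "v \<in> Lp_space \<infinity> S"
  shows "AE x in lebesgue_on S. norm (v x) \<le> Lp_norm \<infinity> S v"
proof -
  obtain c where c: "AE x in lebesgue_on S. norm (v x) \<le> c" and m: "v \<in> borel_measurable (lebesgue_on S)"
    using assms by (auto simp: Lp_space_def)
  have m': "(\<lambda>x. ennreal (norm (v x))) \<in> borel_measurable (lebesgue_on S)" using m by simp
  have "AE x in lebesgue_on S. ennreal (norm (v x)) \<le> ennreal c"
    using c by eventually_elim (rule ennreal_leI)
  then have "esssup (lebesgue_on S) (\<lambda>x. ennreal (norm (v x))) \<le> ennreal c"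
    using m' by (intro esssup_I)
  then have fin: "esssup (lebesgue_on S) (\<lambda>x. ennreal (norm (v x))) < \<infinity>"
    using le_less_trans by fastforce
  then have "ennreal (Lp_norm \<infinity> S v) = esssup (lebesgue_on S) (\<lambda>x. ennreal (norm (v x)))"
    by (simp add: Lp_norm_def)
  then have "AE x in lebesgue_on S. ennreal (norm (v x)) \<le> ennreal (Lp_norm \<infinity> S v)"
    using esssup_AE[of "\<lambda>x. ennreal (norm (v x))" "lebesgue_on S"] by simp
  then show ?thesis
    by eventually_elim (simp add: Lp_norm_nonneg)
qed

lemma Lp_norm_infinity_le:
  assumes "v \<in> borel_measurable (lebesgue_on S)" "AE x in lebesgue_on S. norm (v x) \<le> c" "c \<ge> 0"
  shows "v \<in> Lp_space \<infinity> S" "Lp_norm \<infinity> S v \<le> c"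
proof -
  show "v \<in> Lp_space \<infinity> S" using assms by (auto simp: Lp_space_def)
  have m': "(\<lambda>x. ennreal (norm (v x))) \<in> borel_measurable (lebesgue_on S)" using assms(1) by simp
  have "AE x in lebesgue_on S. ennreal (norm (v x)) \<le> ennreal c"
    using assms(2) by eventually_elim (rule ennreal_leI)
  then have "esssup (lebesgue_on S) (\<lambda>x. ennreal (norm (v x))) \<le> ennreal c"
    using m' by (intro esssup_I)
  then have "enn2real (esssup (lebesgue_on S) (\<lambda>x. ennreal (norm (v x)))) \<le> enn2real (ennreal c)"
    by (intro enn2real_mono) auto
  then show "Lp_norm \<infinity> S v \<le> c" using assms(3) by (simp add: Lp_norm_def)
qed

lemma Lp_norm_finite_eq:
  assumes t: "1 \<le> t" "t \<noteq> \<infinity>" and v: "v \<in> Lp_space t S"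
  shows "(\<integral>\<^sup>+x. ennreal (norm (v x) powr enn2real t) \<partial>lebesgue_on S) = ennreal (Lp_norm t S v powr enn2real t)"
proof -
  have s: "enn2real t \<ge> 1" by (rule enn2real_ge_1[OF t])
  have "integrable (lebesgue_on S) (\<lambda>x. norm (v x) powr enn2real t)"
    using v t by (simp add: Lp_space_def)
  then show ?thesis
    using t s by (subst nn_integral_eq_integral) (auto simp: Lp_norm_def powr_powr)
qed

lemma Lp_norm_finite_le:
  assumes t: "1 \<le> t" "t \<noteq> \<infinity>" and v: "v \<in> borel_measurable (lebesgue_on S)"
    and c: "c \<ge> 0" and le: "(\<integral>\<^sup>+x. ennreal (norm (v x) powr enn2real t) \<partial>lebesgue_on S) \<le> ennreal (c powr enn2real t)"
  shows "v \<in> Lp_space t S" "Lp_norm t S v \<le> c"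
proof -
  have s: "enn2real t \<ge> 1" by (rule enn2real_ge_1[OF t])
  have m: "(\<lambda>x. norm (v x) powr enn2real t) \<in> borel_measurable (lebesgue_on S)"
    using v by simp
  have "integrable (lebesgue_on S) (\<lambda>x. norm (v x) powr enn2real t)"
    using le m by (intro integrableI_bounded) (auto intro: le_less_trans)
  then show v': "v \<in> Lp_space t S" using v t by (simp add: Lp_space_def)
  have "Lp_norm t S v powr enn2real t \<le> c powr enn2real t"
    using le unfolding Lp_norm_finite_eq[OF t v'] by (simp add: ennreal_le_iff)
  then show "Lp_norm t S v \<le> c"
    using s c powr_less_mono2[of "enn2real t" c "Lp_norm t S v"] by force
qed

lemma Lp_bound_of_Lp_norm:
  assumes t: "1 \<le> t" and S: "S \<in> sets lebesgue" and v: "v \<in> Lp_space t S"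
    and w: "AE x in lborel. indicator S x *\<^sub>R v x = w x"
  shows "Lp_bound t w (Lp_norm t S v)"
proof (cases "t = \<infinity>")
  case True
  have "AE x in lborel. x \<in> S \<longrightarrow> norm (v x) \<le> Lp_norm t S v"
    using Lp_norm_infinity_AE[of v S] v True by (simp add: AE_lebesgue_on_iff[OF S])
  then have "AE x in lborel. norm (w x) \<le> Lp_norm t S v"
    using w
  proof eventually_elim
    case (elim x)
    show ?case unfolding elim(2)[symmetric] using elim(1) Lp_norm_nonneg[of t S v] by (cases "x \<in> S") auto
  qed
  then show ?thesis using True by (simp add: Lp_bound_def)
next
  case False
  have s: "enn2real t \<ge> 1" by (rule enn2real_ge_1[OF t False])
  have "(\<integral>\<^sup>+x. ennreal (norm (w x) powr enn2real t) \<partial>lborel) = (\<integral>\<^sup>+x. ennreal (norm (v x) powr enn2real t) * indicator S x \<partial>lborel)"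
  proof (rule nn_integral_cong_AE)
    show "AE x in lborel. ennreal (norm (w x) powr enn2real t) = ennreal (norm (v x) powr enn2real t) * indicator S x"
      using w
    proof eventually_elim
      case (elim x)
      show ?case unfolding elim[symmetric] by (cases "x \<in> S") auto
    qed
  qed
  also have "\<dots> = ennreal (Lp_norm t S v powr enn2real t)"
    using Lp_norm_finite_eq[OF t False v] nn_integral_lebesgue_on[OF S] by simp
  finally show ?thesis using False by (simp add: Lp_bound_def)
qed

lemma Lp_norm_le_of_Lp_bound:
  assumes t: "1 \<le> t" and S: "S \<in> sets lebesgue" and v: "v \<in> borel_measurable (lebesgue_on S)"
    and le: "Lp_bound t (\<lambda>x. indicator S x *\<^sub>R v x) c" and c: "c \<ge> 0"
  shows "v \<in> Lp_space t S" "Lp_norm t S v \<le> c"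
proof -
  have "v \<in> Lp_space t S \<and> Lp_norm t S v \<le> c"
  proof (cases "t = \<infinity>")
    case True
    have "AE x in lborel. norm (indicator S x *\<^sub>R v x) \<le> c" using le True by (simp add: Lp_bound_def)
    then have "AE x in lebesgue_on S. norm (v x) \<le> c"
      unfolding AE_lebesgue_on_iff[OF S] by eventually_elim auto
    from Lp_norm_infinity_le[OF v this c] show ?thesis using True by simp
  next
    case False
    have s: "enn2real t \<ge> 1" by (rule enn2real_ge_1[OF t False])
    have eq: "ennreal (norm (v x) powr enn2real t) * indicator S x = ennreal (norm (indicator S x *\<^sub>R v x) powr enn2real t)" for x
      by (cases "x \<in> S") auto
    have "(\<integral>\<^sup>+x. ennreal (norm (v x) powr enn2real t) \<partial>lebesgue_on S) \<le> ennreal (c powr enn2real t)"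
      unfolding nn_integral_lebesgue_on[OF S] eq using le False by (simp add: Lp_bound_def)
    from Lp_norm_finite_le[OF t False v c this] show ?thesis by simp
  qed
  then show "v \<in> Lp_space t S" "Lp_norm t S v \<le> c" by auto
qed

lemma Lp_bound_mono:
  fixes v :: "'a::euclidean_space \<Rightarrow> 'b::euclidean_space" and w :: "'a \<Rightarrow> 'c::euclidean_space"
  assumes t: "1 \<le> t" and vw: "AE x in lborel. norm (v x) \<le> C * norm (w x)" and w: "Lp_bound t w c"
    and C: "C \<ge> 0" "c \<ge> 0" and m: "w \<in> borel_measurable borel"
  shows "Lp_bound t v (C * c)"
proof (cases "t = \<infinity>")
  case True
  then have "AE x in lborel. norm (w x) \<le> c" using w by (simp add: Lp_bound_def)
  with vw have "AE x in lborel. norm (v x) \<le> C * c"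
  proof eventually_elim
    case (elim x)
    then show ?case using C mult_left_mono[of "norm (w x)" c C] by linarith
  qed
  then show ?thesis using True by (simp add: Lp_bound_def)
next
  case False
  have s: "enn2real t \<ge> 1" by (rule enn2real_ge_1[OF t False])
  have "(\<integral>\<^sup>+x. ennreal (norm (v x) powr enn2real t) \<partial>lborel)
    \<le> (\<integral>\<^sup>+x. ennreal (C powr enn2real t) * ennreal (norm (w x) powr enn2real t) \<partial>lborel)"
  proof (rule nn_integral_mono_AE)
    show "AE x in lborel. ennreal (norm (v x) powr enn2real t) \<le> ennreal (C powr enn2real t) * ennreal (norm (w x) powr enn2real t)"
      using vw
    proof eventually_elim
      case (elim x)
      then have "norm (v x) powr enn2real t \<le> (C * norm (w x)) powr enn2real t"
        using s by (intro powr_mono2) auto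
      then show ?case using C by (simp add: powr_mult ennreal_leI flip: ennreal_mult)
    qed
  qed
  also have "\<dots> = ennreal (C powr enn2real t) * (\<integral>\<^sup>+x. ennreal (norm (w x) powr enn2real t) \<partial>lborel)"
    using m by (simp add: nn_integral_cmult)
  also have "\<dots> \<le> ennreal (C powr enn2real t) * ennreal (c powr enn2real t)"
    using w False by (intro mult_left_mono) (auto simp: Lp_bound_def)
  also have "\<dots> = ennreal ((C * c) powr enn2real t)"
    using C by (simp add: powr_mult ennreal_mult)
  finally show ?thesis using False by (simp add: Lp_bound_def)
qed

lemma Lp_bound_conv_moll:
  fixes w :: "'a::euclidean_space \<Rightarrow> 'b::euclidean_space"
  assumes t: "1 \<le> t" and w: "Lp_bound t w c" and m: "w \<in> borel_measurable borel" and h: "h > 0" and c: "c \<ge> 0"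
  shows "Lp_bound t (conv (moll h) w) c"
proof (cases "t = \<infinity>")
  case True
  then have ae: "AE x in lborel. norm (w x) \<le> c" using w by (simp add: Lp_bound_def)
  have "norm (conv (moll h) w x) \<le> c" for x
  proof -
    have "ennreal (norm (conv (moll h) w x)) \<le> (\<integral>\<^sup>+y. ennreal (\<bar>moll h (x - y)\<bar> * norm (w y)) \<partial>lborel)"
      by (rule norm_conv_le)
    also have "\<dots> \<le> (\<integral>\<^sup>+y. ennreal (moll h (x - y)) * ennreal c \<partial>lborel)"
    proof (rule nn_integral_mono_AE)
      show "AE y in lborel. ennreal (\<bar>moll h (x - y)\<bar> * norm (w y)) \<le> ennreal (moll h (x - y)) * ennreal c"
        using ae
      proof eventually_elim
        case (elim y)
        then have "\<bar>moll h (x - y)\<bar> * norm (w y) \<le> moll h (x - y) * c"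
          using moll_nonneg[OF h, of "x - y"] by (simp add: mult_left_mono)
        then show ?case using moll_nonneg[OF h, of "x - y"] c by (simp add: ennreal_leI flip: ennreal_mult)
      qed
    qed
    also have "\<dots> = ennreal c"
      by (subst nn_integral_multc) (simp_all add: moll_nn_integral_reflect(1)[OF h])
    finally show ?thesis using c by simp
  qed
  then show ?thesis using True by (simp add: Lp_bound_def)
next
  case False
  have s: "enn2real t \<ge> 1" by (rule enn2real_ge_1[OF t False])
  then show ?thesis
    using nn_integral_conv_moll_le[OF h s m] w False order_trans by (auto simp: Lp_bound_def)
qed

lemma Lp_space_diff:
  fixes u v :: "'a::euclidean_space \<Rightarrow> 'b::euclidean_space"
  assumes t: "1 \<le> t" and u: "u \<in> Lp_space t S" and v: "v \<in> Lp_space t S"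
  shows "(\<lambda>x. u x - v x) \<in> Lp_space t S"
proof -
  have m: "(\<lambda>x. u x - v x) \<in> borel_measurable (lebesgue_on S)"
    using u v by (auto simp: Lp_space_def)
  show ?thesis
  proof (cases "t = \<infinity>")
    case True
    obtain a b where "AE x in lebesgue_on S. norm (u x) \<le> a" "AE x in lebesgue_on S. norm (v x) \<le> b"
      using u v True by (auto simp: Lp_space_def)
    then have "AE x in lebesgue_on S. norm (u x - v x) \<le> a + b"
      by eventually_elim (meson add_mono norm_triangle_ineq4 order_trans)
    then show ?thesis using m True by (auto simp: Lp_space_def)
  next
    case False
    have s: "enn2real t \<ge> 1" by (rule enn2real_ge_1[OF t False])
    have "integrable (lebesgue_on S) (\<lambda>x. norm (u x - v x) powr enn2real t)"
    proof (rule Bochner_Integration.integrable_bound)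
      show "integrable (lebesgue_on S) (\<lambda>x. 3 powr enn2real t * (norm (u x) powr enn2real t + norm (v x) powr enn2real t))"
        using u v False by (simp add: Lp_space_def)
      show "AE x in lebesgue_on S. norm (norm (u x - v x) powr enn2real t) \<le> norm (3 powr enn2real t * (norm (u x) powr enn2real t + norm (v x) powr enn2real t))"
      proof (rule AE_I2)
        fix x
        have "norm (u x - v x) powr enn2real t \<le> (norm (u x) + norm (v x) + 0) powr enn2real t"
          using s norm_triangle_ineq4[of "u x" "v x"] by (intro powr_mono2) auto
        also have "\<dots> \<le> 3 powr enn2real t * (norm (u x) powr enn2real t + norm (v x) powr enn2real t + 0 powr enn2real t)"
          using s by (intro powr_sum3_le) auto
        finally show "norm (norm (u x - v x) powr enn2real t) \<le> norm (3 powr enn2real t * (norm (u x) powr enn2real t + norm (v x) powr enn2real t))"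
          by simp
      qed
    qed (use m in simp)
    then show ?thesis using m False by (simp add: Lp_space_def)
  qed
qed

lemma Lp_space_AE:
  fixes u v :: "'a::euclidean_space \<Rightarrow> 'b::euclidean_space"
  assumes S: "S \<in> sets lebesgue" and u: "u \<in> Lp_space t S" and ae: "AE x in lebesgue_on S. u x = v x"
  shows "v \<in> Lp_space t S"
proof -
  have mu: "u \<in> borel_measurable (lebesgue_on S)" using u by (simp add: Lp_space_def)
  have "AE x in lborel. x \<in> S \<longrightarrow> u x = v x" using ae by (simp add: AE_lebesgue_on_iff[OF S])
  then have ae1: "AE x in lebesgue. x \<in> S \<longrightarrow> u x = v x" by (rule AE_completion)
  have ae': "AE x in lebesgue. indicator S x *\<^sub>R u x = indicator S x *\<^sub>R v x"
    using ae1 by eventually_elim (auto simp: indicator_def)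
  have m: "v \<in> borel_measurable (lebesgue_on S)"
    unfolding measurable_lebesgue_on_iff[OF S]
    using borel_measurable_AE[OF mu[unfolded measurable_lebesgue_on_iff[OF S]] ae'] by simp
  show ?thesis
  proof (cases "t = \<infinity>")
    case True
    then obtain c where "AE x in lebesgue_on S. norm (u x) \<le> c" using u by (auto simp: Lp_space_def)
    with ae have "AE x in lebesgue_on S. norm (v x) \<le> c" by eventually_elim simp
    then show ?thesis using True m by (auto simp: Lp_space_def)
  next
    case False
    have "integrable (lebesgue_on S) (\<lambda>x. norm (v x) powr enn2real t)"
    proof (rule integrable_cong_AE_imp)
      show "integrable (lebesgue_on S) (\<lambda>x. norm (u x) powr enn2real t)" using u False by (simp add: Lp_space_def)
      show "AE x in lebesgue_on S. norm (u x) powr enn2real t = norm (v x) powr enn2real t"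
        using ae by eventually_elim simp
    qed (use m in simp)
    then show ?thesis using m False by (simp add: Lp_space_def)
  qed
qed

lemma has_weak_deriv_diff:
  fixes u v :: "'a::euclidean_space \<Rightarrow> 'b::euclidean_space"
  assumes S: "open S" and b: "b \<in> Basis" and u: "has_weak_deriv S b u u'" and v: "has_weak_deriv S b v v'"
  shows "has_weak_deriv S b (\<lambda>x. u x - v x) (\<lambda>x. u' x - v' x)"
proof -
  have li: "locally_integrable S u" "locally_integrable S u'" "locally_integrable S v" "locally_integrable S v'"
    using u v by (auto simp: has_weak_deriv_def)
  have "(\<integral>x. dir_deriv b \<psi> x *\<^sub>R (u x - v x) \<partial>lebesgue_on S) = - (\<integral>x. \<psi> x *\<^sub>R (u' x - v' x) \<partial>lebesgue_on S)"
    if \<psi>: "\<psi> \<in> test_functions S" for \<psi> :: "'a \<Rightarrow> real"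
  proof -
    have "(\<integral>x. dir_deriv b \<psi> x *\<^sub>R u x \<partial>lebesgue_on S) = - (\<integral>x. \<psi> x *\<^sub>R u' x \<partial>lebesgue_on S)"
      "(\<integral>x. dir_deriv b \<psi> x *\<^sub>R v x \<partial>lebesgue_on S) = - (\<integral>x. \<psi> x *\<^sub>R v' x \<partial>lebesgue_on S)"
      using u v \<psi> by (auto simp: has_weak_deriv_def)
    then show ?thesis
      unfolding scaleR_diff_right
      using integrable_test_scaleR(2)[OF S \<psi> li(1) b] integrable_test_scaleR(2)[OF S \<psi> li(3) b]
        integrable_test_scaleR(1)[OF S \<psi> li(2)] integrable_test_scaleR(1)[OF S \<psi> li(4)]
      by simp
  qed
  then show ?thesis using li by (auto simp: has_weak_deriv_def locally_integrable_def)
qed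

lemma W1_0_diff:
  fixes u v :: "'a::euclidean_space \<Rightarrow> 'b::euclidean_space"
  assumes S: "open S" and t: "1 \<le> t" and u: "u \<in> W1_0 t S" and v: "v \<in> W1_0 t S"
  shows "(\<lambda>x. u x - v x) \<in> W1_0 t S"
proof -
  have uv: "u \<in> W1 t S" "v \<in> W1 t S" using u v by (auto simp: W1_0_def)
  have "(\<lambda>x. u x - v x) \<in> W1 t S"
    unfolding W1_def
  proof (intro CollectI conjI ballI)
    show "(\<lambda>x. u x - v x) \<in> Lp_space t S" using uv by (intro Lp_space_diff t) (auto simp: W1_def)
    fix b :: 'a assume b: "b \<in> Basis"
    obtain u' v' where "u' \<in> Lp_space t S" "has_weak_deriv S b u u'" "v' \<in> Lp_space t S" "has_weak_deriv S b v v'"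
      using uv b unfolding W1_def by blast
    then show "\<exists>w\<in>Lp_space t S. has_weak_deriv S b (\<lambda>x. u x - v x) w"
      using Lp_space_diff[OF t] has_weak_deriv_diff[OF S b] by (intro bexI[of _ "\<lambda>x. u' x - v' x"]) auto
  qed
  moreover obtain f g where f: "continuous_on (closure S) f" "\<forall>x\<in>frontier S. f x = 0" "AE x in lebesgue_on S. u x = f x"
    and g: "continuous_on (closure S) g" "\<forall>x\<in>frontier S. g x = 0" "AE x in lebesgue_on S. v x = g x"
    using u v unfolding W1_0_def by blast
  moreover have "AE x in lebesgue_on S. u x - v x = f x - g x"
    using f(3) g(3) by eventually_elim simp
  moreover have "continuous_on (closure S) (\<lambda>x. f x - g x)" by (intro continuous_intros f g)
  ultimately show ?thesis unfolding W1_0_def by (intro CollectI conjI exI[of _ "\<lambda>x. f x - g x"]) auto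
qed

section \<open>Approximation by test functions\<close>

lemma continuous_zero_boundary_extension:
  fixes u :: "'a::euclidean_space \<Rightarrow> 'b::euclidean_space"
  assumes S: "open S" and u: "continuous_on (closure S) u" "\<forall>x\<in>frontier S. u x = 0"
  shows "continuous_on UNIV (\<lambda>x. if x \<in> S then u x else 0)" (is "continuous_on _ ?f")
proof -
  have 1: "continuous_on (closure S) ?f"
  proof (subst continuous_on_cong[OF refl])
    show "?f x = u x" if "x \<in> closure S" for x
      using that u(2) S by (auto simp: frontier_def interior_open)
  qed (rule u(1))
  have 2: "continuous_on (- S) ?f"
  proof (subst continuous_on_cong[OF refl])
    show "continuous_on (- S) (\<lambda>x. 0 :: 'b)" by simp
  qed auto
  have "continuous_on (closure S \<union> - S) ?f"
    using S by (intro continuous_on_closed_Un 1 2) auto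
  moreover have "closure S \<union> - S = UNIV" using closure_subset by auto
  ultimately show ?thesis by simp
qed

lemma uniformly_continuous_bounded_support:
  fixes u :: "'a::euclidean_space \<Rightarrow> 'b::euclidean_space"
  assumes u: "continuous_on UNIV u" and R: "\<And>x. norm x > R \<Longrightarrow> u x = 0" and e: "e > 0"
  shows "\<exists>d>0. \<forall>x y. norm (x - y) < d \<longrightarrow> norm (u y - u x) < e"
proof -
  have "uniformly_continuous_on (cball 0 (R + 1)) u"
    by (intro compact_uniformly_continuous continuous_on_subset[OF u]) auto
  then obtain d where d: "d > 0" "\<forall>x\<in>cball 0 (R + 1). \<forall>y\<in>cball 0 (R + 1). dist y x < d \<longrightarrow> dist (u y) (u x) < e"
    using e unfolding uniformly_continuous_on_def by blast
  have "norm (u y - u x) < e" if xy: "norm (x - y) < min d 1" for x y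
  proof (cases "norm x \<le> R + 1 \<and> norm y \<le> R + 1")
    case True
    then show ?thesis using d(2) xy by (simp add: dist_norm norm_minus_commute)
  next
    case False
    have "norm x \<le> norm y + norm (x - y)" "norm y \<le> norm x + norm (x - y)"
      using norm_triangle_sub[of x y] norm_triangle_sub[of y x] by (simp_all add: norm_minus_commute)
    then have "norm x > R" "norm y > R" using False xy by linarith+
    then show ?thesis using R e by simp
  qed
  then show ?thesis using d(1) by (intro exI[of _ "min d 1"]) auto
qed

lemma trim_deriv_diff: "trim_deriv w (a - b) = trim_deriv w a - trim_deriv w b"
proof -
  have "linear (trim_deriv w)"
    using trim_has_derivative[of w] has_derivative_linear by blast
  then show ?thesis by (rule linear_diff)
qed

lemma trim_deriv_measurable:
  assumes [measurable]: "u \<in> borel_measurable borel" "v \<in> borel_measurable borel"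
  shows "(\<lambda>x. trim_deriv (u x) (v x)) \<in> borel_measurable borel"
proof -
  have [measurable]: "flat m \<in> borel_measurable borel" for m
    using Ck_on_flat[of 0 m] by (intro borel_measurable_continuous_onI) simp
  show ?thesis unfolding trim_deriv_def by measurable
qed

text \<open>For every \<open>l > 0\<close> one has \<open>r \<le> l + l powr (1 - s) * r powr s\<close> for \<open>r \<ge> 0\<close>; integrate this over \<open>B\<close> with
  a small \<open>l\<close>.\<close>

lemma Ls_tendsto_imp_L1_tendsto:
  fixes f :: "nat \<Rightarrow> 'a::euclidean_space \<Rightarrow> 'b::euclidean_space"
  assumes m: "\<And>k. f k \<in> borel_measurable borel" and supp: "\<And>k x. x \<notin> B \<Longrightarrow> f k x = 0" and B: "B \<in> sets lborel" "emeasure lborel B < \<infinity>"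
    and s: "s \<ge> 1" and lim: "(\<lambda>k. \<integral>\<^sup>+x. ennreal (norm (f k x) powr s) \<partial>lborel) \<longlonglongrightarrow> 0"
  shows "(\<lambda>k. \<integral>\<^sup>+x. ennreal (norm (f k x)) \<partial>lborel) \<longlonglongrightarrow> 0"
proof (rule order_tendstoI)
  fix a :: ennreal assume "0 < a"
  then obtain e where e: "e > 0" "ennreal e < a"
  proof (cases a rule: ennreal_cases)
    case (real r)
    then show ?thesis using \<open>0 < a\<close> that[of "r / 2"] by (simp add: ennreal_less_iff)
  next
    case top
    then show ?thesis using that[of 1] by simp
  qed
  define V where "V = measure lborel B"
  have V: "emeasure lborel B = ennreal V" "V \<ge> 0"
    using B by (auto simp: V_def intro!: emeasure_eq_ennreal_measure)
  define l where "l = e / (2 * (V + 1))"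
  have l: "l > 0" using e V by (simp add: l_def)
  have lV: "l * V \<le> e / 2" using e V by (simp add: l_def field_simps)
  define d where "d = e / 2 * l powr (s - 1)"
  have d: "d > 0" using e l by (simp add: d_def)
  have "\<forall>\<^sub>F k in sequentially. (\<integral>\<^sup>+x. ennreal (norm (f k x) powr s) \<partial>lborel) < ennreal d"
    using order_tendstoD(2)[OF lim, of "ennreal d"] d by simp
  then show "\<forall>\<^sub>F k in sequentially. (\<integral>\<^sup>+x. ennreal (norm (f k x)) \<partial>lborel) < a"
  proof eventually_elim
    case (elim k)
    have "(\<integral>\<^sup>+x. ennreal (norm (f k x)) \<partial>lborel)
      \<le> (\<integral>\<^sup>+x. ennreal l * indicator B x + ennreal (l powr (1 - s)) * ennreal (norm (f k x) powr s) \<partial>lborel)"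
    proof (rule nn_integral_mono)
      fix x
      have *: "norm (f k x) \<le> l powr (1 - s) * norm (f k x) powr s" if "norm (f k x) > l"
      proof -
        have "l powr (s - 1) \<le> norm (f k x) powr (s - 1)" using that l s by (intro powr_mono2) auto
        then have "l powr (s - 1) * norm (f k x) \<le> norm (f k x) powr (s - 1) * norm (f k x)" by (intro mult_right_mono) auto
        also have "\<dots> = norm (f k x) powr s"
          using that l powr_add[of "norm (f k x)" "s - 1" 1] by simp
        finally have "l powr (1 - s) * (l powr (s - 1) * norm (f k x)) \<le> l powr (1 - s) * norm (f k x) powr s"
          by (intro mult_left_mono) auto
        moreover have "l powr (1 - s) * l powr (s - 1) = 1" using l by (simp flip: powr_add)
        ultimately show ?thesis by (simp flip: mult.assoc)
      qed
      have "norm (f k x) \<le> l * indicator B x + l powr (1 - s) * norm (f k x) powr s"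
      proof (cases "x \<in> B")
        case True
        then show ?thesis using * l by (cases "norm (f k x) > l") (auto simp: add_increasing add_increasing2)
      qed (simp add: supp)
      then have "ennreal (norm (f k x)) \<le> ennreal (l * indicator B x + l powr (1 - s) * norm (f k x) powr s)"
        by (rule ennreal_leI)
      also have "\<dots> = ennreal l * indicator B x + ennreal (l powr (1 - s)) * ennreal (norm (f k x) powr s)"
        using l by (cases "x \<in> B") (auto simp: ennreal_mult)
      finally show "ennreal (norm (f k x)) \<le> ennreal l * indicator B x + ennreal (l powr (1 - s)) * ennreal (norm (f k x) powr s)" .
    qed
    also have "\<dots> = ennreal l * emeasure lborel B + ennreal (l powr (1 - s)) * (\<integral>\<^sup>+x. ennreal (norm (f k x) powr s) \<partial>lborel)"
    proof -
      have m1: "(\<lambda>x. ennreal l * indicator B x) \<in> borel_measurable lborel"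
        by (intro borel_measurable_times_ennreal borel_measurable_const borel_measurable_indicator B)
      have m2: "(\<lambda>x. ennreal (norm (f k x) powr s)) \<in> borel_measurable lborel" using m[of k] by simp
      show ?thesis using m1 m2 B by (simp add: nn_integral_add nn_integral_cmult nn_integral_cmult_indicator)
    qed
    also have "\<dots> \<le> ennreal (e / 2) + ennreal (l powr (1 - s)) * ennreal d"
      unfolding V(1) using elim lV l V by (intro add_mono mult_left_mono) (auto simp: ennreal_leI simp flip: ennreal_mult)
    also have "\<dots> = ennreal e"
    proof -
      have "l powr (1 - s) * l powr (s - 1) = 1" using l by (simp flip: powr_add)
      then have "l powr (1 - s) * d = e / 2" by (simp add: d_def)
      then show ?thesis using e d by (simp flip: ennreal_mult ennreal_plus)
    qed
    finally show ?case using e(2) by (rule le_less_trans)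
  qed
qed simp

lemma continuous_Lp_space:
  fixes g :: "'a::euclidean_space \<Rightarrow> 'b::euclidean_space"
  assumes t: "1 \<le> t" and S: "S \<in> sets lebesgue" and g: "continuous_on UNIV g" "\<And>x. x \<notin> cbox a c \<Longrightarrow> g x = 0"
  shows "g \<in> Lp_space t S"
proof -
  have gb: "g \<in> borel_measurable borel" by (rule borel_measurable_continuous_onI[OF g(1)])
  then have m: "g \<in> borel_measurable (lebesgue_on S)"
    by (simp add: measurable_completion measurable_restrict_space1)
  show ?thesis
  proof (cases "t = \<infinity>")
    case True
    obtain C where "\<And>x. x \<in> cbox a c \<Longrightarrow> norm (g x) \<le> C"
      using compact_imp_bounded[OF compact_continuous_image[OF continuous_on_subset[OF g(1)] compact_cbox[of a c]]]
      by (auto simp: bounded_iff)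
    then have "norm (g x) \<le> max C 0" for x using g(2)[of x] by (cases "x \<in> cbox a c") (auto simp: le_max_iff_disj)
    then have "AE x in lebesgue_on S. norm (g x) \<le> max C 0" by simp
    then show ?thesis using m True by (auto simp: Lp_space_def)
  next
    case False
    have s: "enn2real t \<ge> 1" by (rule enn2real_ge_1[OF t False])
    have "integrable lborel (\<lambda>x. norm (g x) powr enn2real t)"
    proof (rule integrable_continuous_bounded_support[of _ a c])
      show "continuous_on UNIV (\<lambda>x. norm (g x) powr enn2real t)"
        using s by (intro continuous_on_powr' continuous_on_norm g(1) continuous_on_const) auto
    qed (simp add: g(2))
    then have "integrable lebesgue (\<lambda>x. norm (g x) powr enn2real t)"
      using gb by (simp add: integrable_completion)
    from integrable_mult_indicator[OF S this]
    have "integrable (lebesgue_on S) (\<lambda>x. norm (g x) powr enn2real t)"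
      using S by (simp add: integrable_restrict_space)
    then show ?thesis using m False by (simp add: Lp_space_def)
  qed
qed

lemma has_weak_deriv_test:
  assumes "open S" "\<psi> \<in> test_functions S'" "b \<in> Basis"
  shows "has_weak_deriv S b \<psi> (dir_deriv b \<psi>)"
proof (rule has_weak_deriv_classical[OF assms(1) _ assms(3)])
  have "Ck_on 1 UNIV \<psi>" by (rule test_function_Ck[OF assms(2)])
  then show "Ck_on 1 S \<psi>" by (auto intro: continuous_on_subset)
qed

lemma test_function_in_W1_0:
  fixes \<psi> :: "'a::euclidean_space \<Rightarrow> 'b::euclidean_space"
  assumes t: "1 \<le> t" and S: "open S" and \<psi>: "\<psi> \<in> test_functions S"
  shows "\<psi> \<in> W1_0 t S"
proof -
  obtain a c where ac: "\<And>x. x \<notin> cbox a c \<Longrightarrow> \<psi> x = 0" "\<And>x b. x \<notin> cbox a c \<Longrightarrow> dir_deriv b \<psi> x = 0"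
    using test_function_box[OF \<psi>] by blast
  note S' = open_in_lebesgue[OF S]
  have "\<psi> \<in> Lp_space t S" by (rule continuous_Lp_space[OF t S' test_function_continuous[OF \<psi>] ac(1)])
  moreover have "dir_deriv b \<psi> \<in> Lp_space t S" if "b \<in> Basis" for b
    by (rule continuous_Lp_space[OF t S' dir_deriv_test_continuous[OF \<psi> that] ac(2)])
  ultimately have "\<psi> \<in> W1 t S"
    using has_weak_deriv_test[OF S \<psi>] by (auto simp: W1_def)
  moreover have "\<forall>x\<in>frontier S. \<psi> x = 0"
    using test_function_outside(1)[OF \<psi>] S by (auto simp: frontier_def interior_open)
  moreover have "continuous_on (closure S) \<psi>" by (rule continuous_on_subset[OF test_function_continuous[OF \<psi>]]) simp
  ultimately show ?thesis unfolding W1_0_def by (intro CollectI conjI exI[of _ \<psi>]) auto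
qed

lemma Lp_norm_weak_deriv_le:
  fixes u v :: "'a::euclidean_space \<Rightarrow> 'b::euclidean_space"
  assumes t: "1 \<le> t" and S: "open S" and v: "has_weak_deriv S b u v" "v \<in> borel_measurable borel"
    and le: "Lp_bound t v c" and c: "c \<ge> 0"
  shows "Lp_norm t S (weak_deriv S b u) \<le> c"
proof -
  note S' = open_in_lebesgue[OF S]
  have ae: "AE x in lebesgue_on S. weak_deriv S b u x = v x" by (rule weak_deriv_AE(1)[OF S v(1)])
  have ind: "Lp_bound t (\<lambda>x. indicator S x *\<^sub>R w x) (1 * c)" if "AE x in lebesgue_on S. w x = v x" for w
  proof (rule Lp_bound_mono[OF t _ le _ c v(2)])
    show "AE x in lborel. norm (indicator S x *\<^sub>R w x) \<le> 1 * norm (v x)"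
      using that unfolding AE_lebesgue_on_iff[OF S'] by eventually_elim (auto simp: indicator_def)
  qed simp
  have "v \<in> borel_measurable (lebesgue_on S)"
    using v(2) by (simp add: measurable_completion measurable_restrict_space1)
  then have "v \<in> Lp_space t S"
    using ind[of v] by (intro Lp_norm_le_of_Lp_bound(1)[OF t S' _ _ c]) auto
  moreover have "AE x in lebesgue_on S. v x = weak_deriv S b u x" using ae by eventually_elim simp
  ultimately have "weak_deriv S b u \<in> Lp_space t S" by (rule Lp_space_AE[OF S'])
  then have "weak_deriv S b u \<in> borel_measurable (lebesgue_on S)" by (simp add: Lp_space_def)
  from Lp_norm_le_of_Lp_bound(2)[OF t S' this _ c] show ?thesis using ind[OF ae] by simp
qed

text \<open>Fix an element \<open>\<phi>\<close> of \<open>W\<^sup>1\<^sup>,\<^sup>t\<^sub>0\<close>. Below, \<open>rep\<close> is its continuous representative and \<open>grad b\<close> a Borel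
  representative of its weak derivative, both extended by zero; \<open>\<eta> k\<close> is the level below which
  values are cut off, and \<open>width k\<close> is a mollification radius within which \<open>rep\<close> varies by less than
  \<open>\<eta> k / 4\<close>.\<close>

locale W1_0_function =
  fixes t :: ennreal and \<Omega> :: "'a::euclidean_space set" and \<phi> :: "'a \<Rightarrow> 'b::euclidean_space"
  assumes t: "1 \<le> t" and \<Omega>: "open \<Omega>" "bounded \<Omega>" and \<phi>: "\<phi> \<in> W1_0 t \<Omega>"
begin

lemma \<Omega>_sets: "\<Omega> \<in> sets lebesgue" "\<Omega> \<in> sets borel"
  using \<Omega> open_in_lebesgue by auto

definition rep :: "'a \<Rightarrow> 'b" where
  "rep = (SOME u. continuous_on UNIV u \<and> (\<forall>x. x \<notin> \<Omega> \<longrightarrow> u x = 0) \<and> (AE x in lebesgue_on \<Omega>. \<phi> x = u x))"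

lemma rep: "continuous_on UNIV rep" "x \<notin> \<Omega> \<Longrightarrow> rep x = 0" "AE x in lebesgue_on \<Omega>. \<phi> x = rep x"
proof -
  obtain u where u: "continuous_on (closure \<Omega>) u" "\<forall>x\<in>frontier \<Omega>. u x = 0" "AE x in lebesgue_on \<Omega>. \<phi> x = u x"
    using \<phi> unfolding W1_0_def by blast
  define w where "w x = (if x \<in> \<Omega> then u x else 0)" for x
  have "continuous_on UNIV w"
    using continuous_zero_boundary_extension[OF \<Omega>(1) u(1,2)] by (simp add: w_def[abs_def])
  moreover have "AE x in lebesgue_on \<Omega>. \<phi> x = w x"
    using u(3) unfolding AE_lebesgue_on_iff[OF \<Omega>_sets(1)] by eventually_elim (simp add: w_def)
  ultimately have "continuous_on UNIV w \<and> (\<forall>x. x \<notin> \<Omega> \<longrightarrow> w x = 0) \<and> (AE x in lebesgue_on \<Omega>. \<phi> x = w x)"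
    by (simp add: w_def)
  then have "continuous_on UNIV rep \<and> (\<forall>x. x \<notin> \<Omega> \<longrightarrow> rep x = 0) \<and> (AE x in lebesgue_on \<Omega>. \<phi> x = rep x)"
    unfolding rep_def
    by (rule someI[where P = "\<lambda>u. continuous_on UNIV u \<and> (\<forall>x. x \<notin> \<Omega> \<longrightarrow> u x = 0) \<and> (AE x in lebesgue_on \<Omega>. \<phi> x = u x)"])
  then show "continuous_on UNIV rep" "x \<notin> \<Omega> \<Longrightarrow> rep x = 0" "AE x in lebesgue_on \<Omega>. \<phi> x = rep x" by auto
qed

lemma rep_measurable: "rep \<in> borel_measurable borel"
  by (rule borel_measurable_continuous_onI[OF rep(1)])

lemma rep_AE: "AE x in lborel. indicator \<Omega> x *\<^sub>R \<phi> x = rep x"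
  using rep(3) unfolding AE_lebesgue_on_iff[OF \<Omega>_sets(1)]
  by eventually_elim (auto simp: indicator_def rep(2))

lemma \<phi>_Lp: "\<phi> \<in> Lp_space t \<Omega>"
  using \<phi> by (auto simp: W1_0_def W1_def)

lemma rep_Lp_bound: "Lp_bound t rep (Lp_norm t \<Omega> \<phi>)"
  by (rule Lp_bound_of_Lp_norm[OF t \<Omega>_sets(1) \<phi>_Lp rep_AE])

lemma weak_deriv_\<phi>:
  assumes "b \<in> Basis"
  shows "has_weak_deriv \<Omega> b \<phi> (weak_deriv \<Omega> b \<phi>)" "weak_deriv \<Omega> b \<phi> \<in> Lp_space t \<Omega>"
proof -
  obtain v where v: "v \<in> Lp_space t \<Omega>" "has_weak_deriv \<Omega> b \<phi> v"
    using \<phi> assms unfolding W1_0_def W1_def by blast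
  show "has_weak_deriv \<Omega> b \<phi> (weak_deriv \<Omega> b \<phi>)" by (rule weak_deriv_AE(2)[OF \<Omega>(1) v(2)])
  have "AE x in lebesgue_on \<Omega>. v x = weak_deriv \<Omega> b \<phi> x"
    using weak_deriv_AE(1)[OF \<Omega>(1) v(2)] by eventually_elim simp
  then show "weak_deriv \<Omega> b \<phi> \<in> Lp_space t \<Omega>" by (rule Lp_space_AE[OF \<Omega>_sets(1) v(1)])
qed

definition grad :: "'a \<Rightarrow> 'a \<Rightarrow> 'b" where
  "grad b = (SOME w. w \<in> borel_measurable borel \<and> (\<forall>x. x \<notin> \<Omega> \<longrightarrow> w x = 0) \<and>
     (AE x in lborel. indicator \<Omega> x *\<^sub>R weak_deriv \<Omega> b \<phi> x = w x))"

lemma grad: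
  assumes b: "b \<in> Basis"
  shows "grad b \<in> borel_measurable borel" "x \<notin> \<Omega> \<Longrightarrow> grad b x = 0"
    "AE x in lborel. indicator \<Omega> x *\<^sub>R weak_deriv \<Omega> b \<phi> x = grad b x"
proof -
  have "(\<lambda>x. indicator \<Omega> x *\<^sub>R weak_deriv \<Omega> b \<phi> x) \<in> borel_measurable lebesgue"
    using weak_deriv_\<phi>(2)[OF b] by (simp add: Lp_space_def measurable_lebesgue_on_iff[OF \<Omega>_sets(1)])
  then obtain g where g: "g \<in> borel_measurable borel" "AE x in lborel. indicator \<Omega> x *\<^sub>R weak_deriv \<Omega> b \<phi> x = g x"
    using lebesgue_measurable_borel_rep by blast
  define w where "w x = indicator \<Omega> x *\<^sub>R g x" for x
  have "w \<in> borel_measurable borel"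
    unfolding w_def[abs_def] by (intro borel_measurable_scaleR borel_measurable_indicator \<Omega>_sets g)
  moreover have "AE x in lborel. indicator \<Omega> x *\<^sub>R weak_deriv \<Omega> b \<phi> x = w x"
    using g(2)
  proof eventually_elim
    case (elim x)
    show ?case unfolding w_def elim[symmetric] by (cases "x \<in> \<Omega>") auto
  qed
  ultimately have "w \<in> borel_measurable borel \<and> (\<forall>x. x \<notin> \<Omega> \<longrightarrow> w x = 0) \<and>
     (AE x in lborel. indicator \<Omega> x *\<^sub>R weak_deriv \<Omega> b \<phi> x = w x)" by (simp add: w_def)
  then have "grad b \<in> borel_measurable borel \<and> (\<forall>x. x \<notin> \<Omega> \<longrightarrow> grad b x = 0) \<and>
     (AE x in lborel. indicator \<Omega> x *\<^sub>R weak_deriv \<Omega> b \<phi> x = grad b x)"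
    unfolding grad_def
    by (rule someI[where P = "\<lambda>w. w \<in> borel_measurable borel \<and> (\<forall>x. x \<notin> \<Omega> \<longrightarrow> w x = 0) \<and>
     (AE x in lborel. indicator \<Omega> x *\<^sub>R weak_deriv \<Omega> b \<phi> x = w x)"])
  then show "grad b \<in> borel_measurable borel" "x \<notin> \<Omega> \<Longrightarrow> grad b x = 0"
    "AE x in lborel. indicator \<Omega> x *\<^sub>R weak_deriv \<Omega> b \<phi> x = grad b x" by auto
qed

lemma grad_Lp_bound: "b \<in> Basis \<Longrightarrow> Lp_bound t (grad b) (Lp_norm t \<Omega> (weak_deriv \<Omega> b \<phi>))"
  by (rule Lp_bound_of_Lp_norm[OF t \<Omega>_sets(1) weak_deriv_\<phi>(2) grad(3)])

lemma radius: "\<exists>R>0. \<forall>x. norm x \<ge> R \<longrightarrow> x \<notin> \<Omega>"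
proof -
  obtain r where r: "r > 0" "\<And>x. x \<in> \<Omega> \<Longrightarrow> norm x \<le> r" using \<Omega>(2) unfolding bounded_pos by blast
  then show ?thesis by (intro exI[of _ "r + 1"]) force
qed

lemma box: "\<exists>a c. \<forall>x. x \<notin> cbox a c \<longrightarrow> rep x = 0"
  using bounded_subset_cbox_symmetric[OF \<Omega>(2)] rep(2) by (metis subsetD)

definition \<eta> :: "nat \<Rightarrow> real" where "\<eta> k = inverse (real (Suc k))"

lemma \<eta>: "\<eta> k > 0" "\<eta> \<longlonglongrightarrow> 0"
  unfolding \<eta>_def[abs_def] by simp (rule LIMSEQ_inverse_real_of_nat)

definition width :: "nat \<Rightarrow> real" where
  "width k = (SOME h. 0 < h \<and> h \<le> \<eta> k \<and> (\<forall>x y. norm (x - y) \<le> h \<longrightarrow> norm (rep y - rep x) < \<eta> k / 4))"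

lemma width: "0 < width k" "width k \<le> \<eta> k" "norm (x - y) \<le> width k \<Longrightarrow> norm (rep y - rep x) < \<eta> k / 4"
proof -
  obtain R where R: "R > 0" "\<forall>x. norm x \<ge> R \<longrightarrow> x \<notin> \<Omega>" using radius by blast
  obtain d where d: "d > 0" "\<forall>x y. norm (x - y) < d \<longrightarrow> norm (rep y - rep x) < \<eta> k / 4"
    using uniformly_continuous_bounded_support[OF rep(1), of R "\<eta> k / 4"] R(2) rep(2) \<eta>(1)[of k] by auto
  define h where "h = min (d / 2) (\<eta> k)"
  have "0 < h \<and> h \<le> \<eta> k \<and> (\<forall>x y. norm (x - y) \<le> h \<longrightarrow> norm (rep y - rep x) < \<eta> k / 4)"
    using d \<eta>(1)[of k] by (auto simp: h_def)
  then have "0 < width k \<and> width k \<le> \<eta> k \<and> (\<forall>x y. norm (x - y) \<le> width k \<longrightarrow> norm (rep y - rep x) < \<eta> k / 4)"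
    unfolding width_def by (rule someI)
  then show "0 < width k" "width k \<le> \<eta> k" "norm (x - y) \<le> width k \<Longrightarrow> norm (rep y - rep x) < \<eta> k / 4" by auto
qed

lemma width_tendsto: "width \<longlonglongrightarrow> 0"
  by (rule tendsto_sandwich[OF _ _ tendsto_const \<eta>(2)]) (auto simp: width less_imp_le)

definition smoothed :: "nat \<Rightarrow> 'a \<Rightarrow> 'b" where "smoothed k = conv (moll (width k)) rep"

lemma smoothed_near: "norm (smoothed k x - rep x) \<le> \<eta> k / 4"
proof -
  obtain a c where "\<And>x. x \<notin> cbox a c \<Longrightarrow> rep x = 0" using box by blast
  then show ?thesis
    unfolding smoothed_def
  proof (rule norm_conv_moll_diff_le[OF width(1) rep(1)])
    show "norm (rep y - rep x) \<le> \<eta> k / 4" if "norm (x - y) < width k" for y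
      by (rule less_imp_le[OF width(3)]) (use that in simp)
  qed
qed

lemma Ck_on_smoothed: "Ck_on m UNIV (smoothed k)"
proof -
  obtain a c where "\<And>x. x \<notin> cbox a c \<Longrightarrow> rep x = 0" using box by blast
  then show ?thesis unfolding smoothed_def by (rule Ck_on_conv[OF rep(1) _ Ck_on_moll])
qed

lemma integral_dir_deriv_test_rep:
  fixes \<psi> :: "'a \<Rightarrow> real"
  assumes \<psi>: "\<psi> \<in> test_functions \<Omega>" and b: "b \<in> Basis"
  shows "(\<integral>y. dir_deriv b \<psi> y *\<^sub>R rep y \<partial>lborel) = (\<integral>y. dir_deriv b \<psi> y *\<^sub>R \<phi> y \<partial>lebesgue_on \<Omega>)"
proof -
  have "(\<integral>y. dir_deriv b \<psi> y *\<^sub>R rep y \<partial>lborel) = (\<integral>y. dir_deriv b \<psi> y *\<^sub>R rep y \<partial>lebesgue_on \<Omega>)"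
  proof (rule integral_lebesgue_on_eq_lborel[OF \<Omega>_sets(1), symmetric])
    show "(\<lambda>y. dir_deriv b \<psi> y *\<^sub>R rep y) \<in> borel_measurable borel"
      by (intro borel_measurable_continuous_onI continuous_on_scaleR dir_deriv_test_continuous[OF \<psi> b] rep(1))
  qed (simp add: rep(2))
  also have "\<dots> = (\<integral>y. dir_deriv b \<psi> y *\<^sub>R \<phi> y \<partial>lebesgue_on \<Omega>)"
  proof (rule integral_cong_AE)
    have m: "dir_deriv b \<psi> \<in> borel_measurable (lebesgue_on \<Omega>)"
      using borel_measurable_continuous_onI[OF dir_deriv_test_continuous[OF \<psi> b]]
      by (simp add: measurable_completion measurable_restrict_space1)
    show "(\<lambda>y. dir_deriv b \<psi> y *\<^sub>R rep y) \<in> borel_measurable (lebesgue_on \<Omega>)"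
      using rep_measurable by (intro borel_measurable_scaleR m) (simp add: measurable_completion measurable_restrict_space1)
    show "(\<lambda>y. dir_deriv b \<psi> y *\<^sub>R \<phi> y) \<in> borel_measurable (lebesgue_on \<Omega>)"
      using \<phi>_Lp by (intro borel_measurable_scaleR m) (simp add: Lp_space_def)
    show "AE y in lebesgue_on \<Omega>. dir_deriv b \<psi> y *\<^sub>R rep y = dir_deriv b \<psi> y *\<^sub>R \<phi> y"
      using rep(3) by eventually_elim simp
  qed
  finally show ?thesis .
qed

text \<open>If the support of the translated mollifier lies in \<open>\<Omega>\<close>, the mollifier is a test function, and the
  derivative can be moved from it to \<open>\<phi>\<close> by the definition of weak derivatives.\<close>

lemma dir_deriv_smoothed:
  assumes b: "b \<in> Basis" and x: "cball x (width k) \<subseteq> \<Omega>"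
  shows "dir_deriv b (smoothed k) x = conv (moll (width k)) (grad b) x"
proof -
  obtain a c where ac: "\<And>x. x \<notin> cbox a c \<Longrightarrow> rep x = 0" using box by blast
  define \<psi> where "\<psi> y = moll (width k) (x - y)" for y
  have \<psi>: "\<psi> \<in> test_functions \<Omega>"
    unfolding \<psi>_def[abs_def] by (rule moll_test_function[OF width(1) x])
  have d\<psi>: "dir_deriv b \<psi> y = - dir_deriv b (moll (width k)) (x - y)" for y
  proof -
    have "Ck_on 1 UNIV (moll (width k) :: 'a \<Rightarrow> real)" by (rule Ck_on_moll)
    then show ?thesis unfolding \<psi>_def[abs_def] by (intro dir_deriv_reflect) simp
  qed
  obtain D where D: "(smoothed k has_derivative D) (at x)" "D b = conv (dir_deriv b (moll (width k))) rep x"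
    using conv_has_derivative[OF Ck_on_moll[of 1 "width k"] rep(1), of a c x] ac b unfolding smoothed_def by blast
  have "dir_deriv b (smoothed k) x = conv (dir_deriv b (moll (width k))) rep x"
    using dir_deriv_eq[OF D(1)] D(2) by simp
  also have "\<dots> = - (\<integral>y. dir_deriv b \<psi> y *\<^sub>R rep y \<partial>lborel)"
    by (simp add: conv_def d\<psi>)
  also have "(\<integral>y. dir_deriv b \<psi> y *\<^sub>R rep y \<partial>lborel) = (\<integral>y. dir_deriv b \<psi> y *\<^sub>R \<phi> y \<partial>lebesgue_on \<Omega>)"
    by (rule integral_dir_deriv_test_rep[OF \<psi> b])
  also have "\<dots> = - (\<integral>y. \<psi> y *\<^sub>R weak_deriv \<Omega> b \<phi> y \<partial>lebesgue_on \<Omega>)"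
    using weak_deriv_\<phi>(1)[OF b] \<psi> by (simp add: has_weak_deriv_def)
  also have "(\<integral>y. \<psi> y *\<^sub>R weak_deriv \<Omega> b \<phi> y \<partial>lebesgue_on \<Omega>) = (\<integral>y. \<psi> y *\<^sub>R (indicator \<Omega> y *\<^sub>R weak_deriv \<Omega> b \<phi> y) \<partial>lebesgue)"
    unfolding integral_lebesgue_on[OF \<Omega>_sets(1)] by (simp add: mult.commute)
  also have "\<dots> = (\<integral>y. \<psi> y *\<^sub>R grad b y \<partial>lebesgue)"
  proof (rule integral_cong_AE)
    have m: "\<psi> \<in> borel_measurable lebesgue"
      using borel_measurable_continuous_onI[OF test_function_continuous[OF \<psi>]] by (simp add: measurable_completion)
    show "(\<lambda>y. \<psi> y *\<^sub>R (indicator \<Omega> y *\<^sub>R weak_deriv \<Omega> b \<phi> y)) \<in> borel_measurable lebesgue"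
      using weak_deriv_\<phi>(2)[OF b]
      by (intro borel_measurable_scaleR[OF m]) (simp add: Lp_space_def measurable_lebesgue_on_iff[OF \<Omega>_sets(1)])
    show "(\<lambda>y. \<psi> y *\<^sub>R grad b y) \<in> borel_measurable lebesgue"
      using grad(1)[OF b] by (intro borel_measurable_scaleR[OF m]) (simp add: measurable_completion)
    show "AE y in lebesgue. \<psi> y *\<^sub>R (indicator \<Omega> y *\<^sub>R weak_deriv \<Omega> b \<phi> y) = \<psi> y *\<^sub>R grad b y"
      using AE_completion[OF grad(3)[OF b]] by eventually_elim simp
  qed
  also have "\<dots> = conv (moll (width k)) (grad b) x"
  proof -
    have "(\<lambda>y. \<psi> y *\<^sub>R grad b y) \<in> borel_measurable lborel"
      using borel_measurable_continuous_onI[OF test_function_continuous[OF \<psi>]] grad(1)[OF b]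
      by (intro borel_measurable_scaleR) simp_all
    then show ?thesis unfolding conv_def \<psi>_def[symmetric] by (rule integral_completion)
  qed
  finally show ?thesis by simp
qed

definition approx :: "nat \<Rightarrow> 'a \<Rightarrow> 'b" where
  "approx k x = \<eta> k *\<^sub>R trim (inverse (\<eta> k) *\<^sub>R smoothed k x)"

text \<open>The cut-off changes values by at most \<open>2 * \<eta> k\<close>, the mollification by at most \<open>\<eta> k / 4\<close>.\<close>

lemma approx_near: "norm (approx k x - rep x) \<le> 3 * \<eta> k"
proof -
  have "approx k x - smoothed k x = \<eta> k *\<^sub>R (trim (inverse (\<eta> k) *\<^sub>R smoothed k x) - inverse (\<eta> k) *\<^sub>R smoothed k x)"
    using \<eta>(1)[of k] by (simp add: approx_def scaleR_diff_right)
  then have "norm (approx k x - smoothed k x) \<le> \<eta> k * 2"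
    using \<eta>(1)[of k] norm_trim_diff_le[of "inverse (\<eta> k) *\<^sub>R smoothed k x"] by simp
  then show ?thesis
    using smoothed_near[of k x] norm_triangle_ineq[of "approx k x - smoothed k x" "smoothed k x - rep x"] \<eta>(1)[of k] by simp
qed

lemma approx_zero:
  assumes "norm (rep x) < 3 / 4 * \<eta> k" shows "approx k x = 0"
proof -
  have "norm (smoothed k x) \<le> \<eta> k"
    using assms smoothed_near[of k x] norm_triangle_ineq[of "smoothed k x - rep x" "rep x"] by simp
  then have "norm (inverse (\<eta> k) *\<^sub>R smoothed k x) \<le> 1"
    using \<eta>(1)[of k] by (simp add: field_simps)
  then show ?thesis by (simp add: approx_def trim_small)
qed

lemma approx_test: "approx k \<in> test_functions \<Omega>"
proof -
  have C: "Ck_on m UNIV (approx k)" for m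
    unfolding approx_def[abs_def]
    by (intro Ck_on_scaleR Ck_on_const Ck_on_trim_compose Ck_on_smoothed)
  define T where "T = {x. 3 / 4 * \<eta> k \<le> norm (rep x)}"
  have "closed T"
    unfolding T_def by (intro closed_Collect_le continuous_intros rep(1))
  have "{x. approx k x \<noteq> 0} \<subseteq> T" using approx_zero by (auto simp: T_def not_less[symmetric])
  then have cl: "closure {x. approx k x \<noteq> 0} \<subseteq> T" using \<open>closed T\<close> by (rule closure_minimal)
  have "T \<subseteq> \<Omega>"
  proof
    fix x assume "x \<in> T"
    then have "rep x \<noteq> 0" using \<eta>(1)[of k] by (auto simp: T_def)
    then show "x \<in> \<Omega>" using rep(2) by blast
  qed
  then have "closure {x. approx k x \<noteq> 0} \<subseteq> \<Omega>" "bounded (closure {x. approx k x \<noteq> 0})"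
    using cl bounded_subset[OF \<Omega>(2)] by auto
  then show ?thesis using C by (simp add: test_functions_def compact_eq_bounded_closed)
qed

text \<open>Where the cut-off vanishes, so does its derivative, and both sides are zero. Elsewhere \<open>rep\<close> exceeds
  \<open>3/4 * \<eta> k\<close> in norm, so it has no zero within distance \<open>width k\<close>; that neighbourhood therefore lies
  in \<open>\<Omega>\<close> and \<open>dir_deriv_smoothed\<close> applies.\<close>

lemma dir_deriv_approx:
  assumes b: "b \<in> Basis"
  shows "dir_deriv b (approx k) x = trim_deriv (inverse (\<eta> k) *\<^sub>R smoothed k x) (conv (moll (width k)) (grad b) x)"
proof -
  have D: "(smoothed k has_derivative frechet_derivative (smoothed k) (at x)) (at x)"
    using Ck_on_smoothed[of 1 k] by (simp add: frechet_derivative_works[symmetric])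
  define w where "w = inverse (\<eta> k) *\<^sub>R smoothed k x"
  have lin: "linear (trim_deriv w)" using trim_has_derivative[of w] has_derivative_linear by blast
  have "((\<lambda>x. inverse (\<eta> k) *\<^sub>R smoothed k x) has_derivative (\<lambda>h. inverse (\<eta> k) *\<^sub>R frechet_derivative (smoothed k) (at x) h)) (at x)"
    using D by (rule has_derivative_scaleR_right)
  from has_derivative_compose[OF this trim_has_derivative]
  have "((\<lambda>x. trim (inverse (\<eta> k) *\<^sub>R smoothed k x)) has_derivative (\<lambda>h. trim_deriv w (inverse (\<eta> k) *\<^sub>R frechet_derivative (smoothed k) (at x) h))) (at x)"
    by (simp add: w_def)
  then have "(approx k has_derivative (\<lambda>h. \<eta> k *\<^sub>R trim_deriv w (inverse (\<eta> k) *\<^sub>R frechet_derivative (smoothed k) (at x) h))) (at x)"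
    unfolding approx_def[abs_def] by (rule has_derivative_scaleR_right)
  from dir_deriv_eq[OF this, of b]
  have eq: "dir_deriv b (approx k) x = trim_deriv w (dir_deriv b (smoothed k) x)"
    using \<eta>(1)[of k] by (simp add: linear_scale[OF lin] dir_deriv_def)
  show ?thesis
  proof (cases "norm w \<le> 1")
    case True
    then show ?thesis unfolding eq w_def[symmetric] by (simp add: trim_small)
  next
    case False
    then have "norm (smoothed k x) > \<eta> k" using \<eta>(1)[of k] by (simp add: w_def field_simps)
    then have big: "norm (rep x) > 3 / 4 * \<eta> k"
      using smoothed_near[of k x] norm_triangle_ineq[of "smoothed k x - rep x" "rep x"] by simp
    have "cball x (width k) \<subseteq> \<Omega>"
    proof
      fix y assume "y \<in> cball x (width k)"
      then have "norm (rep y - rep x) < \<eta> k / 4" by (intro width(3)) (simp add: dist_norm)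
      then have "rep y \<noteq> 0" using big \<eta>(1)[of k] by auto
      then show "y \<in> \<Omega>" using rep(2) by blast
    qed
    from dir_deriv_smoothed[OF b this] show ?thesis unfolding eq w_def[symmetric] by simp
  qed
qed

lemma approx_Lp_bound: "Lp_bound t (approx k) (Lp_norm t \<Omega> \<phi>)"
proof -
  have "norm (approx k x) \<le> 1 * norm (smoothed k x)" for x
    using norm_trim_le[of "inverse (\<eta> k) *\<^sub>R smoothed k x"] \<eta>(1)[of k] by (simp add: approx_def field_simps)
  then have "Lp_bound t (approx k) (1 * Lp_norm t \<Omega> \<phi>)"
  proof (intro Lp_bound_mono[OF t])
    show "Lp_bound t (smoothed k) (Lp_norm t \<Omega> \<phi>)"
      unfolding smoothed_def by (rule Lp_bound_conv_moll[OF t rep_Lp_bound rep_measurable width(1) Lp_norm_nonneg])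
    show "smoothed k \<in> borel_measurable borel"
      using Ck_on_smoothed[of 0 k] by (intro borel_measurable_continuous_onI) simp
  qed (auto simp: Lp_norm_nonneg)
  then show ?thesis by simp
qed

lemma dir_deriv_approx_Lp_bound:
  assumes b: "b \<in> Basis"
  shows "Lp_bound t (dir_deriv b (approx k)) (7 * Lp_norm t \<Omega> (weak_deriv \<Omega> b \<phi>))"
proof (rule Lp_bound_mono[OF t])
  show "Lp_bound t (conv (moll (width k)) (grad b)) (Lp_norm t \<Omega> (weak_deriv \<Omega> b \<phi>))"
    by (rule Lp_bound_conv_moll[OF t grad_Lp_bound[OF b] grad(1)[OF b] width(1) Lp_norm_nonneg])
  show "conv (moll (width k)) (grad b) \<in> borel_measurable borel"
    by (rule conv_measurable[OF moll_measurable grad(1)[OF b]])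
qed (auto simp: Lp_norm_nonneg dir_deriv_approx[OF b] norm_trim_deriv_le)

text \<open>The limit of the gradients of the approximations. It turns out to be the weak gradient itself: the
  gradient of a Sobolev function vanishes almost everywhere on its zero set.\<close>

definition trunc_grad :: "'a \<Rightarrow> 'a \<Rightarrow> 'b" where
  "trunc_grad b x = (if rep x = 0 then 0 else grad b x)"

lemma trunc_grad_measurable:
  assumes b: "b \<in> Basis"
  shows "trunc_grad b \<in> borel_measurable borel"
proof -
  have "{x. rep x = 0} \<in> sets borel"
    by (intro borel_closed closed_Collect_eq rep(1) continuous_intros)
  then have "(\<lambda>x. if x \<in> {x. rep x = 0} then 0 else grad b x) \<in> borel_measurable borel"
    using grad(1)[OF b] by (intro measurable_If_set) auto
  then show ?thesis by (simp add: trunc_grad_def[abs_def])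
qed

lemma dir_deriv_approx_measurable: "b \<in> Basis \<Longrightarrow> dir_deriv b (approx k) \<in> borel_measurable borel"
  by (intro borel_measurable_continuous_onI dir_deriv_test_continuous[OF approx_test])

lemma grad_finite:
  assumes "t \<noteq> \<infinity>" "b \<in> Basis"
  shows "(\<integral>\<^sup>+x. ennreal (norm (grad b x) powr enn2real t) \<partial>lborel) < \<infinity>"
  using grad_Lp_bound[OF assms(2)] assms(1) by (auto simp: Lp_bound_def intro: le_less_trans)

lemma trim_deriv_approx_tendsto:
  "(\<lambda>k. trim_deriv (inverse (\<eta> k) *\<^sub>R smoothed k x) h) \<longlonglongrightarrow> (if rep x = 0 then 0 else h)"
proof (cases "rep x = 0")
  case True
  have "trim_deriv (inverse (\<eta> k) *\<^sub>R smoothed k x) h = 0" for k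
  proof -
    have "norm (smoothed k x) \<le> \<eta> k" using smoothed_near[of k x] True \<eta>(1)[of k] by simp
    then have "norm (inverse (\<eta> k) *\<^sub>R smoothed k x) \<le> 1" using \<eta>(1)[of k] by (simp add: field_simps)
    then show ?thesis by (rule trim_small)
  qed
  then show ?thesis using True by simp
next
  case False
  define r where "r = norm (rep x)"
  have r: "r > 0" using False by (simp add: r_def)
  have "filterlim (\<lambda>k. norm (inverse (\<eta> k) *\<^sub>R smoothed k x)) at_top sequentially"
  proof (rule filterlim_at_top_mono)
    have "filterlim (\<lambda>k. inverse (\<eta> k)) at_top sequentially"
      using \<eta> by (intro filterlim_inverse_at_top) auto
    then show "filterlim (\<lambda>k. (r / 2) * inverse (\<eta> k)) at_top sequentially"
      using r by (intro filterlim_tendsto_pos_mult_at_top[OF tendsto_const]) auto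
    have "\<forall>\<^sub>F k in sequentially. \<eta> k < r"
      using order_tendstoD(2)[OF \<eta>(2), of r] r by simp
    then show "\<forall>\<^sub>F k in sequentially. (r / 2) * inverse (\<eta> k) \<le> norm (inverse (\<eta> k) *\<^sub>R smoothed k x)"
    proof eventually_elim
      case (elim k)
      have "r \<le> norm (smoothed k x) + norm (smoothed k x - rep x)"
        using norm_triangle_sub[of "rep x" "smoothed k x"] by (simp add: r_def norm_minus_commute)
      then have "r / 2 \<le> norm (smoothed k x)" using smoothed_near[of k x] elim r by simp
      then show ?case using \<eta>(1)[of k] by (simp add: field_simps)
    qed
  qed
  from trim_deriv_tendsto[OF this] show ?thesis using False by simp
qed

text \<open>The derivative of the cut-off, applied to the difference between the mollified gradient and the gradient,
  is controlled by the convergence of mollifications; applied to the gradient itself it converges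
  pointwise, dominated by a multiple of the gradient.\<close>

lemma dir_deriv_approx_tendsto:
  assumes fin: "t \<noteq> \<infinity>" and b: "b \<in> Basis"
  shows "(\<lambda>k. \<integral>\<^sup>+x. ennreal (norm (dir_deriv b (approx k) x - trunc_grad b x) powr enn2real t) \<partial>lborel) \<longlonglongrightarrow> 0"
proof -
  define s where "s = enn2real t"
  have s: "s \<ge> 1" unfolding s_def by (rule enn2real_ge_1[OF t fin])
  define P where "P k x = trim_deriv (inverse (\<eta> k) *\<^sub>R smoothed k x)" for k x
  define g where "g k = conv (moll (width k)) (grad b)" for k
  have gm: "g k \<in> borel_measurable borel" for k
    unfolding g_def by (rule conv_measurable[OF moll_measurable grad(1)[OF b]])
  have sm: "(\<lambda>x. inverse (\<eta> k) *\<^sub>R smoothed k x) \<in> borel_measurable borel" for k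
  proof -
    have [measurable]: "smoothed k \<in> borel_measurable borel"
      using Ck_on_smoothed[of 0 k] by (intro borel_measurable_continuous_onI) simp
    show ?thesis by measurable
  qed
  have Pm: "(\<lambda>x. P k x (grad b x) - trunc_grad b x) \<in> borel_measurable borel" for k
    unfolding P_def by (intro borel_measurable_diff trim_deriv_measurable sm grad(1)[OF b] trunc_grad_measurable[OF b])
  obtain R where R: "R > 0" "\<forall>x. norm x \<ge> R \<longrightarrow> x \<notin> \<Omega>" using radius by blast
  have gfin: "(\<integral>\<^sup>+x. ennreal (norm (grad b x) powr s) \<partial>lborel) < \<infinity>"
    unfolding s_def by (rule grad_finite[OF fin b])
  have A: "(\<lambda>k. \<integral>\<^sup>+x. ennreal (norm (g k x - grad b x) powr s) \<partial>lborel) \<longlonglongrightarrow> 0"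
    unfolding g_def
    by (rule mollification_tendsto[OF grad(1)[OF b] R(1) _ s gfin width(1) width_tendsto]) (use R(2) grad(2)[OF b] in blast)
  have B: "(\<lambda>k. \<integral>\<^sup>+x. ennreal (norm (P k x (grad b x) - trunc_grad b x) powr s) \<partial>lborel) \<longlonglongrightarrow> (\<integral>\<^sup>+x. 0 \<partial>(lborel :: 'a measure))"
  proof (rule nn_integral_dominated_convergence[where w = "\<lambda>x. ennreal (8 powr s) * ennreal (norm (grad b x) powr s)"])
    show "(\<integral>\<^sup>+x. ennreal (8 powr s) * ennreal (norm (grad b x) powr s) \<partial>lborel) < \<infinity>"
      using gfin grad(1)[OF b] by (simp add: nn_integral_cmult ennreal_mult_less_top)
    show "AE x in lborel. ennreal (norm (P j x (grad b x) - trunc_grad b x) powr s) \<le> ennreal (8 powr s) * ennreal (norm (grad b x) powr s)" for j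
    proof (rule AE_I2)
      fix x
      have "norm (P j x (grad b x) - trunc_grad b x) \<le> norm (P j x (grad b x)) + norm (trunc_grad b x)"
        by (rule norm_triangle_ineq4)
      also have "\<dots> \<le> 7 * norm (grad b x) + norm (grad b x)"
        unfolding P_def by (intro add_mono norm_trim_deriv_le) (simp add: trunc_grad_def)
      finally have "norm (P j x (grad b x) - trunc_grad b x) powr s \<le> (8 * norm (grad b x)) powr s"
        using s by (intro powr_mono2) auto
      then show "ennreal (norm (P j x (grad b x) - trunc_grad b x) powr s) \<le> ennreal (8 powr s) * ennreal (norm (grad b x) powr s)"
        by (simp add: powr_mult ennreal_leI flip: ennreal_mult)
    qed
    show "AE x in lborel. (\<lambda>k. ennreal (norm (P k x (grad b x) - trunc_grad b x) powr s)) \<longlonglongrightarrow> 0"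
    proof (rule AE_I2)
      fix x
      have "(\<lambda>k. P k x (grad b x)) \<longlonglongrightarrow> trunc_grad b x"
        using trim_deriv_approx_tendsto[of x "grad b x"] by (simp add: P_def trunc_grad_def)
      then have "(\<lambda>k. norm (P k x (grad b x) - trunc_grad b x) powr s) \<longlonglongrightarrow> norm (trunc_grad b x - trunc_grad b x) powr s"
        using s by (intro tendsto_powr' tendsto_norm tendsto_diff tendsto_const) auto
      from tendsto_ennrealI[OF this] show "(\<lambda>k. ennreal (norm (P k x (grad b x) - trunc_grad b x) powr s)) \<longlonglongrightarrow> 0"
        by simp
    qed
    show "(\<lambda>x. ennreal (norm (P i x (grad b x) - trunc_grad b x) powr s)) \<in> borel_measurable lborel" for i
      using Pm[of i] by simp
  qed (use grad(1)[OF b] in simp_all)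
  have le: "(\<integral>\<^sup>+x. ennreal (norm (dir_deriv b (approx k) x - trunc_grad b x) powr s) \<partial>lborel)
    \<le> ennreal (3 powr s) * (ennreal (7 powr s) * (\<integral>\<^sup>+x. ennreal (norm (g k x - grad b x) powr s) \<partial>lborel)
        + (\<integral>\<^sup>+x. ennreal (norm (P k x (grad b x) - trunc_grad b x) powr s) \<partial>lborel))" for k
  proof -
    have "(\<integral>\<^sup>+x. ennreal (norm (dir_deriv b (approx k) x - trunc_grad b x) powr s) \<partial>lborel)
      \<le> (\<integral>\<^sup>+x. ennreal (3 powr s) * (ennreal (7 powr s) * ennreal (norm (g k x - grad b x) powr s)
         + ennreal (norm (P k x (grad b x) - trunc_grad b x) powr s)) \<partial>lborel)"
    proof (rule nn_integral_mono)
      fix x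
      have eq: "dir_deriv b (approx k) x - trunc_grad b x = P k x (g k x - grad b x) + (P k x (grad b x) - trunc_grad b x) + 0"
        by (simp add: dir_deriv_approx[OF b] P_def g_def trim_deriv_diff)
      have "norm (P k x (g k x - grad b x)) powr s \<le> (7 * norm (g k x - grad b x)) powr s"
        unfolding P_def using s norm_trim_deriv_le by (intro powr_mono2) auto
      then have "ennreal (norm (P k x (g k x - grad b x)) powr s) \<le> ennreal (7 powr s) * ennreal (norm (g k x - grad b x) powr s)"
        by (simp add: powr_mult ennreal_leI flip: ennreal_mult)
      then have "ennreal (3 powr s) * (ennreal (norm (P k x (g k x - grad b x)) powr s) + ennreal (norm (P k x (grad b x) - trunc_grad b x) powr s) + ennreal (norm (0::'b) powr s))
        \<le> ennreal (3 powr s) * (ennreal (7 powr s) * ennreal (norm (g k x - grad b x) powr s) + ennreal (norm (P k x (grad b x) - trunc_grad b x) powr s))"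
        by (intro mult_left_mono) (auto intro: add_right_mono)
      moreover have "ennreal (norm (dir_deriv b (approx k) x - trunc_grad b x) powr s) \<le> ennreal (3 powr s) * (ennreal (norm (P k x (g k x - grad b x)) powr s) + ennreal (norm (P k x (grad b x) - trunc_grad b x) powr s) + ennreal (norm (0::'b) powr s))"
        unfolding eq using s by (intro norm_sum3_powr_le) simp
      ultimately show "ennreal (norm (dir_deriv b (approx k) x - trunc_grad b x) powr s)
        \<le> ennreal (3 powr s) * (ennreal (7 powr s) * ennreal (norm (g k x - grad b x) powr s) + ennreal (norm (P k x (grad b x) - trunc_grad b x) powr s))"
        by (rule order_trans[rotated])
    qed
    also have "\<dots> = ennreal (3 powr s) * (ennreal (7 powr s) * (\<integral>\<^sup>+x. ennreal (norm (g k x - grad b x) powr s) \<partial>lborel)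
        + (\<integral>\<^sup>+x. ennreal (norm (P k x (grad b x) - trunc_grad b x) powr s) \<partial>lborel))"
    proof -
      have m1: "(\<lambda>x. g k x - grad b x) \<in> borel_measurable borel" by (intro borel_measurable_diff gm grad(1)[OF b])
      have "(\<lambda>x. ennreal (norm (g k x - grad b x) powr s)) \<in> borel_measurable lborel"
        "(\<lambda>x. ennreal (norm (P k x (grad b x) - trunc_grad b x) powr s)) \<in> borel_measurable lborel"
        using m1 Pm[of k] by simp_all
      then show ?thesis by (simp add: nn_integral_cmult nn_integral_add)
    qed
    finally show ?thesis .
  qed
  have "(\<lambda>k. ennreal (3 powr s) * (ennreal (7 powr s) * (\<integral>\<^sup>+x. ennreal (norm (g k x - grad b x) powr s) \<partial>lborel)
        + (\<integral>\<^sup>+x. ennreal (norm (P k x (grad b x) - trunc_grad b x) powr s) \<partial>lborel))) \<longlonglongrightarrow> ennreal (3 powr s) * (ennreal (7 powr s) * 0 + (\<integral>\<^sup>+x. 0 \<partial>(lborel :: 'a measure)))"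
    by (intro ennreal_tendsto_cmult tendsto_add A B) auto
  then have lim: "(\<lambda>k. ennreal (3 powr s) * (ennreal (7 powr s) * (\<integral>\<^sup>+x. ennreal (norm (g k x - grad b x) powr s) \<partial>lborel)
        + (\<integral>\<^sup>+x. ennreal (norm (P k x (grad b x) - trunc_grad b x) powr s) \<partial>lborel))) \<longlonglongrightarrow> 0"
    by simp
  show ?thesis
    unfolding s_def[symmetric]
    by (rule tendsto_sandwich[OF _ _ tendsto_const lim]) (use le in auto)
qed

lemma trunc_grad_outside: "x \<notin> \<Omega> \<Longrightarrow> trunc_grad b x = 0"
  using rep(2) by (simp add: trunc_grad_def)

lemma trunc_grad_integrable:
  assumes fin: "t \<noteq> \<infinity>" and b: "b \<in> Basis"
  shows "integrable lborel (trunc_grad b)"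
proof -
  obtain R where R: "R > 0" "\<forall>x. norm x \<ge> R \<longrightarrow> x \<notin> \<Omega>" using radius by blast
  have "integrable lborel (grad b)"
    by (rule integrable_Lp_bounded_support[OF grad(1)[OF b] _ enn2real_ge_1[OF t fin] grad_finite[OF fin b], of R])
      (use R(2) grad(2)[OF b] in blast)
  then show ?thesis
    by (rule Bochner_Integration.integrable_bound) (use trunc_grad_measurable[OF b] in \<open>auto simp: trunc_grad_def\<close>)
qed

text \<open>Pass to the limit in the integration by parts for the approximations: the functions converge uniformly,
  and their gradients in \<open>L\<^sup>s\<close> and thus, having a common bounded support, in \<open>L\<^sup>1\<close>.\<close>

lemma trunc_grad_weak_deriv:
  assumes fin: "t \<noteq> \<infinity>" and b: "b \<in> Basis"
  shows "has_weak_deriv \<Omega> b \<phi> (trunc_grad b)"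
  unfolding has_weak_deriv_def
proof (intro conjI ballI)
  show "locally_integrable \<Omega> \<phi>" using weak_deriv_\<phi>(1)[OF b] by (simp add: has_weak_deriv_def)
  have iz: "integrable lborel (trunc_grad b)" by (rule trunc_grad_integrable[OF fin b])
  show "locally_integrable \<Omega> (trunc_grad b)"
    unfolding locally_integrable_def
  proof (intro allI impI)
    fix K assume K: "compact K \<and> K \<subseteq> \<Omega>"
    then have Ks: "K \<in> sets lebesgue" by (intro lmeasurable_compact[THEN fmeasurableD]) auto
    have "integrable lebesgue (trunc_grad b)"
      using iz trunc_grad_measurable[OF b] by (simp add: integrable_completion)
    then have "integrable lebesgue (\<lambda>x. indicator K x *\<^sub>R trunc_grad b x)"
      by (rule integrable_mult_indicator[OF Ks])
    then show "integrable (lebesgue_on K) (trunc_grad b)" using Ks by (simp add: integrable_restrict_space)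
  qed
  fix \<psi> :: "'a \<Rightarrow> real" assume \<psi>: "\<psi> \<in> test_functions \<Omega>"
  obtain a c where ac: "\<And>x. x \<notin> cbox a c \<Longrightarrow> \<psi> x = 0 \<and> (\<forall>b. dir_deriv b \<psi> x = 0)"
    using test_function_box[OF \<psi>] by blast
  note c\<psi> = test_function_continuous[OF \<psi>] and cd = dir_deriv_test_continuous[OF \<psi> b]
  have parts: "(\<integral>x. dir_deriv b \<psi> x *\<^sub>R approx k x \<partial>lborel) = - (\<integral>x. \<psi> x *\<^sub>R dir_deriv b (approx k) x \<partial>lborel)" for k
  proof -
    have "has_weak_deriv \<Omega> b (approx k) (dir_deriv b (approx k))"
    proof (rule has_weak_deriv_classical[OF \<Omega>(1) _ b])
      have "Ck_on 1 UNIV (approx k)" by (rule test_function_Ck[OF approx_test])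
      then show "Ck_on 1 \<Omega> (approx k)" by (auto intro: continuous_on_subset)
    qed
    then have "(\<integral>x. dir_deriv b \<psi> x *\<^sub>R approx k x \<partial>lebesgue_on \<Omega>) = - (\<integral>x. \<psi> x *\<^sub>R dir_deriv b (approx k) x \<partial>lebesgue_on \<Omega>)"
      using \<psi> by (simp add: has_weak_deriv_def)
    moreover have "(\<integral>x. dir_deriv b \<psi> x *\<^sub>R approx k x \<partial>lebesgue_on \<Omega>) = (\<integral>x. dir_deriv b \<psi> x *\<^sub>R approx k x \<partial>lborel)"
      by (intro integral_lebesgue_on_eq_lborel \<Omega>_sets borel_measurable_continuous_onI continuous_on_scaleR cd test_function_continuous[OF approx_test])
        (simp add: test_function_outside(2)[OF \<psi>])
    moreover have "(\<integral>x. \<psi> x *\<^sub>R dir_deriv b (approx k) x \<partial>lebesgue_on \<Omega>) = (\<integral>x. \<psi> x *\<^sub>R dir_deriv b (approx k) x \<partial>lborel)"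
      by (intro integral_lebesgue_on_eq_lborel \<Omega>_sets borel_measurable_continuous_onI continuous_on_scaleR c\<psi> dir_deriv_test_continuous[OF approx_test b])
        (simp add: test_function_outside(1)[OF \<psi>])
    ultimately show ?thesis by simp
  qed
  have L: "(\<lambda>k. \<integral>x. dir_deriv b \<psi> x *\<^sub>R approx k x \<partial>lborel) \<longlonglongrightarrow> (\<integral>x. dir_deriv b \<psi> x *\<^sub>R rep x \<partial>lborel)"
  proof (rule integral_dominated_convergence[where w = "\<lambda>x. norm (dir_deriv b \<psi> x) * (norm (rep x) + 3)"])
    show "(\<lambda>x. dir_deriv b \<psi> x *\<^sub>R rep x) \<in> borel_measurable lborel"
      using borel_measurable_continuous_onI[OF continuous_on_scaleR[OF cd rep(1)]] by simp
    show "(\<lambda>x. dir_deriv b \<psi> x *\<^sub>R approx k x) \<in> borel_measurable lborel" for k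
      using borel_measurable_continuous_onI[OF continuous_on_scaleR[OF cd test_function_continuous[OF approx_test]]] by simp
    show "integrable lborel (\<lambda>x. norm (dir_deriv b \<psi> x) * (norm (rep x) + 3))"
      by (rule integrable_continuous_bounded_support[of _ a c]) (use ac in \<open>auto intro!: continuous_intros cd rep(1)\<close>)
    show "AE x in lborel. (\<lambda>k. dir_deriv b \<psi> x *\<^sub>R approx k x) \<longlonglongrightarrow> dir_deriv b \<psi> x *\<^sub>R rep x"
    proof (rule AE_I2)
      fix x
      have "(\<lambda>k. approx k x - rep x) \<longlonglongrightarrow> 0"
      proof (rule Lim_null_comparison)
        show "\<forall>\<^sub>F k in sequentially. norm (approx k x - rep x) \<le> 3 * \<eta> k" using approx_near by simp
        show "(\<lambda>k. 3 * \<eta> k) \<longlonglongrightarrow> 0" using tendsto_mult_left[OF \<eta>(2), of 3] by simp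
      qed
      then have "(\<lambda>k. approx k x) \<longlonglongrightarrow> rep x" by (simp add: LIM_zero_iff)
      then show "(\<lambda>k. dir_deriv b \<psi> x *\<^sub>R approx k x) \<longlonglongrightarrow> dir_deriv b \<psi> x *\<^sub>R rep x"
        by (intro tendsto_scaleR tendsto_const)
    qed
    show "AE x in lborel. norm (dir_deriv b \<psi> x *\<^sub>R approx k x) \<le> norm (dir_deriv b \<psi> x) * (norm (rep x) + 3)" for k
    proof (rule AE_I2)
      fix x
      have "\<eta> k \<le> 1" by (simp add: \<eta>_def inverse_le_1_iff)
      then have "norm (approx k x) \<le> norm (rep x) + 3"
        using approx_near[of k x] norm_triangle_sub[of "approx k x" "rep x"] by linarith
      then show "norm (dir_deriv b \<psi> x *\<^sub>R approx k x) \<le> norm (dir_deriv b \<psi> x) * (norm (rep x) + 3)"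
        by (simp add: mult_left_mono)
    qed
  qed
  obtain C where C: "\<And>x. \<bar>\<psi> x\<bar> \<le> C" "C \<ge> 0"
  proof -
    obtain C0 where "\<And>x. x \<in> cbox a c \<Longrightarrow> \<bar>\<psi> x\<bar> \<le> C0"
      using compact_imp_bounded[OF compact_continuous_image[OF continuous_on_subset[OF c\<psi>] compact_cbox[of a c]]]
      by (auto simp: bounded_iff)
    then have "\<bar>\<psi> x\<bar> \<le> max C0 0" for x using ac[of x] by (cases "x \<in> cbox a c") (auto simp: le_max_iff_disj)
    then show ?thesis using that[of "max C0 0"] by auto
  qed
  define d where "d k x = dir_deriv b (approx k) x - trunc_grad b x" for k x
  have dm: "d k \<in> borel_measurable borel" for k
    unfolding d_def[abs_def] by (intro borel_measurable_diff dir_deriv_approx_measurable trunc_grad_measurable b)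
  have L1: "(\<lambda>k. \<integral>\<^sup>+x. ennreal (norm (d k x)) \<partial>lborel) \<longlonglongrightarrow> 0"
  proof (rule Ls_tendsto_imp_L1_tendsto[OF dm _ _ _ enn2real_ge_1[OF t fin]])
    show "d k x = 0" if "x \<notin> \<Omega>" for k x
      using that by (simp add: d_def trunc_grad_outside test_function_outside(2)[OF approx_test])
    show "\<Omega> \<in> sets lborel" using \<Omega>_sets by simp
    show "emeasure lborel \<Omega> < \<infinity>" using emeasure_bounded_finite[OF \<Omega>(2)] .
    show "(\<lambda>k. \<integral>\<^sup>+x. ennreal (norm (d k x) powr enn2real t) \<partial>lborel) \<longlonglongrightarrow> 0"
      unfolding d_def by (rule dir_deriv_approx_tendsto[OF fin b])
  qed
  have ia: "integrable lborel (dir_deriv b (approx k))" for k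
  proof -
    obtain a' c' where "\<And>x. x \<notin> cbox a' c' \<Longrightarrow> dir_deriv b (approx k) x = 0"
      using test_function_box[OF approx_test] by blast
    then show ?thesis by (rule integrable_continuous_bounded_support[OF dir_deriv_test_continuous[OF approx_test b]])
  qed
  have prod: "integrable lborel (\<lambda>x. \<psi> x *\<^sub>R w x)" if "integrable lborel w" for w :: "'a \<Rightarrow> 'b"
  proof (rule Bochner_Integration.integrable_bound)
    show "integrable lborel (\<lambda>x. C * norm (w x))" using that by (intro integrable_mult_right integrable_norm)
    show "(\<lambda>x. \<psi> x *\<^sub>R w x) \<in> borel_measurable lborel"
      using borel_measurable_continuous_onI[OF c\<psi>] borel_measurable_integrable[OF that] by (intro borel_measurable_scaleR) simp_all
    show "AE x in lborel. norm (\<psi> x *\<^sub>R w x) \<le> norm (C * norm (w x))"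
    proof (rule AE_I2)
      show "norm (\<psi> x *\<^sub>R w x) \<le> norm (C * norm (w x))" for x
        using mult_right_mono[OF C(1)[of x], of "norm (w x)"] C(2) by (simp add: abs_mult)
    qed
  qed
  have R: "(\<lambda>k. \<integral>x. \<psi> x *\<^sub>R dir_deriv b (approx k) x \<partial>lborel) \<longlonglongrightarrow> (\<integral>x. \<psi> x *\<^sub>R trunc_grad b x \<partial>lborel)"
  proof (rule tendsto_L1_int)
    show "integrable lborel (\<lambda>x. \<psi> x *\<^sub>R dir_deriv b (approx k) x)" for k by (rule prod[OF ia])
    show "integrable lborel (\<lambda>x. \<psi> x *\<^sub>R trunc_grad b x)" by (rule prod[OF iz])
    have "(\<lambda>k. ennreal C * (\<integral>\<^sup>+x. ennreal (norm (d k x)) \<partial>lborel)) \<longlonglongrightarrow> ennreal C * 0"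
      by (intro ennreal_tendsto_cmult L1) simp
    then have lim: "(\<lambda>k. ennreal C * (\<integral>\<^sup>+x. ennreal (norm (d k x)) \<partial>lborel)) \<longlonglongrightarrow> 0" by simp
    have le: "(\<integral>\<^sup>+x. ennreal (norm (\<psi> x *\<^sub>R dir_deriv b (approx k) x - \<psi> x *\<^sub>R trunc_grad b x)) \<partial>lborel) \<le> ennreal C * (\<integral>\<^sup>+x. ennreal (norm (d k x)) \<partial>lborel)" for k
    proof -
      have "(\<integral>\<^sup>+x. ennreal (norm (\<psi> x *\<^sub>R dir_deriv b (approx k) x - \<psi> x *\<^sub>R trunc_grad b x)) \<partial>lborel) \<le> (\<integral>\<^sup>+x. ennreal C * ennreal (norm (d k x)) \<partial>lborel)"
      proof (rule nn_integral_mono)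
        fix x
        have "norm (\<psi> x *\<^sub>R dir_deriv b (approx k) x - \<psi> x *\<^sub>R trunc_grad b x) \<le> C * norm (d k x)"
          using mult_right_mono[OF C(1)[of x], of "norm (d k x)"] by (simp add: d_def flip: scaleR_diff_right)
        then show "ennreal (norm (\<psi> x *\<^sub>R dir_deriv b (approx k) x - \<psi> x *\<^sub>R trunc_grad b x)) \<le> ennreal C * ennreal (norm (d k x))"
          using C(2) by (simp add: ennreal_leI flip: ennreal_mult)
      qed
      also have "\<dots> = ennreal C * (\<integral>\<^sup>+x. ennreal (norm (d k x)) \<partial>lborel)"
        using dm[of k] by (simp add: nn_integral_cmult)
      finally show ?thesis .
    qed
    show "(\<lambda>k. \<integral>\<^sup>+x. ennreal (norm (\<psi> x *\<^sub>R dir_deriv b (approx k) x - \<psi> x *\<^sub>R trunc_grad b x)) \<partial>lborel) \<longlonglongrightarrow> 0"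
      by (rule tendsto_sandwich[OF _ _ tendsto_const lim]) (use le in auto)
  qed
  have "(\<integral>x. dir_deriv b \<psi> x *\<^sub>R rep x \<partial>lborel) = - (\<integral>x. \<psi> x *\<^sub>R trunc_grad b x \<partial>lborel)"
    using L tendsto_minus[OF R] unfolding parts by (rule LIMSEQ_unique)
  moreover have "(\<integral>x. \<psi> x *\<^sub>R trunc_grad b x \<partial>lebesgue_on \<Omega>) = (\<integral>x. \<psi> x *\<^sub>R trunc_grad b x \<partial>lborel)"
    using borel_measurable_continuous_onI[OF c\<psi>] trunc_grad_measurable[OF b]
    by (intro integral_lebesgue_on_eq_lborel \<Omega>_sets borel_measurable_scaleR) (simp_all add: trunc_grad_outside)
  ultimately show "(\<integral>x. dir_deriv b \<psi> x *\<^sub>R \<phi> x \<partial>lebesgue_on \<Omega>) = - (\<integral>x. \<psi> x *\<^sub>R trunc_grad b x \<partial>lebesgue_on \<Omega>)"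
    using integral_dir_deriv_test_rep[OF \<psi> b] by simp
qed

lemma approx_diff_W1_0: "(\<lambda>x. approx k x - \<phi> x) \<in> W1_0 t \<Omega>"
  by (rule W1_0_diff[OF \<Omega>(1) t test_function_in_W1_0[OF t \<Omega>(1) approx_test] \<phi>])

lemma W1_norm_approx_le: "W1_norm t \<Omega> (approx k) \<le> 7 * W1_norm t \<Omega> \<phi>"
proof -
  have "Lp_norm t \<Omega> (approx k) \<le> Lp_norm t \<Omega> \<phi>"
  proof (rule Lp_norm_le_of_Lp_bound(2)[OF t \<Omega>_sets(1)])
    have cm: "approx k \<in> borel_measurable borel"
      by (rule borel_measurable_continuous_onI[OF test_function_continuous[OF approx_test]])
    then show "approx k \<in> borel_measurable (lebesgue_on \<Omega>)"
      by (simp add: measurable_completion measurable_restrict_space1)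
    have "(\<lambda>x. indicator \<Omega> x *\<^sub>R approx k x) = approx k"
      using test_function_outside(1)[OF approx_test] by (auto simp: indicator_def fun_eq_iff)
    then show "Lp_bound t (\<lambda>x. indicator \<Omega> x *\<^sub>R approx k x) (Lp_norm t \<Omega> \<phi>)"
      using approx_Lp_bound by simp
  qed (rule Lp_norm_nonneg)
  moreover have "Lp_norm t \<Omega> (weak_deriv \<Omega> b (approx k)) \<le> 7 * Lp_norm t \<Omega> (weak_deriv \<Omega> b \<phi>)" if "b \<in> Basis" for b
    using that by (intro Lp_norm_weak_deriv_le[OF t \<Omega>(1) has_weak_deriv_test[OF \<Omega>(1) approx_test]] dir_deriv_approx_measurable dir_deriv_approx_Lp_bound)
      (auto simp: Lp_norm_nonneg)
  then have "W1_seminorm t \<Omega> (approx k) \<le> 7 * W1_seminorm t \<Omega> \<phi>"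
    unfolding W1_seminorm_def sum_distrib_left by (rule sum_mono)
  ultimately show ?thesis
    unfolding W1_norm_def using Lp_norm_nonneg[of t \<Omega> \<phi>] by (simp add: distrib_left)
qed

lemma Lp_norm_approx_diff_tendsto: "(\<lambda>k. Lp_norm t \<Omega> (\<lambda>x. approx k x - \<phi> x)) \<longlonglongrightarrow> 0"
proof -
  have near: "AE x in lebesgue_on \<Omega>. norm (approx k x - \<phi> x) \<le> 3 * \<eta> k" for k
    using rep(3) by eventually_elim (simp add: approx_near)
  have m: "(\<lambda>x. approx k x - \<phi> x) \<in> borel_measurable (lebesgue_on \<Omega>)" for k
    using approx_diff_W1_0[of k] by (simp add: W1_0_def W1_def Lp_space_def)
  define C where "C = (if t = \<infinity> then 3 else 3 * (measure lebesgue \<Omega> + 1) powr (1 / enn2real t))"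
  have "Lp_norm t \<Omega> (\<lambda>x. approx k x - \<phi> x) \<le> C * \<eta> k" for k
  proof (cases "t = \<infinity>")
    case True
    then show ?thesis
      using Lp_norm_infinity_le(2)[OF m near] \<eta>(1)[of k] by (simp add: C_def)
  next
    case False
    define s where "s = enn2real t"
    have s: "s \<ge> 1" unfolding s_def by (rule enn2real_ge_1[OF t False])
    have V: "emeasure lebesgue \<Omega> = ennreal (measure lebesgue \<Omega>)"
    proof (rule emeasure_eq_ennreal_measure)
      have "emeasure lebesgue \<Omega> = emeasure lborel \<Omega>" using \<Omega>_sets by simp
      then show "emeasure lebesgue \<Omega> \<noteq> top" using emeasure_bounded_finite[OF \<Omega>(2)] by simp
    qed
    show ?thesis
    proof (rule Lp_norm_finite_le(2)[OF t False m])
      show "0 \<le> C * \<eta> k" using \<eta>(1)[of k] by (simp add: C_def)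
      have "(\<integral>\<^sup>+x. ennreal (norm (approx k x - \<phi> x) powr s) \<partial>lebesgue_on \<Omega>) \<le> (\<integral>\<^sup>+x. ennreal ((3 * \<eta> k) powr s) \<partial>lebesgue_on \<Omega>)"
      proof (rule nn_integral_mono_AE)
        show "AE x in lebesgue_on \<Omega>. ennreal (norm (approx k x - \<phi> x) powr s) \<le> ennreal ((3 * \<eta> k) powr s)"
          using near[of k]
        proof eventually_elim
          case (elim x)
          then show ?case using s by (intro ennreal_leI powr_mono2) auto
        qed
      qed
      also have "\<dots> = ennreal ((3 * \<eta> k) powr s) * ennreal (measure lebesgue \<Omega>)"
        using \<Omega>_sets(1) by (simp add: emeasure_restrict_space V)
      also have "\<dots> \<le> ennreal ((3 * \<eta> k) powr s) * ennreal (measure lebesgue \<Omega> + 1)"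
        by (intro mult_left_mono ennreal_leI) auto
      also have "\<dots> = ennreal ((3 * \<eta> k) powr s * (measure lebesgue \<Omega> + 1))"
        by (simp add: ennreal_mult)
      also have "(3 * \<eta> k) powr s * (measure lebesgue \<Omega> + 1) = (C * \<eta> k) powr s"
        using s \<eta>(1)[of k] False by (simp add: C_def s_def[symmetric] powr_mult powr_powr)
      finally show "(\<integral>\<^sup>+x. ennreal (norm (approx k x - \<phi> x) powr enn2real t) \<partial>lebesgue_on \<Omega>) \<le> ennreal ((C * \<eta> k) powr enn2real t)"
        by (simp add: s_def)
    qed
  qed
  then have le: "\<forall>\<^sub>F k in sequentially. norm (Lp_norm t \<Omega> (\<lambda>x. approx k x - \<phi> x)) \<le> C * \<eta> k"
    by (simp add: Lp_norm_nonneg)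
  have "(\<lambda>k. C * \<eta> k) \<longlonglongrightarrow> 0" using tendsto_mult_left[OF \<eta>(2), of C] by simp
  with le show ?thesis by (rule Lim_null_comparison)
qed

lemma Lp_norm_weak_deriv_approx_diff_tendsto:
  assumes fin: "t \<noteq> \<infinity>" and b: "b \<in> Basis"
  shows "(\<lambda>k. Lp_norm t \<Omega> (weak_deriv \<Omega> b (\<lambda>x. approx k x - \<phi> x))) \<longlonglongrightarrow> 0"
proof -
  define s where "s = enn2real t"
  have s: "s \<ge> 1" unfolding s_def by (rule enn2real_ge_1[OF t fin])
  define A where "A k = (\<integral>\<^sup>+x. ennreal (norm (dir_deriv b (approx k) x - trunc_grad b x) powr s) \<partial>lborel)" for k
  have A: "A \<longlonglongrightarrow> 0" unfolding A_def s_def by (rule dir_deriv_approx_tendsto[OF fin b])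
  have wd: "has_weak_deriv \<Omega> b (\<lambda>x. approx k x - \<phi> x) (\<lambda>x. dir_deriv b (approx k) x - trunc_grad b x)" for k
    by (rule has_weak_deriv_diff[OF \<Omega>(1) b has_weak_deriv_test[OF \<Omega>(1) approx_test b] trunc_grad_weak_deriv[OF fin b]])
  have le: "Lp_norm t \<Omega> (weak_deriv \<Omega> b (\<lambda>x. approx k x - \<phi> x)) \<le> e" if e: "e > 0" "A k < ennreal (e powr s)" for k e
  proof (rule Lp_norm_weak_deriv_le[OF t \<Omega>(1) wd])
    show "(\<lambda>x. dir_deriv b (approx k) x - trunc_grad b x) \<in> borel_measurable borel"
      by (intro borel_measurable_diff dir_deriv_approx_measurable trunc_grad_measurable b)
    show "Lp_bound t (\<lambda>x. dir_deriv b (approx k) x - trunc_grad b x) e"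
      using e(2) fin by (simp add: Lp_bound_def A_def s_def less_imp_le)
  qed (use e in simp)
  show ?thesis
  proof (rule order_tendstoI)
    fix e :: real assume e: "0 < e"
    have "\<forall>\<^sub>F k in sequentially. A k < ennreal ((e / 2) powr s)"
      using order_tendstoD(2)[OF A, of "ennreal ((e / 2) powr s)"] e by simp
    then show "\<forall>\<^sub>F k in sequentially. Lp_norm t \<Omega> (weak_deriv \<Omega> b (\<lambda>x. approx k x - \<phi> x)) < e"
    proof eventually_elim
      case (elim k)
      then show ?case using le[of "e / 2" k] e by simp
    qed
  next
    fix e :: real assume "e < 0"
    then show "\<forall>\<^sub>F k in sequentially. e < Lp_norm t \<Omega> (weak_deriv \<Omega> b (\<lambda>x. approx k x - \<phi> x))"
      using Lp_norm_nonneg less_le_trans by (intro always_eventually) blast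
  qed
qed

text \<open>By this lemma every estimate for test functions that is uniform along \<open>approx\<close> holds for \<open>\<phi>\<close>. For
  finite exponents it is boundedness of \<open>f\<close> and convergence in norm; for the infinite exponent it is the
  last clause of \<open>extends_by_continuity\<close>.\<close>

lemma W1_dual_approx_tendsto:
  assumes f: "extends_by_continuity t \<Omega> f\<^sub>0 f"
  shows "(\<lambda>k. f\<^sub>0 (approx k)) \<longlonglongrightarrow> f \<phi>"
proof -
  have eq: "f (approx k) = f\<^sub>0 (approx k)" for k
    using f approx_test by (simp add: extends_by_continuity_def)
  have "(\<lambda>k. f (approx k)) \<longlonglongrightarrow> f \<phi>"
  proof (cases "t = \<infinity>")
    case True
    have "bounded (range (\<lambda>k. W1_norm \<infinity> \<Omega> (approx k)))"
    proof -
      have "norm (W1_norm \<infinity> \<Omega> (approx k)) \<le> 7 * W1_norm \<infinity> \<Omega> \<phi>" for k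
        using W1_norm_approx_le[of k] True by (simp add: W1_norm_def W1_seminorm_def Lp_norm_nonneg sum_nonneg)
      then show ?thesis unfolding bounded_iff by blast
    qed
    then show ?thesis
      using f True approx_test \<phi> Lp_norm_approx_diff_tendsto unfolding extends_by_continuity_def by blast
  next
    case False
    have fd: "f \<in> W1_dual t \<Omega>" using f by (simp add: extends_by_continuity_def)
    then have "\<exists>B. \<forall>\<phi>\<in>W1_0 t \<Omega>. \<bar>f \<phi>\<bar> \<le> B * W1_norm t \<Omega> \<phi>" by (simp add: W1_dual_def)
    then obtain B where B: "\<And>\<phi>. \<phi> \<in> W1_0 t \<Omega> \<Longrightarrow> \<bar>f \<phi>\<bar> \<le> B * W1_norm t \<Omega> \<phi>" by blast
    have add: "\<forall>\<phi>\<in>W1_0 t \<Omega>. \<forall>\<psi>\<in>W1_0 t \<Omega>. f (\<lambda>x. \<phi> x + \<psi> x) = f \<phi> + f \<psi>"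
      using fd by (simp add: W1_dual_def)
    have diff: "f (approx k) - f \<phi> = f (\<lambda>x. approx k x - \<phi> x)" for k
    proof -
      have "f (\<lambda>x. (approx k x - \<phi> x) + \<phi> x) = f (\<lambda>x. approx k x - \<phi> x) + f \<phi>"
        using add[rule_format, OF approx_diff_W1_0[of k] \<phi>] .
      then show ?thesis by simp
    qed
    have "(\<lambda>k. W1_norm t \<Omega> (\<lambda>x. approx k x - \<phi> x)) \<longlonglongrightarrow> 0 + (\<Sum>b\<in>(Basis::'a set). 0)"
      unfolding W1_norm_def W1_seminorm_def
      by (intro tendsto_add tendsto_sum Lp_norm_approx_diff_tendsto Lp_norm_weak_deriv_approx_diff_tendsto[OF False])
    then have N: "(\<lambda>k. B * W1_norm t \<Omega> (\<lambda>x. approx k x - \<phi> x)) \<longlonglongrightarrow> B * 0"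
      by (intro tendsto_mult_left) simp
    have "(\<lambda>k. f (approx k) - f \<phi>) \<longlonglongrightarrow> 0"
    proof (rule Lim_null_comparison)
      show "\<forall>\<^sub>F k in sequentially. norm (f (approx k) - f \<phi>) \<le> B * W1_norm t \<Omega> (\<lambda>x. approx k x - \<phi> x)"
        using B[OF approx_diff_W1_0] by (simp add: diff)
    qed (use N in simp)
    then show ?thesis by (simp add: LIM_zero_iff)
  qed
  then show ?thesis by (simp add: eq)
qed

end

section \<open>Morrey's inequality\<close>

text \<open>The set where the bound fails is open and negligible, hence empty.\<close>

lemma AE_le_imp_le_continuous:
  fixes g :: "'a::euclidean_space \<Rightarrow> real"
  assumes S: "open S" and g: "continuous_on S g" and ae: "AE x in lborel. x \<in> S \<longrightarrow> g x \<le> c" and x: "x \<in> S"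
  shows "g x \<le> c"
proof (rule ccontr)
  assume "\<not> g x \<le> c"
  define U where "U = S \<inter> g -` {c<..}"
  have "open U" unfolding U_def using continuous_open_preimage[OF g S] by simp
  have "x \<in> U" using x \<open>\<not> g x \<le> c\<close> by (simp add: U_def)
  have "AE x in lebesgue. x \<in> S \<longrightarrow> g x \<le> c" by (rule AE_completion[OF ae])
  then obtain N where "N \<in> null_sets lebesgue" "{x. \<not> (x \<in> S \<longrightarrow> g x \<le> c)} \<subseteq> N"
    unfolding eventually_ae_filter by auto
  moreover have "U \<subseteq> {x. \<not> (x \<in> S \<longrightarrow> g x \<le> c)}" by (auto simp: U_def)
  ultimately have "negligible U" using negligible_iff_null_sets negligible_subset by blast
  then show False using open_not_negligible[OF \<open>open U\<close>] \<open>x \<in> U\<close> by auto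
qed

lemma norm_increment_le:
  fixes u :: "'a::euclidean_space \<Rightarrow> 'b::euclidean_space"
  assumes u: "Ck_on 1 UNIV u"
  shows "ennreal (norm (u (x + y) - u x))
    \<le> (\<integral>\<^sup>+\<tau>. ennreal (norm y * (\<Sum>b\<in>Basis. norm (dir_deriv b u (x + \<tau> *\<^sub>R y)))) * indicator {0..1} \<tau> \<partial>lborel)"
proof -
  define F where "F \<tau> = (\<Sum>b\<in>Basis. (y \<bullet> b) *\<^sub>R dir_deriv b u (x + \<tau> *\<^sub>R y))" for \<tau>
  have cd: "continuous_on UNIV (dir_deriv b u)" if "b \<in> Basis" for b using u that by simp
  have cF: "continuous_on {0..1} F"
    unfolding F_def by (intro continuous_intros continuous_on_compose2[OF cd]) auto
  have D: "((\<lambda>\<tau>. u (x + \<tau> *\<^sub>R y)) has_vector_derivative F \<tau>) (at \<tau> within {0..1})" for \<tau>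
  proof -
    have 1: "((\<lambda>\<tau>. x + \<tau> *\<^sub>R y) has_derivative (\<lambda>h. h *\<^sub>R y)) (at \<tau> within {0..1})"
      by (auto intro!: derivative_eq_intros)
    have 2: "(u has_derivative (\<lambda>h. \<Sum>b\<in>Basis. (h \<bullet> b) *\<^sub>R dir_deriv b u (x + \<tau> *\<^sub>R y))) (at (x + \<tau> *\<^sub>R y))"
      using u by (intro has_derivative_dir_deriv) simp
    from has_derivative_compose[OF 1 2] show ?thesis
      by (simp add: has_vector_derivative_def F_def scaleR_sum_right)
  qed
  have int: "integrable lborel (\<lambda>\<tau>. indicator {0..1} \<tau> *\<^sub>R F \<tau>)"
    by (rule borel_integrable_compact[OF compact_Icc cF])
  have "u (x + y) - u x = (\<integral>\<tau>. indicator {0..1} \<tau> *\<^sub>R F \<tau> \<partial>lborel)"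
    using integral_FTC_atLeastAtMost[of 0 1 "\<lambda>\<tau>. u (x + \<tau> *\<^sub>R y)" F] D cF by simp
  then have "ennreal (norm (u (x + y) - u x)) \<le> (\<integral>\<^sup>+\<tau>. ennreal (norm (indicator {0..1} \<tau> *\<^sub>R F \<tau>)) \<partial>lborel)"
    using integral_norm_bound_ennreal[OF int] by simp
  also have "\<dots> \<le> (\<integral>\<^sup>+\<tau>. ennreal (norm y * (\<Sum>b\<in>Basis. norm (dir_deriv b u (x + \<tau> *\<^sub>R y)))) * indicator {0..1} \<tau> \<partial>lborel)"
  proof (rule nn_integral_mono)
    fix \<tau> :: real
    have "norm (F \<tau>) \<le> (\<Sum>b\<in>Basis. norm y * norm (dir_deriv b u (x + \<tau> *\<^sub>R y)))"
      unfolding F_def by (rule sum_norm_le) (simp add: Basis_le_norm mult_right_mono)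
    then have "norm (F \<tau>) \<le> norm y * (\<Sum>b\<in>Basis. norm (dir_deriv b u (x + \<tau> *\<^sub>R y)))"
      by (simp add: sum_distrib_left)
    then show "ennreal (norm (indicator {0..1} \<tau> *\<^sub>R F \<tau>)) \<le> ennreal (norm y * (\<Sum>b\<in>Basis. norm (dir_deriv b u (x + \<tau> *\<^sub>R y)))) * indicator {0..1} \<tau>"
      by (cases "\<tau> \<in> {0..1}") (auto intro: ennreal_leI)
  qed
  finally show ?thesis .
qed

text \<open>The dual exponent \<open>t\<close> exceeds the dimension \<open>n\<close>, stated for \<open>p\<close> in a form without division. The type
  parameter \<open>dom\<close> carries the dimension.\<close>

locale conjugate_exponents =
  fixes p :: real and t :: ennreal and dom :: "'a::euclidean_space itself"
  assumes p: "1 \<le> p" and conj: "1 / ennreal p + 1 / t = 1"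
    and subcritical: "p * (real DIM('a) - 1) < real DIM('a)"
begin

definition \<alpha> :: real where "\<alpha> = 1 - real DIM('a) + real DIM('a) / p"

lemma \<alpha>_pos: "\<alpha> > 0"
  using subcritical p by (simp add: \<alpha>_def field_simps)

lemma t_cases:
  obtains "p = 1" "t = \<infinity>" | "p > 1" "t \<noteq> \<infinity>" "enn2real t > 1" "1 / p + 1 / enn2real t = 1" "t = ennreal (enn2real t)"
proof (cases "p = 1")
  case True
  then have "1 + 1 / t = 1 + 0" using conj by simp
  then have "1 / t = 0" by (simp only: ennreal_add_left_cancel) auto
  then have "t = \<infinity>" by (simp add: divide_ennreal_def ennreal_inverse_eq_0_iff)
  with True that(1) show ?thesis by blast
next
  case False
  then have p1: "p > 1" using p by simp
  have ip: "1 / ennreal p = ennreal (1 / p)"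
    using p by (simp add: divide_ennreal[symmetric] flip: ennreal_1)
  have "t \<noteq> \<infinity>"
  proof
    assume "t = \<infinity>"
    then have "ennreal (1 / p) = ennreal 1" using conj ip by simp
    then show False using p1 by simp
  qed
  then obtain s where s: "t = ennreal s" "s \<ge> 0" by (cases t rule: ennreal_cases) auto
  have "s \<noteq> 0"
  proof
    assume "s = 0"
    then have "1 / t = \<infinity>" using s by (simp add: ennreal_divide_zero)
    then show False using conj by simp
  qed
  then have s0: "s > 0" using s by simp
  have "1 / t = ennreal (1 / s)"
    using s0 s by (simp add: divide_ennreal[symmetric] flip: ennreal_1)
  then have "ennreal (1 / p + 1 / s) = ennreal 1"
    using conj ip p1 s0 by simp
  then have eq: "1 / p + 1 / s = 1" using p1 s0 by (subst (asm) ennreal_inj) auto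
  then have "1 / s < 1" using p1 by (smt (verit) divide_pos_pos)
  then have "s > 1" using s0 by (simp add: field_simps)
  then show ?thesis using that(2) p1 \<open>t \<noteq> \<infinity>\<close> s eq by simp
qed

lemma t_ge_1: "1 \<le> t"
  by (rule t_cases) (auto, metis ennreal_1 ennreal_leI less_imp_le)

text \<open>Hoelder's inequality combined with the substitution \<open>z = x + \<tau>y\<close>, which multiplies the \<open>L\<^sup>t\<close> norm of
  the second factor by \<open>\<tau>\<close> to the power \<open>-n/t = \<alpha> - 1\<close>. For the infinite exponent, continuity turns
  the essential bound into a pointwise one and \<open>\<alpha> = 1\<close>.\<close>

lemma scaled_pairing_le:
  fixes \<omega> :: "'a \<Rightarrow> real" and G :: "'a \<Rightarrow> 'b::euclidean_space"
  assumes \<omega>: "\<omega> \<in> borel_measurable borel" "\<And>y. 0 \<le> \<omega> y" "(\<integral>\<^sup>+y. ennreal (\<omega> y powr p) \<partial>lborel) \<le> ennreal (D powr p)" "D \<ge> 0"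
    and G: "continuous_on UNIV G" "Lp_bound t G N" "N \<ge> 0" and \<tau>: "\<tau> > 0"
  shows "(\<integral>\<^sup>+y. ennreal (\<omega> y * norm (G (x + \<tau> *\<^sub>R y))) \<partial>lborel) \<le> ennreal (D * N) * ennreal (\<tau> powr (\<alpha> - 1))"
proof (rule t_cases)
  assume *: "p = 1" "t = \<infinity>"
  have a1: "\<alpha> = 1" unfolding \<alpha>_def using * by simp
  have "AE x in lborel. x \<in> UNIV \<longrightarrow> norm (G x) \<le> N" using G(2) * by (simp add: Lp_bound_def)
  then have GN: "norm (G z) \<le> N" for z
    using AE_le_imp_le_continuous[of UNIV "\<lambda>x. norm (G x)" N z] continuous_on_norm[OF G(1)] by auto
  have "(\<integral>\<^sup>+y. ennreal (\<omega> y * norm (G (x + \<tau> *\<^sub>R y))) \<partial>lborel) \<le> (\<integral>\<^sup>+y. ennreal (\<omega> y powr p) * ennreal N \<partial>lborel)"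
  proof (rule nn_integral_mono)
    show "ennreal (\<omega> y * norm (G (x + \<tau> *\<^sub>R y))) \<le> ennreal (\<omega> y powr p) * ennreal N" for y
      using * \<omega>(2)[of y] GN G(3) by (auto simp: ennreal_leI mult_left_mono simp flip: ennreal_mult)
  qed
  also have "\<dots> = (\<integral>\<^sup>+y. ennreal (\<omega> y powr p) \<partial>lborel) * ennreal N"
    using \<omega>(1) by (intro nn_integral_multc) simp
  also have "\<dots> \<le> ennreal (D powr p) * ennreal N" by (intro mult_right_mono \<omega>) auto
  also have "\<dots> = ennreal (D * N) * ennreal (\<tau> powr (\<alpha> - 1))"
    using * \<omega>(4) G(3) \<tau> unfolding a1 by (simp add: ennreal_mult)
  finally show ?thesis .
next
  assume *: "p > 1" "t \<noteq> \<infinity>" "enn2real t > 1" "1 / p + 1 / enn2real t = 1"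
  define s where "s = enn2real t"
  have Gm: "G \<in> borel_measurable borel" by (rule borel_measurable_continuous_onI[OF G(1)])
  have cG: "continuous_on UNIV (\<lambda>y. G (x + \<tau> *\<^sub>R y))"
    by (intro continuous_on_compose2[OF G(1)] continuous_intros) auto
  define e where "e = - real DIM('a) / s"
  have se: "s * e = - real DIM('a)" using * by (simp add: e_def s_def)
  have ea: "e = \<alpha> - 1"
  proof -
    have "1 / s = 1 - 1 / p" using * by (simp add: s_def)
    then have "e = - real DIM('a) * (1 - 1 / p)" by (simp add: e_def divide_inverse)
    then show ?thesis by (simp add: \<alpha>_def algebra_simps)
  qed
  have "(\<integral>\<^sup>+y. ennreal (\<omega> y * norm (G (x + \<tau> *\<^sub>R y))) \<partial>lborel) \<le> ennreal (D * (N * \<tau> powr e))"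
  proof (rule nn_integral_Holder[OF *(1) *(3)[folded s_def] *(4)[folded s_def]])
    have "(\<integral>\<^sup>+z. ennreal (norm (G z) powr s) \<partial>lborel) = ennreal (\<bar>\<tau>\<bar> ^ DIM('a)) * (\<integral>\<^sup>+y. ennreal (norm (G (x + \<tau> *\<^sub>R y)) powr s) \<partial>lborel)"
      using \<tau> Gm by (intro nn_integral_lborel_affine) auto
    then have "ennreal (\<tau> ^ DIM('a)) * (\<integral>\<^sup>+y. ennreal (norm (G (x + \<tau> *\<^sub>R y)) powr s) \<partial>lborel) \<le> ennreal (N powr s)"
      using G(2) * \<tau> by (simp add: Lp_bound_def s_def)
    then have "ennreal (\<tau> powr (- real DIM('a))) * (ennreal (\<tau> ^ DIM('a)) * (\<integral>\<^sup>+y. ennreal (norm (G (x + \<tau> *\<^sub>R y)) powr s) \<partial>lborel)) \<le> ennreal (\<tau> powr (- real DIM('a))) * ennreal (N powr s)"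
      by (rule mult_left_mono) simp
    moreover have "ennreal (\<tau> powr (- real DIM('a))) * ennreal (\<tau> ^ DIM('a)) = 1"
      using \<tau> by (simp add: powr_minus powr_realpow flip: ennreal_mult)
    moreover have "ennreal (\<tau> powr (- real DIM('a))) * ennreal (N powr s) = ennreal ((N * \<tau> powr e) powr s)"
      using \<tau> G(3) se by (simp add: powr_mult powr_powr mult.commute flip: ennreal_mult)
    ultimately show "(\<integral>\<^sup>+y. ennreal (norm (G (x + \<tau> *\<^sub>R y)) powr s) \<partial>lborel) \<le> ennreal ((N * \<tau> powr e) powr s)"
      by (simp flip: mult.assoc)
    show "(\<lambda>y. norm (G (x + \<tau> *\<^sub>R y))) \<in> borel_measurable lborel"
      using borel_measurable_continuous_onI[OF continuous_on_norm[OF cG]] by simp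
  qed (use \<omega> G in auto)
  also have "\<dots> = ennreal (D * N) * ennreal (\<tau> powr (\<alpha> - 1))"
    using \<omega>(4) G(3) by (simp add: ea ennreal_mult mult.assoc)
  finally show ?thesis .
qed

lemma nn_integral_powr_unit: "(\<integral>\<^sup>+\<tau>. ennreal (\<tau> powr (\<alpha> - 1)) * indicator {0..1} \<tau> \<partial>lborel) = ennreal (1 / \<alpha>)"
proof -
  have "((\<lambda>\<tau>. \<tau> powr (\<alpha> - 1)) has_integral (1 powr (\<alpha> - 1 + 1) / (\<alpha> - 1 + 1))) {0..1}"
    using \<alpha>_pos by (intro has_integral_powr_from_0) auto
  then have "((\<lambda>\<tau>. \<tau> powr (\<alpha> - 1)) has_integral (1 / \<alpha>)) {0..1}" by simp
  then have "integral\<^sup>N lborel (\<lambda>x. indicator {0..1} x * x powr (\<alpha> - 1)) = ennreal (1 / \<alpha>)"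
    by (intro nn_integral_has_integral_lebesgue) auto
  moreover have "ennreal (indicator {0..1} x * x powr (\<alpha> - 1)) = ennreal (x powr (\<alpha> - 1)) * indicator {0..1} x" for x :: real
    by (cases "x \<in> {0..1}") auto
  ultimately show ?thesis by simp
qed

text \<open>The central estimate. Bound the increment by the integral of the gradient along the segment, exchange the
  integrals, and apply \<open>scaled_pairing_le\<close> for each \<open>\<tau>\<close>; what remains is the integral of
  \<open>\<tau> powr (\<alpha> - 1)\<close> over the unit interval, which is \<open>1 / \<alpha>\<close>.\<close>

lemma weighted_increment_le:
  fixes \<delta> :: "'a \<Rightarrow> real" and u :: "'a \<Rightarrow> 'b::euclidean_space"
  assumes \<delta>: "\<delta> \<in> borel_measurable borel" "(\<integral>\<^sup>+y. ennreal ((\<bar>\<delta> y\<bar> * norm y) powr p) \<partial>lborel) \<le> ennreal (D powr p)" "D \<ge> 0"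
    and u: "Ck_on 1 UNIV u" "\<And>b. b \<in> Basis \<Longrightarrow> Lp_bound t (dir_deriv b u) (N b)" "\<And>b. b \<in> Basis \<Longrightarrow> N b \<ge> 0"
  shows "(\<integral>\<^sup>+y. ennreal (\<bar>\<delta> y\<bar> * norm (u (x + y) - u x)) \<partial>lborel) \<le> ennreal (D * (\<Sum>b\<in>Basis. N b) / \<alpha>)"
proof -
  define \<omega> where "\<omega> y = \<bar>\<delta> y\<bar> * norm y" for y
  have \<omega>m: "\<omega> \<in> borel_measurable borel" unfolding \<omega>_def[abs_def] using \<delta>(1) by simp
  have \<omega>0: "\<omega> y \<ge> 0" for y by (simp add: \<omega>_def)
  have cd: "continuous_on UNIV (dir_deriv b u)" if "b \<in> Basis" for b using u(1) that by simp
  define H where "H b \<tau> y = ennreal (\<omega> y * norm (dir_deriv b u (x + \<tau> *\<^sub>R y))) * indicator {0..1} \<tau>" for b \<tau> y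
  have Hm: "(\<lambda>(\<tau>, y). H b \<tau> y) \<in> borel_measurable (lborel \<Otimes>\<^sub>M lborel)" if b: "b \<in> Basis" for b
  proof -
    have "continuous_on UNIV (\<lambda>z::real \<times> 'a. norm (dir_deriv b u (x + fst z *\<^sub>R snd z)))"
      by (intro continuous_intros continuous_on_compose2[OF cd[OF b]]) auto
    from borel_measurable_continuous_onI[OF this]
    have "(\<lambda>z. norm (dir_deriv b u (x + fst z *\<^sub>R snd z))) \<in> borel_measurable (lborel \<Otimes>\<^sub>M lborel)"
      by (simp add: borel_prod measurable_cong_sets[OF sets_pair_measure_cong[OF sets_lborel sets_lborel] refl])
    moreover have "(\<lambda>z. \<omega> (snd z)) \<in> borel_measurable (lborel \<Otimes>\<^sub>M lborel)"
      using \<omega>m by measurable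
    moreover have "(\<lambda>z. indicator {0..1} (fst z) :: ennreal) \<in> borel_measurable ((lborel :: real measure) \<Otimes>\<^sub>M (lborel :: 'a measure))"
      by measurable
    ultimately have "(\<lambda>z. ennreal (\<omega> (snd z) * norm (dir_deriv b u (x + fst z *\<^sub>R snd z))) * indicator {0..1} (fst z)) \<in> borel_measurable (lborel \<Otimes>\<^sub>M lborel)"
      by (intro borel_measurable_times_ennreal measurable_compose[OF borel_measurable_times measurable_ennreal])
    then show ?thesis by (simp add: H_def case_prod_unfold)
  qed
  have "(\<integral>\<^sup>+y. ennreal (\<bar>\<delta> y\<bar> * norm (u (x + y) - u x)) \<partial>lborel) \<le> (\<integral>\<^sup>+y. (\<integral>\<^sup>+\<tau>. (\<Sum>b\<in>Basis. H b \<tau> y) \<partial>lborel) \<partial>lborel)"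
  proof (rule nn_integral_mono)
    fix y
    have "ennreal (\<bar>\<delta> y\<bar> * norm (u (x + y) - u x)) = ennreal \<bar>\<delta> y\<bar> * ennreal (norm (u (x + y) - u x))"
      by (simp add: ennreal_mult)
    also have "\<dots> \<le> ennreal \<bar>\<delta> y\<bar> * (\<integral>\<^sup>+\<tau>. ennreal (norm y * (\<Sum>b\<in>Basis. norm (dir_deriv b u (x + \<tau> *\<^sub>R y)))) * indicator {0..1} \<tau> \<partial>lborel)"
      by (intro mult_left_mono norm_increment_le u(1)) simp
    also have "\<dots> = (\<integral>\<^sup>+\<tau>. ennreal \<bar>\<delta> y\<bar> * (ennreal (norm y * (\<Sum>b\<in>Basis. norm (dir_deriv b u (x + \<tau> *\<^sub>R y)))) * indicator {0..1} \<tau>) \<partial>lborel)"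
    proof (rule nn_integral_cmult[symmetric])
      have "continuous_on UNIV (\<lambda>\<tau>. norm y * (\<Sum>b\<in>Basis. norm (dir_deriv b u (x + \<tau> *\<^sub>R y))))"
        by (intro continuous_intros continuous_on_compose2[OF cd]) auto
      from borel_measurable_continuous_onI[OF this]
      show "(\<lambda>\<tau>. ennreal (norm y * (\<Sum>b\<in>Basis. norm (dir_deriv b u (x + \<tau> *\<^sub>R y)))) * indicator {0..1} \<tau>) \<in> borel_measurable lborel"
        by (intro borel_measurable_times_ennreal) auto
    qed
    also have "\<dots> = (\<integral>\<^sup>+\<tau>. (\<Sum>b\<in>Basis. H b \<tau> y) \<partial>lborel)"
    proof (rule nn_integral_cong)
      fix \<tau> :: real
      show "ennreal \<bar>\<delta> y\<bar> * (ennreal (norm y * (\<Sum>b\<in>Basis. norm (dir_deriv b u (x + \<tau> *\<^sub>R y)))) * indicator {0..1} \<tau>) = (\<Sum>b\<in>Basis. H b \<tau> y)"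
      proof (cases "\<tau> \<in> {0..1}")
        case True
        have "ennreal \<bar>\<delta> y\<bar> * ennreal (norm y * (\<Sum>b\<in>Basis. norm (dir_deriv b u (x + \<tau> *\<^sub>R y))))
          = ennreal (\<bar>\<delta> y\<bar> * (norm y * (\<Sum>b\<in>Basis. norm (dir_deriv b u (x + \<tau> *\<^sub>R y)))))"
          by (rule ennreal_mult[symmetric]) (auto intro!: mult_nonneg_nonneg sum_nonneg)
        also have "\<dots> = ennreal (\<Sum>b\<in>Basis. \<omega> y * norm (dir_deriv b u (x + \<tau> *\<^sub>R y)))"
          by (simp add: \<omega>_def sum_distrib_left mult.assoc)
        also have "\<dots> = (\<Sum>b\<in>Basis. ennreal (\<omega> y * norm (dir_deriv b u (x + \<tau> *\<^sub>R y))))"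
          by (rule sum_ennreal[symmetric]) (simp add: \<omega>0)
        finally show ?thesis using True by (simp add: H_def)
      qed (simp add: H_def)
    qed
    finally show "ennreal (\<bar>\<delta> y\<bar> * norm (u (x + y) - u x)) \<le> (\<integral>\<^sup>+\<tau>. (\<Sum>b\<in>Basis. H b \<tau> y) \<partial>lborel)" .
  qed
  also have "\<dots> = (\<integral>\<^sup>+\<tau>. (\<integral>\<^sup>+y. (\<Sum>b\<in>Basis. H b \<tau> y) \<partial>lborel) \<partial>lborel)"
  proof (rule lborel_pair.Fubini')
    show "(\<lambda>(\<tau>, y). \<Sum>b\<in>Basis. H b \<tau> y) \<in> borel_measurable (lborel \<Otimes>\<^sub>M lborel)"
      unfolding case_prod_unfold using Hm by (intro borel_measurable_sum) (simp add: case_prod_unfold)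
  qed
  also have "\<dots> \<le> (\<integral>\<^sup>+\<tau>. (\<Sum>b\<in>Basis. ennreal (D * N b)) * (ennreal (\<tau> powr (\<alpha> - 1)) * indicator {0..1} \<tau>) \<partial>lborel)"
  proof (rule nn_integral_mono_AE)
    have "AE \<tau> in lborel. \<tau> \<noteq> (0::real)" by (rule AE_lborel_singleton)
    then show "AE \<tau> in lborel. (\<integral>\<^sup>+y. (\<Sum>b\<in>Basis. H b \<tau> y) \<partial>lborel) \<le> (\<Sum>b\<in>Basis. ennreal (D * N b)) * (ennreal (\<tau> powr (\<alpha> - 1)) * indicator {0..1} \<tau>)"
    proof eventually_elim
      case (elim \<tau>)
      show ?case
      proof (cases "\<tau> \<in> {0..1}")
        case True
        then have \<tau>: "\<tau> > 0" using elim by auto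
        have "(\<integral>\<^sup>+y. (\<Sum>b\<in>Basis. H b \<tau> y) \<partial>lborel) = (\<integral>\<^sup>+y. (\<Sum>b\<in>Basis. ennreal (\<omega> y * norm (dir_deriv b u (x + \<tau> *\<^sub>R y)))) \<partial>lborel)"
          using True by (simp add: H_def)
        also have "\<dots> = (\<Sum>b\<in>Basis. \<integral>\<^sup>+y. ennreal (\<omega> y * norm (dir_deriv b u (x + \<tau> *\<^sub>R y))) \<partial>lborel)"
        proof (rule nn_integral_sum)
          fix b :: 'a assume b: "b \<in> Basis"
          have "continuous_on UNIV (\<lambda>y. norm (dir_deriv b u (x + \<tau> *\<^sub>R y)))"
            by (intro continuous_intros continuous_on_compose2[OF cd[OF b]]) auto
          from borel_measurable_continuous_onI[OF this]
          show "(\<lambda>y. ennreal (\<omega> y * norm (dir_deriv b u (x + \<tau> *\<^sub>R y)))) \<in> borel_measurable lborel"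
            using \<omega>m by simp
        qed
        also have "\<dots> \<le> (\<Sum>b\<in>Basis. ennreal (D * N b) * ennreal (\<tau> powr (\<alpha> - 1)))"
          by (intro sum_mono scaled_pairing_le \<omega>m \<omega>0 cd u \<delta>(3) \<tau>) (use \<delta>(2) in \<open>simp add: \<omega>_def\<close>)
        finally show ?thesis using True by (simp add: sum_distrib_right)
      qed (simp add: H_def)
    qed
  qed
  also have "\<dots> = (\<Sum>b\<in>Basis. ennreal (D * N b)) * ennreal (1 / \<alpha>)"
  proof -
    have "(\<lambda>\<tau>. ennreal (\<tau> powr (\<alpha> - 1)) * indicator {0..1} \<tau>) \<in> borel_measurable lborel"
      by (intro borel_measurable_times_ennreal) auto
    then show ?thesis by (simp only: nn_integral_cmult nn_integral_powr_unit)
  qed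
  also have "\<dots> = ennreal ((\<Sum>b\<in>Basis. D * N b) * (1 / \<alpha>))"
  proof -
    have nn: "0 \<le> D * N b" if "b \<in> Basis" for b using \<delta>(3) u(3)[OF that] by simp
    then have "(\<Sum>b\<in>Basis. ennreal (D * N b)) = ennreal (\<Sum>b\<in>Basis. D * N b)" by (rule sum_ennreal)
    moreover have "0 \<le> (\<Sum>b\<in>Basis. D * N b)" using nn by (rule sum_nonneg)
    moreover have "0 \<le> 1 / \<alpha>" using \<alpha>_pos by simp
    ultimately show ?thesis by (metis ennreal_mult)
  qed
  also have "(\<Sum>b\<in>Basis. D * N b) * (1 / \<alpha>) = D * (\<Sum>b\<in>Basis. N b) / \<alpha>"
    by (simp add: sum_distrib_left)
  finally show ?thesis .
qed

definition \<kappa> :: real where "\<kappa> = unit_ball_vol (real DIM('a)) powr (1 / p - 1)"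

lemma \<kappa>_pos: "\<kappa> > 0"
proof -
  have "unit_ball_vol (real DIM('a)) > 0" by (rule unit_ball_vol_pos) simp
  then show ?thesis unfolding \<kappa>_def powr_gt_zero by linarith
qed

text \<open>The central estimate with the indicator of a ball as kernel. The points of the ball have distance at most
  \<open>2 * r\<close> from \<open>x\<close>, so the weighted kernel has \<open>L\<^sup>p\<close> norm at most \<open>2 * r\<close> times the volume to the
  power \<open>1/p\<close>.\<close>

lemma ball_oscillation_le:
  fixes u :: "'a \<Rightarrow> 'b::euclidean_space"
  assumes u: "Ck_on 1 UNIV u" "\<And>b. b \<in> Basis \<Longrightarrow> Lp_bound t (dir_deriv b u) (N b)" "\<And>b. b \<in> Basis \<Longrightarrow> N b \<ge> 0"
    and r: "r > 0" "norm (m - x) \<le> r"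
  shows "(\<integral>\<^sup>+y. ennreal (norm (u y - u x)) * indicator (ball m r) y \<partial>lborel)
    \<le> ennreal (2 * \<kappa> * r powr \<alpha> * (\<Sum>b\<in>Basis. N b) / \<alpha> * measure lborel (ball m r))"
proof -
  define V where "V = measure lborel (ball m r)"
  have V: "V = unit_ball_vol (real DIM('a)) * r ^ DIM('a)" using r by (simp add: V_def content_ball)
  have V0: "V > 0" using r by (simp add: V_def)
  have eV: "emeasure lborel (ball (m - x) r) = ennreal V" using r by (simp add: emeasure_ball V)
  define \<delta> :: "'a \<Rightarrow> real" where "\<delta> y = indicator (ball (m - x) r) y" for y
  define D where "D = 2 * r * V powr (1 / p)"
  have \<delta>m: "\<delta> \<in> borel_measurable borel" unfolding \<delta>_def[abs_def] by (intro borel_measurable_indicator) simp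
  have "(\<integral>\<^sup>+y. ennreal ((\<bar>\<delta> y\<bar> * norm y) powr p) \<partial>lborel) \<le> (\<integral>\<^sup>+y. ennreal ((2 * r) powr p) * indicator (ball (m - x) r) y \<partial>lborel)"
  proof (rule nn_integral_mono)
    fix y
    show "ennreal ((\<bar>\<delta> y\<bar> * norm y) powr p) \<le> ennreal ((2 * r) powr p) * indicator (ball (m - x) r) y"
    proof (cases "y \<in> ball (m - x) r")
      case True
      then have "norm y \<le> 2 * r"
        using r norm_triangle_sub[of y "m - x"] by (simp add: dist_norm norm_minus_commute)
      then have "norm y powr p \<le> (2 * r) powr p" using p by (intro powr_mono2) auto
      then show ?thesis using True by (simp add: \<delta>_def ennreal_leI)
    qed (simp add: \<delta>_def)
  qed
  also have "\<dots> = ennreal ((2 * r) powr p) * ennreal V"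
    by (subst nn_integral_cmult_indicator) (simp_all add: eV)
  also have "\<dots> = ennreal (D powr p)"
    using r V0 p by (simp add: D_def powr_mult powr_powr flip: ennreal_mult)
  finally have \<delta>D: "(\<integral>\<^sup>+y. ennreal ((\<bar>\<delta> y\<bar> * norm y) powr p) \<partial>lborel) \<le> ennreal (D powr p)" .
  have D0: "D \<ge> 0" using r by (simp add: D_def)
  have um: "u \<in> borel_measurable borel" by (rule borel_measurable_continuous_onI[OF Ck_on_continuous[OF u(1)]])
  have fm: "(\<lambda>y. ennreal (norm (u y - u x)) * indicator (ball m r) y) \<in> borel_measurable borel"
    using um by (intro borel_measurable_times_ennreal borel_measurable_indicator) simp_all
  have "(\<integral>\<^sup>+y. ennreal (norm (u y - u x)) * indicator (ball m r) y \<partial>lborel)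
    = (\<integral>\<^sup>+y. ennreal (norm (u (x + y) - u x)) * indicator (ball m r) (x + y) \<partial>lborel)"
    using nn_integral_lborel_shift[OF fm, of x] by simp
  also have "\<dots> = (\<integral>\<^sup>+y. ennreal (\<bar>\<delta> y\<bar> * norm (u (x + y) - u x)) \<partial>lborel)"
  proof (rule nn_integral_cong)
    fix y
    have "x + y \<in> ball m r \<longleftrightarrow> y \<in> ball (m - x) r" by (simp add: dist_norm algebra_simps)
    then show "ennreal (norm (u (x + y) - u x)) * indicator (ball m r) (x + y) = ennreal (\<bar>\<delta> y\<bar> * norm (u (x + y) - u x))"
      by (cases "y \<in> ball (m - x) r") (simp_all add: \<delta>_def)
  qed
  also have "\<dots> \<le> ennreal (D * (\<Sum>b\<in>Basis. N b) / \<alpha>)"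
    by (rule weighted_increment_le[OF \<delta>m \<delta>D D0 u])
  also have "D = 2 * \<kappa> * r powr \<alpha> * V"
  proof -
    have "V powr (1 / p) = V powr (1 / p - 1) * V" using V0 powr_add[of V "1 / p - 1" 1] by simp
    also have "V powr (1 / p - 1) = \<kappa> * r powr (real DIM('a) * (1 / p - 1))"
      using r unfolding V by (simp add: \<kappa>_def powr_mult powr_powr flip: powr_realpow)
    also have "real DIM('a) * (1 / p - 1) = \<alpha> - 1" by (simp add: \<alpha>_def algebra_simps)
    finally have "D = 2 * \<kappa> * (r * r powr (\<alpha> - 1)) * V" by (simp add: D_def)
    also have "r * r powr (\<alpha> - 1) = r powr \<alpha>" using r powr_add[of r 1 "\<alpha> - 1"] by simp
    finally show ?thesis .
  qed
  also have "2 * \<kappa> * r powr \<alpha> * V * (\<Sum>b\<in>Basis. N b) / \<alpha> = 2 * \<kappa> * r powr \<alpha> * (\<Sum>b\<in>Basis. N b) / \<alpha> * V" by simp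
  finally show ?thesis by (simp add: V_def)
qed

text \<open>Compare \<open>u x\<close> and \<open>u z\<close> with the values of \<open>u\<close> on the ball about \<open>x\<close> of radius \<open>norm (x - z)\<close>.\<close>

lemma Morrey_Hoelder:
  fixes u :: "'a \<Rightarrow> 'b::euclidean_space"
  assumes u: "Ck_on 1 UNIV u" "\<And>b. b \<in> Basis \<Longrightarrow> Lp_bound t (dir_deriv b u) (N b)" "\<And>b. b \<in> Basis \<Longrightarrow> N b \<ge> 0"
  shows "norm (u x - u z) \<le> 4 * \<kappa> / \<alpha> * (\<Sum>b\<in>Basis. N b) * norm (x - z) powr \<alpha>"
proof (cases "x = z")
  case False
  define r where "r = norm (x - z)"
  have r: "r > 0" using False by (simp add: r_def)
  have zx: "norm (x - x) \<le> r" "norm (x - z) \<le> r" using r by (auto simp: r_def)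
  define V where "V = measure lborel (ball x r)"
  have V0: "V > 0" using r by (simp add: V_def)
  have eV: "emeasure lborel (ball x r) = ennreal V"
    using r by (simp add: V_def emeasure_ball content_ball)
  define E where "E = 2 * \<kappa> * r powr \<alpha> * (\<Sum>b\<in>Basis. N b) / \<alpha> * V"
  have E0: "E \<ge> 0" unfolding E_def using \<kappa>_pos \<alpha>_pos V0 u(3)
    by (intro mult_nonneg_nonneg divide_nonneg_pos sum_nonneg) auto
  have um: "u \<in> borel_measurable borel" by (rule borel_measurable_continuous_onI[OF Ck_on_continuous[OF u(1)]])
  have fm: "(\<lambda>y. ennreal (norm (u y - u w)) * indicator (ball x r) y) \<in> borel_measurable lborel" for w
    using um by (intro borel_measurable_times_ennreal borel_measurable_indicator) simp_all
  have "ennreal (norm (u x - u z) * V) = (\<integral>\<^sup>+y. ennreal (norm (u x - u z)) * indicator (ball x r) y \<partial>lborel)"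
    by (subst nn_integral_cmult_indicator) (simp_all add: eV ennreal_mult V0 less_imp_le)
  also have "\<dots> \<le> (\<integral>\<^sup>+y. ennreal (norm (u y - u x)) * indicator (ball x r) y + ennreal (norm (u y - u z)) * indicator (ball x r) y \<partial>lborel)"
  proof (rule nn_integral_mono)
    fix y
    have "norm (u x - u z) \<le> norm (u y - u x) + norm (u y - u z)"
      using norm_triangle_ineq4[of "u y - u z" "u y - u x"] by simp
    then have "ennreal (norm (u x - u z)) \<le> ennreal (norm (u y - u x)) + ennreal (norm (u y - u z))"
      by (simp add: ennreal_leI flip: ennreal_plus)
    then show "ennreal (norm (u x - u z)) * indicator (ball x r) y \<le> ennreal (norm (u y - u x)) * indicator (ball x r) y + ennreal (norm (u y - u z)) * indicator (ball x r) y"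
      by (cases "y \<in> ball x r") simp_all
  qed
  also have "\<dots> = (\<integral>\<^sup>+y. ennreal (norm (u y - u x)) * indicator (ball x r) y \<partial>lborel) + (\<integral>\<^sup>+y. ennreal (norm (u y - u z)) * indicator (ball x r) y \<partial>lborel)"
    by (rule nn_integral_add[OF fm fm])
  also have "\<dots> \<le> ennreal E + ennreal E"
    unfolding E_def V_def by (intro add_mono ball_oscillation_le[OF u] r zx)
  also have "\<dots> = ennreal (2 * E)" using E0 by (simp flip: ennreal_plus)
  finally have "norm (u x - u z) * V \<le> 2 * E" using E0 by (simp add: ennreal_le_iff)
  then have "norm (u x - u z) * V \<le> (4 * \<kappa> / \<alpha> * (\<Sum>b\<in>Basis. N b) * r powr \<alpha>) * V" by (simp add: E_def field_simps)
  then show ?thesis using V0 unfolding r_def by (rule mult_right_le_imp_le)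
qed simp

text \<open>Compare \<open>u x\<close> with the mean of \<open>norm u\<close> over the unit ball about \<open>x\<close>, which Hoelder's inequality bounds
  by the norm of \<open>u\<close>.\<close>

lemma Morrey_sup:
  fixes u :: "'a \<Rightarrow> 'b::euclidean_space"
  assumes u: "Ck_on 1 UNIV u" "\<And>b. b \<in> Basis \<Longrightarrow> Lp_bound t (dir_deriv b u) (N b)" "\<And>b. b \<in> Basis \<Longrightarrow> N b \<ge> 0"
    and u0: "Lp_bound t u N0" "N0 \<ge> 0"
  shows "norm (u x) \<le> \<kappa> * N0 + 2 * \<kappa> / \<alpha> * (\<Sum>b\<in>Basis. N b)"
proof -
  have cu: "continuous_on UNIV u" by (rule Ck_on_continuous[OF u(1)])
  have um: "u \<in> borel_measurable borel" by (rule borel_measurable_continuous_onI[OF cu])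
  define V where "V = measure lborel (ball x 1)"
  have VV: "V = unit_ball_vol (real DIM('a))" by (simp add: V_def content_ball)
  have V0: "V > 0" by (simp add: V_def)
  have eV: "emeasure lborel (ball x 1) = ennreal V" by (simp add: VV emeasure_ball)
  define E where "E = 2 * \<kappa> * 1 powr \<alpha> * (\<Sum>b\<in>Basis. N b) / \<alpha> * V"
  have E0: "E \<ge> 0" unfolding E_def using \<kappa>_pos \<alpha>_pos V0 u(3)
    by (intro mult_nonneg_nonneg divide_nonneg_pos sum_nonneg) auto
  define \<omega> :: "'a \<Rightarrow> real" where "\<omega> y = indicator (ball x 1) y" for y
  have \<omega>m: "\<omega> \<in> borel_measurable borel" unfolding \<omega>_def[abs_def] by (intro borel_measurable_indicator) simp
  have avg: "(\<integral>\<^sup>+y. ennreal (norm (u y)) * indicator (ball x 1) y \<partial>lborel) \<le> ennreal (\<kappa> * N0 * V)"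
  proof -
    have "(\<integral>\<^sup>+y. ennreal (\<omega> y * norm (u (0 + 1 *\<^sub>R y))) \<partial>lborel) \<le> ennreal (V powr (1 / p) * N0) * ennreal (1 powr (\<alpha> - 1))"
    proof (rule scaled_pairing_le[OF \<omega>m _ _ _ cu u0])
      have eq: "ennreal (\<omega> y powr p) = indicator (ball x 1) y" for y
        by (cases "y \<in> ball x 1") (simp_all add: \<omega>_def)
      show "(\<integral>\<^sup>+y. ennreal (\<omega> y powr p) \<partial>lborel) \<le> ennreal ((V powr (1 / p)) powr p)"
        unfolding eq using p V0 by (subst nn_integral_indicator) (simp_all add: eV powr_powr)
    qed (auto simp: \<omega>_def)
    moreover have "ennreal (\<omega> y * norm (u (0 + 1 *\<^sub>R y))) = ennreal (norm (u y)) * indicator (ball x 1) y" for y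
      by (cases "y \<in> ball x 1") (simp_all add: \<omega>_def)
    moreover have "V powr (1 / p) = \<kappa> * V"
      using V0 powr_add[of V "1 / p - 1" 1] by (simp add: \<kappa>_def VV)
    ultimately show ?thesis by (simp add: mult.commute mult.left_commute)
  qed
  have fm: "(\<lambda>y. ennreal (norm (u y - u x)) * indicator (ball x 1) y) \<in> borel_measurable lborel"
    "(\<lambda>y. ennreal (norm (u y)) * indicator (ball x 1) y) \<in> borel_measurable lborel"
    using um by (intro borel_measurable_times_ennreal borel_measurable_indicator; simp)+
  have "ennreal (norm (u x) * V) = (\<integral>\<^sup>+y. ennreal (norm (u x)) * indicator (ball x 1) y \<partial>lborel)"
    by (subst nn_integral_cmult_indicator) (simp_all add: eV ennreal_mult V0 less_imp_le)
  also have "\<dots> \<le> (\<integral>\<^sup>+y. ennreal (norm (u y)) * indicator (ball x 1) y + ennreal (norm (u y - u x)) * indicator (ball x 1) y \<partial>lborel)"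
  proof (rule nn_integral_mono)
    fix y
    have "norm (u x) \<le> norm (u y) + norm (u y - u x)"
      using norm_triangle_sub[of "u x" "u y"] by (simp add: norm_minus_commute)
    then have "ennreal (norm (u x)) \<le> ennreal (norm (u y)) + ennreal (norm (u y - u x))"
      by (simp add: ennreal_leI flip: ennreal_plus)
    then show "ennreal (norm (u x)) * indicator (ball x 1) y \<le> ennreal (norm (u y)) * indicator (ball x 1) y + ennreal (norm (u y - u x)) * indicator (ball x 1) y"
      by (cases "y \<in> ball x 1") simp_all
  qed
  also have "\<dots> = (\<integral>\<^sup>+y. ennreal (norm (u y)) * indicator (ball x 1) y \<partial>lborel) + (\<integral>\<^sup>+y. ennreal (norm (u y - u x)) * indicator (ball x 1) y \<partial>lborel)"
    by (rule nn_integral_add[OF fm(2) fm(1)])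
  also have "\<dots> \<le> ennreal (\<kappa> * N0 * V) + ennreal E"
    unfolding E_def V_def using avg[unfolded V_def] by (intro add_mono ball_oscillation_le[OF u]) auto
  also have "\<dots> = ennreal (\<kappa> * N0 * V + E)" using E0 \<kappa>_pos u0(2) V0 by (simp add: ennreal_plus)
  finally have "norm (u x) * V \<le> \<kappa> * N0 * V + E"
    by (subst (asm) ennreal_le_iff) (use E0 \<kappa>_pos u0(2) V0 in auto)
  then have "norm (u x) * V \<le> (\<kappa> * N0 + 2 * \<kappa> / \<alpha> * (\<Sum>b\<in>Basis. N b)) * V" by (simp add: E_def field_simps)
  then show ?thesis using V0 by (rule mult_right_le_imp_le)
qed

end

section \<open>The regularized force\<close>

lemma continuous_bounded_support_bounded:
  fixes g :: "'a::euclidean_space \<Rightarrow> 'b::real_normed_vector"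
  assumes g: "continuous_on UNIV g" and out: "\<And>x. x \<notin> cbox a c \<Longrightarrow> g x = 0"
  shows "\<exists>C\<ge>0. \<forall>x. norm (g x) \<le> C"
proof -
  obtain C where "\<And>x. x \<in> cbox a c \<Longrightarrow> norm (g x) \<le> C"
    using compact_imp_bounded[OF compact_continuous_image[OF continuous_on_subset[OF g] compact_cbox[of a c]]]
    by (auto simp: bounded_iff)
  then have "norm (g x) \<le> max C 0" for x using out[of x] by (cases "x \<in> cbox a c") (auto simp: le_max_iff_disj)
  then show ?thesis by (intro exI[of _ "max C 0"]) auto
qed

text \<open>The data that enter the regularized force. The constant \<open>e\<close> bounds the interpolated force density.\<close>

locale regularization =
  fixes \<Theta> :: "'t::euclidean_space set" and \<delta> :: "'a::euclidean_space \<Rightarrow> real" and Xh Fh :: "'t \<Rightarrow> 'a" and e :: real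
  assumes \<Theta>: "\<Theta> \<in> lmeasurable" and \<delta>: "continuous_on UNIV \<delta>" and \<delta>0: "\<exists>a c. \<forall>y. y \<notin> cbox a c \<longrightarrow> \<delta> y = 0"
    and Xh: "Xh \<in> borel_measurable (lebesgue_on \<Theta>)" and Fh: "Fh \<in> borel_measurable (lebesgue_on \<Theta>)"
    and Fh_le: "\<And>\<theta>. \<theta> \<in> \<Theta> \<Longrightarrow> norm (Fh \<theta>) \<le> e" and e: "e \<ge> 0"
begin

sublocale fin: finite_measure "lebesgue_on \<Theta>"
  by (rule finite_measure_lebesgue_on[OF \<Theta>])

sublocale P: pair_sigma_finite "lborel :: 'a measure" "lebesgue_on \<Theta>"
  ..

lemma \<delta>_measurable[measurable]: "\<delta> \<in> borel_measurable borel"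
  by (rule borel_measurable_continuous_onI[OF \<delta>])

lemma \<delta>_bounded: "\<exists>C\<ge>0. \<forall>y. \<bar>\<delta> y\<bar> \<le> C"
  using continuous_bounded_support_bounded[OF \<delta>] \<delta>0 by force

lemma \<delta>_integrable: "integrable lborel \<delta>"
  using integrable_continuous_bounded_support[OF \<delta>] \<delta>0 by blast

lemma measure_space: "measure (lebesgue_on \<Theta>) (space (lebesgue_on \<Theta>)) = measure lebesgue \<Theta>"
  using \<Theta> by (simp add: measure_restrict_space fmeasurableD)

lemma kernel_measurable: "(\<lambda>(x, \<theta>). \<delta> (x - Xh \<theta>)) \<in> borel_measurable (lborel \<Otimes>\<^sub>M lebesgue_on \<Theta>)"
proof -
  have [measurable]: "Xh \<in> borel_measurable (lebesgue_on \<Theta>)" by (rule Xh)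
  show ?thesis by measurable
qed

lemma kernel_integrable: "integrable (lebesgue_on \<Theta>) (\<lambda>\<theta>. \<delta> (x - Xh \<theta>) *\<^sub>R Fh \<theta>)"
proof -
  obtain C where C: "C \<ge> 0" "\<And>y. \<bar>\<delta> y\<bar> \<le> C" using \<delta>_bounded by blast
  have [measurable]: "Xh \<in> borel_measurable (lebesgue_on \<Theta>)" "Fh \<in> borel_measurable (lebesgue_on \<Theta>)" by (rule Xh Fh)+
  show ?thesis
  proof (rule fin.integrable_const_bound[where B = "C * e"])
    show "AE \<theta> in lebesgue_on \<Theta>. norm (\<delta> (x - Xh \<theta>) *\<^sub>R Fh \<theta>) \<le> C * e"
      using C Fh_le by (intro AE_I2) (auto intro!: mult_mono)
  qed measurable
qed

lemma regularized_force_bounded: "\<exists>C\<ge>0. \<forall>x. norm (regularized_force \<Theta> \<delta> Xh Fh x) \<le> C"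
proof -
  obtain C where C: "C \<ge> 0" "\<And>y. \<bar>\<delta> y\<bar> \<le> C" using \<delta>_bounded by blast
  have "norm (regularized_force \<Theta> \<delta> Xh Fh x) \<le> C * e * measure lebesgue \<Theta>" for x
  proof -
    have "norm (regularized_force \<Theta> \<delta> Xh Fh x) \<le> (\<integral>\<theta>. norm (\<delta> (x - Xh \<theta>) *\<^sub>R Fh \<theta>) \<partial>lebesgue_on \<Theta>)"
      unfolding regularized_force_def by (rule integral_norm_bound)
    also have "\<dots> \<le> (\<integral>\<theta>. C * e \<partial>lebesgue_on \<Theta>)"
    proof (rule integral_mono[OF integrable_norm[OF kernel_integrable]])
      show "norm (\<delta> (x - Xh \<theta>) *\<^sub>R Fh \<theta>) \<le> C * e" if "\<theta> \<in> space (lebesgue_on \<Theta>)" for \<theta>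
        using C Fh_le that by (auto intro!: mult_mono)
    qed simp
    also have "\<dots> = C * e * measure lebesgue \<Theta>"
      using measure_space by simp
    finally show ?thesis .
  qed
  moreover have "C * e * measure lebesgue \<Theta> \<ge> 0" using C e by simp
  ultimately show ?thesis by blast
qed

lemma regularized_force_measurable: "regularized_force \<Theta> \<delta> Xh Fh \<in> borel_measurable borel"
proof -
  have [measurable]: "Fh \<in> borel_measurable (lebesgue_on \<Theta>)" by (rule Fh)
  have [measurable]: "(\<lambda>(x, \<theta>). \<delta> (x - Xh \<theta>)) \<in> borel_measurable (lborel \<Otimes>\<^sub>M lebesgue_on \<Theta>)"
    by (rule kernel_measurable)
  have "(\<lambda>x. \<integral>\<theta>. \<delta> (x - Xh \<theta>) *\<^sub>R Fh \<theta> \<partial>lebesgue_on \<Theta>) \<in> borel_measurable lborel"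
    by measurable
  then show ?thesis by (simp add: regularized_force_def[abs_def])
qed

text \<open>By Fubini, pairing with the regularized force means averaging the test function against the kernel about
  each point of the discretized boundary.\<close>

lemma functional_of_regularized_force:
  assumes \<Omega>: "open \<Omega>" and \<psi>: "\<psi> \<in> test_functions \<Omega>"
  shows "functional_of \<Omega> (regularized_force \<Theta> \<delta> Xh Fh) \<psi>
    = (\<integral>\<theta>. Fh \<theta> \<bullet> (\<integral>y. \<delta> y *\<^sub>R \<psi> (Xh \<theta> + y) \<partial>lborel) \<partial>lebesgue_on \<Theta>)"
proof -
  have c\<psi>: "continuous_on UNIV \<psi>" by (rule test_function_continuous[OF \<psi>])
  have [measurable]: "\<psi> \<in> borel_measurable borel" by (rule borel_measurable_continuous_onI[OF c\<psi>])
  obtain a c where ac: "\<And>x. x \<notin> cbox a c \<Longrightarrow> \<psi> x = 0" using test_function_box[OF \<psi>] by blast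
  have i\<psi>: "integrable lborel \<psi>" by (rule integrable_continuous_bounded_support[OF c\<psi> ac])
  obtain C where C: "C \<ge> 0" "\<And>y. \<bar>\<delta> y\<bar> \<le> C" using \<delta>_bounded by blast
  have [measurable]: "Fh \<in> borel_measurable (lebesgue_on \<Theta>)" by (rule Fh)
  note [measurable] = kernel_measurable
  define g where "g x \<theta> = \<delta> (x - Xh \<theta>) * (Fh \<theta> \<bullet> \<psi> x)" for x :: 'a and \<theta> :: 't
  have gm: "(\<lambda>(x, \<theta>). g x \<theta>) \<in> borel_measurable (lborel \<Otimes>\<^sub>M lebesgue_on \<Theta>)"
  proof -
    have "(\<lambda>z. (case z of (x, \<theta>) \<Rightarrow> \<delta> (x - Xh \<theta>)) * (Fh (snd z) \<bullet> \<psi> (fst z))) \<in> borel_measurable (lborel \<Otimes>\<^sub>M lebesgue_on \<Theta>)"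
      by measurable
    then show ?thesis by (simp add: g_def case_prod_unfold)
  qed
  have gi: "integrable (lborel \<Otimes>\<^sub>M lebesgue_on \<Theta>) (\<lambda>(x, \<theta>). g x \<theta>)"
  proof (rule Bochner_Integration.integrable_bound[OF _ gm])
    show "integrable (lborel \<Otimes>\<^sub>M lebesgue_on \<Theta>) (\<lambda>(x, \<theta>). C * e * norm (\<psi> x))"
    proof (rule P.Fubini_integrable)
      show "(\<lambda>(x, \<theta>). C * e * norm (\<psi> x)) \<in> borel_measurable (lborel \<Otimes>\<^sub>M lebesgue_on \<Theta>)" by measurable
      show "integrable lborel (\<lambda>x. \<integral>\<theta>. norm (case (x, \<theta>) of (x, \<theta>) \<Rightarrow> C * e * norm (\<psi> x)) \<partial>lebesgue_on \<Theta>)"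
        using i\<psi> by simp
    qed simp
    show "AE z in lborel \<Otimes>\<^sub>M lebesgue_on \<Theta>. norm (case z of (x, \<theta>) \<Rightarrow> g x \<theta>) \<le> norm (case z of (x, \<theta>) \<Rightarrow> C * e * norm (\<psi> x))"
    proof (rule AE_I2)
      fix z :: "'a \<times> 't" assume z: "z \<in> space (lborel \<Otimes>\<^sub>M lebesgue_on \<Theta>)"
      obtain x \<theta> where x: "z = (x, \<theta>)" "\<theta> \<in> \<Theta>" using z by (cases z) (auto simp: space_pair_measure)
      have "\<bar>Fh \<theta> \<bullet> \<psi> x\<bar> \<le> e * norm (\<psi> x)"
        using Cauchy_Schwarz_ineq2[of "Fh \<theta>" "\<psi> x"] mult_right_mono[OF Fh_le[OF x(2)], of "norm (\<psi> x)"] by simp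
      then have "\<bar>\<delta> (x - Xh \<theta>)\<bar> * \<bar>Fh \<theta> \<bullet> \<psi> x\<bar> \<le> C * (e * norm (\<psi> x))"
        using C by (intro mult_mono) auto
      then show "norm (case z of (x, \<theta>) \<Rightarrow> g x \<theta>) \<le> norm (case z of (x, \<theta>) \<Rightarrow> C * e * norm (\<psi> x))"
        using C(1) e x by (simp add: g_def abs_mult mult.assoc)
    qed
  qed
  have "functional_of \<Omega> (regularized_force \<Theta> \<delta> Xh Fh) \<psi> = (\<integral>x. regularized_force \<Theta> \<delta> Xh Fh x \<bullet> \<psi> x \<partial>lborel)"
    unfolding functional_of_def
  proof (rule integral_lebesgue_on_eq_lborel[OF open_in_lebesgue[OF \<Omega>]])
    show "regularized_force \<Theta> \<delta> Xh Fh x \<bullet> \<psi> x = 0" if "x \<notin> \<Omega>" for x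
      using test_function_outside(1)[OF \<psi> that] by simp
    show "(\<lambda>x. regularized_force \<Theta> \<delta> Xh Fh x \<bullet> \<psi> x) \<in> borel_measurable borel"
      using regularized_force_measurable by (intro borel_measurable_inner) simp_all
  qed
  also have "\<dots> = (\<integral>x. (\<integral>\<theta>. g x \<theta> \<partial>lebesgue_on \<Theta>) \<partial>lborel)"
  proof (rule Bochner_Integration.integral_cong[OF refl])
    fix x
    have "regularized_force \<Theta> \<delta> Xh Fh x \<bullet> \<psi> x = (\<integral>\<theta>. (\<delta> (x - Xh \<theta>) *\<^sub>R Fh \<theta>) \<bullet> \<psi> x \<partial>lebesgue_on \<Theta>)"
      unfolding regularized_force_def by (rule integral_inner_left[OF kernel_integrable, symmetric])
    then show "regularized_force \<Theta> \<delta> Xh Fh x \<bullet> \<psi> x = (\<integral>\<theta>. g x \<theta> \<partial>lebesgue_on \<Theta>)"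
      by (simp add: g_def)
  qed
  also have "\<dots> = (\<integral>\<theta>. (\<integral>x. g x \<theta> \<partial>lborel) \<partial>lebesgue_on \<Theta>)"
    by (rule P.Fubini_integral[OF gi, symmetric])
  also have "\<dots> = (\<integral>\<theta>. Fh \<theta> \<bullet> (\<integral>y. \<delta> y *\<^sub>R \<psi> (Xh \<theta> + y) \<partial>lborel) \<partial>lebesgue_on \<Theta>)"
  proof (rule Bochner_Integration.integral_cong[OF refl])
    fix \<theta>
    have c: "continuous_on UNIV (\<lambda>x. \<delta> (x - Xh \<theta>) *\<^sub>R \<psi> x)"
      by (intro continuous_intros continuous_on_compose2[OF \<delta>] c\<psi>) auto
    have i: "integrable lborel (\<lambda>x. \<delta> (x - Xh \<theta>) *\<^sub>R \<psi> x)"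
      by (rule integrable_continuous_bounded_support[OF c, of a c]) (simp add: ac)
    have "(\<integral>x. \<delta> (Xh \<theta> + x - Xh \<theta>) *\<^sub>R \<psi> (Xh \<theta> + x) \<partial>lborel) = (\<integral>x. \<delta> (x - Xh \<theta>) *\<^sub>R \<psi> x \<partial>lborel)"
      by (rule integral_lborel_shift[OF borel_measurable_continuous_onI[OF c]])
    then have "Fh \<theta> \<bullet> (\<integral>y. \<delta> y *\<^sub>R \<psi> (Xh \<theta> + y) \<partial>lborel) = Fh \<theta> \<bullet> (\<integral>x. \<delta> (x - Xh \<theta>) *\<^sub>R \<psi> x \<partial>lborel)" by simp
    also have "\<dots> = (\<integral>x. Fh \<theta> \<bullet> (\<delta> (x - Xh \<theta>) *\<^sub>R \<psi> x) \<partial>lborel)"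
      by (rule integral_inner_right[OF i, symmetric])
    finally show "(\<integral>x. g x \<theta> \<partial>lborel) = Fh \<theta> \<bullet> (\<integral>y. \<delta> y *\<^sub>R \<psi> (Xh \<theta> + y) \<partial>lborel)"
      by (simp add: g_def)
  qed
  finally show ?thesis .
qed

end

context conjugate_exponents
begin

text \<open>Dominates the constants of \<open>Morrey_sup\<close>, \<open>Morrey_Hoelder\<close> and \<open>weighted_increment_le\<close>.\<close>

definition embed_const :: real where
  "embed_const = \<kappa> + 4 * \<kappa> / \<alpha> + 1 / \<alpha>"

lemma embed_const_pos: "embed_const > 0"
  unfolding embed_const_def using \<kappa>_pos \<alpha>_pos by (intro add_pos_pos) auto

text \<open>The four summands on the right correspond, in this order, to the four terms into which the integrand is split
  in the proof.\<close>

lemma test_function_estimate: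
  fixes \<Theta> :: "'t::euclidean_space set" and F X Fh Xh :: "'t \<Rightarrow> 'a" and \<psi> :: "'a \<Rightarrow> 'a"
  assumes R: "regularization \<Theta> \<delta> Xh Fh e"
    and \<Omega>: "open \<Omega>" and \<psi>: "\<psi> \<in> test_functions \<Omega>"
    and meas: "X \<in> borel_measurable (lebesgue_on \<Theta>)" "F \<in> borel_measurable (lebesgue_on \<Theta>)"
    and F_le: "\<And>\<theta>. \<theta> \<in> \<Theta> \<Longrightarrow> norm (F \<theta>) \<le> e"
    and diff: "AE \<theta> in lebesgue_on \<Theta>. norm (F \<theta> - Fh \<theta>) \<le> a" "AE \<theta> in lebesgue_on \<Theta>. norm (X \<theta> - Xh \<theta>) \<le> b" "b \<ge> 0"
    and N: "Lp_bound t \<psi> N0" "N0 \<ge> 0" "\<And>b. b \<in> Basis \<Longrightarrow> Lp_bound t (dir_deriv b \<psi>) (N b)" "\<And>b. b \<in> Basis \<Longrightarrow> N b \<ge> 0"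
  shows "\<bar>force_on_tests \<Theta> X F \<psi> - functional_of \<Omega> (regularized_force \<Theta> \<delta> Xh Fh) \<psi>\<bar>
    \<le> measure lebesgue \<Theta> * (embed_const * (N0 + (\<Sum>b\<in>Basis. N b)) *
        (a + e * b powr \<alpha> + e * \<bar>1 - (\<integral>y. \<delta> y \<partial>lborel)\<bar> + e * Lp_norm (ennreal p) UNIV (\<lambda>y. \<delta> y *\<^sub>R y)))"
proof -
  interpret regularization \<Theta> \<delta> Xh Fh e by (rule R)
  define D where "D = Lp_norm (ennreal p) UNIV (\<lambda>y. \<delta> y *\<^sub>R y)"
  define I where "I = (\<integral>y. \<delta> y \<partial>lborel)"
  define n where "n = embed_const * (N0 + (\<Sum>b\<in>Basis. N b))"
  define S where "S = (\<Sum>b\<in>Basis. N b)"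
  have S0: "S \<ge> 0" unfolding S_def by (rule sum_nonneg) (rule N)
  have n0: "n \<ge> 0" unfolding n_def S_def[symmetric] using embed_const_pos S0 N(2) by simp
  have D0: "D \<ge> 0" by (simp add: D_def Lp_norm_nonneg)
  have u: "Ck_on 1 UNIV \<psi>" by (rule test_function_Ck[OF \<psi>])
  have c\<psi>: "continuous_on UNIV \<psi>" by (rule test_function_continuous[OF \<psi>])
  have [measurable]: "\<psi> \<in> borel_measurable borel" by (rule borel_measurable_continuous_onI[OF c\<psi>])
  obtain a0 c0 where ac: "\<And>x. x \<notin> cbox a0 c0 \<Longrightarrow> \<psi> x = 0" using test_function_box[OF \<psi>] by blast
  have pe: "enn2real (ennreal p) = p" "ennreal p \<noteq> \<infinity>" "1 \<le> ennreal p"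
    using p ennreal_leI[OF p] by auto
  have const: "\<kappa> * N0 + 2 * \<kappa> / \<alpha> * S \<le> n" "4 * \<kappa> / \<alpha> * S \<le> n" "S / \<alpha> \<le> n"
  proof -
    define x1 x2 x3 x4 x5 x6
      where x: "x1 = \<kappa> * N0" "x2 = \<kappa> * S" "x3 = \<kappa> / \<alpha> * N0" "x4 = \<kappa> / \<alpha> * S" "x5 = 1 / \<alpha> * N0" "x6 = 1 / \<alpha> * S"
    have nonneg: "0 \<le> x1" "0 \<le> x2" "0 \<le> x3" "0 \<le> x4" "0 \<le> x5" "0 \<le> x6"
      unfolding x using \<kappa>_pos \<alpha>_pos S0 N(2) by simp_all
    have neq: "n = x1 + x2 + 4 * x3 + 4 * x4 + x5 + x6"
      unfolding n_def embed_const_def S_def[symmetric] x by (simp add: algebra_simps add_divide_distrib)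
    have "\<kappa> * N0 + 2 * \<kappa> / \<alpha> * S = x1 + 2 * x4" by (simp add: x)
    then show "\<kappa> * N0 + 2 * \<kappa> / \<alpha> * S \<le> n" unfolding neq using nonneg by linarith
    have "4 * \<kappa> / \<alpha> * S = 4 * x4" by (simp add: x)
    then show "4 * \<kappa> / \<alpha> * S \<le> n" unfolding neq using nonneg by linarith
    have "S / \<alpha> = x6" by (simp add: x)
    then show "S / \<alpha> \<le> n" unfolding neq using nonneg by linarith
  qed
  have sup: "norm (\<psi> x) \<le> n" for x
    using Morrey_sup[OF u N(3,4) N(1,2), of x] const(1) unfolding S_def by linarith
  have hold: "norm (\<psi> x - \<psi> z) \<le> n * b powr \<alpha>" if "norm (x - z) \<le> b" for x z
  proof -
    have "norm (\<psi> x - \<psi> z) \<le> 4 * \<kappa> / \<alpha> * S * norm (x - z) powr \<alpha>"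
      unfolding S_def by (rule Morrey_Hoelder[OF u N(3,4)])
    also have "\<dots> \<le> n * b powr \<alpha>"
      using that \<alpha>_pos n0 const(2) by (intro mult_mono powr_mono2) auto
    finally show ?thesis .
  qed
  have sm: "(\<lambda>y. \<delta> y *\<^sub>R y) \<in> borel_measurable borel" by measurable
  have D_nn: "(\<integral>\<^sup>+y. ennreal ((\<bar>\<delta> y\<bar> * norm y) powr p) \<partial>lborel) \<le> ennreal (D powr p)"
  proof -
    obtain a1 c1 where ac1: "\<And>y. y \<notin> cbox a1 c1 \<Longrightarrow> \<delta> y = 0" using \<delta>0 by blast
    have "(\<lambda>y. \<delta> y *\<^sub>R y) \<in> Lp_space (ennreal p) UNIV"
      by (rule continuous_Lp_space[OF pe(3) _ _, of _ _ a1 c1]) (auto intro!: continuous_intros \<delta> simp: ac1)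
    from Lp_bound_of_Lp_norm[OF pe(3) _ this, of "\<lambda>y. \<delta> y *\<^sub>R y"]
    have "Lp_bound (ennreal p) (\<lambda>y. \<delta> y *\<^sub>R y) D" by (simp add: D_def)
    then show ?thesis unfolding Lp_bound_def using pe by simp
  qed
  define J where "J z = (\<integral>y. \<delta> y *\<^sub>R \<psi> (z + y) \<partial>lborel)" for z
  have Jint: "integrable lborel (\<lambda>y. \<delta> y *\<^sub>R \<psi> (z + y))" for z
  proof -
    obtain a1 c1 where ac1: "\<And>y. y \<notin> cbox a1 c1 \<Longrightarrow> \<delta> y = 0" using \<delta>0 by blast
    have "continuous_on UNIV (\<lambda>y. \<delta> y *\<^sub>R \<psi> (z + y))"
      by (intro continuous_intros continuous_on_compose2[OF c\<psi>] \<delta>) auto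
    then show ?thesis by (rule integrable_continuous_bounded_support[of _ a1 c1]) (simp add: ac1)
  qed
  have J_near: "norm (I *\<^sub>R \<psi> z - J z) \<le> n * D" for z
  proof -
    have iz: "integrable lborel (\<lambda>y. \<delta> y *\<^sub>R \<psi> z)" using \<delta>_integrable by simp
    have "I *\<^sub>R \<psi> z - J z = (\<integral>y. \<delta> y *\<^sub>R \<psi> z \<partial>lborel) - J z" by (simp add: I_def \<delta>_integrable)
    also have "\<dots> = (\<integral>y. \<delta> y *\<^sub>R (\<psi> z - \<psi> (z + y)) \<partial>lborel)"
      unfolding J_def scaleR_diff_right by (rule Bochner_Integration.integral_diff[OF iz Jint, symmetric])
    finally have eq: "I *\<^sub>R \<psi> z - J z = (\<integral>y. \<delta> y *\<^sub>R (\<psi> z - \<psi> (z + y)) \<partial>lborel)" .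
    have "integrable lborel (\<lambda>y. \<delta> y *\<^sub>R (\<psi> z - \<psi> (z + y)))"
      unfolding scaleR_diff_right by (rule Bochner_Integration.integrable_diff[OF iz Jint])
    from integral_norm_bound_ennreal[OF this]
    have "ennreal (norm (I *\<^sub>R \<psi> z - J z)) \<le> (\<integral>\<^sup>+y. ennreal (\<bar>\<delta> y\<bar> * norm (\<psi> (z + y) - \<psi> z)) \<partial>lborel)"
      unfolding eq by (simp add: norm_minus_commute)
    also have "\<dots> \<le> ennreal (D * (\<Sum>b\<in>Basis. N b) / \<alpha>)"
      by (rule weighted_increment_le[OF \<delta>_measurable D_nn D0 u N(3,4)])
    finally have "norm (I *\<^sub>R \<psi> z - J z) \<le> D * S / \<alpha>"
      using D0 S0 \<alpha>_pos by (simp add: S_def ennreal_le_iff)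
    also have "\<dots> = S / \<alpha> * D" by simp
    also have "\<dots> \<le> n * D" using const(3) D0 by (rule mult_right_mono)
    finally show ?thesis .
  qed
  define E where "E = n * (a + e * b powr \<alpha> + e * \<bar>1 - I\<bar> + e * D)"
  have pt: "AE \<theta> in lebesgue_on \<Theta>. norm (F \<theta> \<bullet> \<psi> (X \<theta>) - Fh \<theta> \<bullet> J (Xh \<theta>)) \<le> E"
    using diff(1,2) AE_space
  proof eventually_elim
    case (elim \<theta>)
    then have \<theta>: "\<theta> \<in> \<Theta>" by simp
    have "F \<theta> \<bullet> \<psi> (X \<theta>) - Fh \<theta> \<bullet> J (Xh \<theta>) = (F \<theta> - Fh \<theta>) \<bullet> \<psi> (X \<theta>) + Fh \<theta> \<bullet> (\<psi> (X \<theta>) - \<psi> (Xh \<theta>))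
        + Fh \<theta> \<bullet> ((1 - I) *\<^sub>R \<psi> (Xh \<theta>)) + Fh \<theta> \<bullet> (I *\<^sub>R \<psi> (Xh \<theta>) - J (Xh \<theta>))"
      by (simp add: inner_diff_left inner_diff_right scaleR_diff_left)
    also have "norm \<dots> \<le> norm (F \<theta> - Fh \<theta>) * norm (\<psi> (X \<theta>)) + norm (Fh \<theta>) * norm (\<psi> (X \<theta>) - \<psi> (Xh \<theta>))
        + norm (Fh \<theta>) * norm ((1 - I) *\<^sub>R \<psi> (Xh \<theta>)) + norm (Fh \<theta>) * norm (I *\<^sub>R \<psi> (Xh \<theta>) - J (Xh \<theta>))"
      unfolding real_norm_def
      by (intro order_trans[OF abs_triangle_ineq] add_mono Cauchy_Schwarz_ineq2)
    also have "\<dots> \<le> a * n + e * (n * b powr \<alpha>) + e * (\<bar>1 - I\<bar> * n) + e * (n * D)"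
    proof -
      have "0 \<le> a" using elim(1) norm_ge_zero order_trans by blast
      moreover have "norm ((1 - I) *\<^sub>R \<psi> (Xh \<theta>)) \<le> \<bar>1 - I\<bar> * n"
        unfolding norm_scaleR by (intro mult_left_mono sup) simp
      ultimately show ?thesis
        using elim(1,2) e by (intro add_mono mult_mono Fh_le[OF \<theta>] sup hold J_near) auto
    qed
    also have "\<dots> = E" by (simp add: E_def algebra_simps)
    finally show ?case .
  qed
  have [measurable]: "X \<in> borel_measurable (lebesgue_on \<Theta>)" "F \<in> borel_measurable (lebesgue_on \<Theta>)"
    "Xh \<in> borel_measurable (lebesgue_on \<Theta>)" "Fh \<in> borel_measurable (lebesgue_on \<Theta>)" by (rule meas Xh Fh)+
  have Jm[measurable]: "J \<in> borel_measurable borel"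
  proof -
    have "(\<lambda>z. \<integral>y. \<delta> y *\<^sub>R \<psi> (z + y) \<partial>lborel) \<in> borel_measurable lborel" by measurable
    then show ?thesis by (simp add: J_def[abs_def])
  qed
  have i1: "integrable (lebesgue_on \<Theta>) (\<lambda>\<theta>. F \<theta> \<bullet> \<psi> (X \<theta>))"
  proof (rule fin.integrable_const_bound[where B = "e * n"])
    show "AE \<theta> in lebesgue_on \<Theta>. norm (F \<theta> \<bullet> \<psi> (X \<theta>)) \<le> e * n"
    proof (rule AE_I2)
      fix \<theta> assume "\<theta> \<in> space (lebesgue_on \<Theta>)"
      then have "norm (F \<theta>) * norm (\<psi> (X \<theta>)) \<le> e * n" using e by (intro mult_mono F_le sup) auto
      then show "norm (F \<theta> \<bullet> \<psi> (X \<theta>)) \<le> e * n" using Cauchy_Schwarz_ineq2[of "F \<theta>" "\<psi> (X \<theta>)"] by simp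
    qed
  qed measurable
  have i2: "integrable (lebesgue_on \<Theta>) (\<lambda>\<theta>. Fh \<theta> \<bullet> J (Xh \<theta>))"
  proof (rule fin.integrable_const_bound[where B = "e * n + E"])
    show "AE \<theta> in lebesgue_on \<Theta>. norm (Fh \<theta> \<bullet> J (Xh \<theta>)) \<le> e * n + E"
      using pt AE_space
    proof eventually_elim
      case (elim \<theta>)
      then have "norm (F \<theta>) * norm (\<psi> (X \<theta>)) \<le> e * n" using e by (intro mult_mono F_le sup) auto
      then have "\<bar>F \<theta> \<bullet> \<psi> (X \<theta>)\<bar> \<le> e * n" using Cauchy_Schwarz_ineq2[of "F \<theta>" "\<psi> (X \<theta>)"] by simp
      then show ?case using elim(1) by simp
    qed
  qed measurable
  have "\<bar>force_on_tests \<Theta> X F \<psi> - functional_of \<Omega> (regularized_force \<Theta> \<delta> Xh Fh) \<psi>\<bar>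
    = norm (\<integral>\<theta>. F \<theta> \<bullet> \<psi> (X \<theta>) - Fh \<theta> \<bullet> J (Xh \<theta>) \<partial>lebesgue_on \<Theta>)"
    unfolding functional_of_regularized_force[OF \<Omega> \<psi>] force_on_tests_def J_def[symmetric] using i1 i2 by simp
  also have "\<dots> \<le> (\<integral>\<theta>. norm (F \<theta> \<bullet> \<psi> (X \<theta>) - Fh \<theta> \<bullet> J (Xh \<theta>)) \<partial>lebesgue_on \<Theta>)"
    by (rule integral_norm_bound)
  also have "\<dots> \<le> (\<integral>\<theta>. E \<partial>lebesgue_on \<Theta>)"
    using i1 i2 pt by (intro integral_mono_AE) auto
  also have "\<dots> = measure lebesgue \<Theta> * E" using measure_space by simp
  finally show ?thesis by (simp add: E_def n_def I_def D_def)
qed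

text \<open>Apply \<open>test_function_estimate\<close> to the approximations of \<open>\<phi>\<close>, whose norms are at most 7, and let them
  converge. The regularized force is bounded, so uniform convergence suffices on its side.\<close>

lemma dual_norm_estimate:
  fixes \<Theta> :: "'t::euclidean_space set" and F X Fh Xh :: "'t \<Rightarrow> 'a" and \<Omega> :: "'a set"
  assumes R: "regularization \<Theta> \<delta> Xh Fh e"
    and \<Omega>: "open \<Omega>" "bounded \<Omega>"
    and meas: "X \<in> borel_measurable (lebesgue_on \<Theta>)" "F \<in> borel_measurable (lebesgue_on \<Theta>)"
    and F_le: "\<And>\<theta>. \<theta> \<in> \<Theta> \<Longrightarrow> norm (F \<theta>) \<le> e"
    and diff: "AE \<theta> in lebesgue_on \<Theta>. norm (F \<theta> - Fh \<theta>) \<le> a" "AE \<theta> in lebesgue_on \<Theta>. norm (X \<theta> - Xh \<theta>) \<le> b" "b \<ge> 0" "a \<ge> 0"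
    and f: "extends_by_continuity t \<Omega> (force_on_tests \<Theta> X F) f"
  shows "W1_dual_norm t \<Omega> (\<lambda>\<phi>. f \<phi> - functional_of \<Omega> (regularized_force \<Theta> \<delta> Xh Fh) \<phi>)
    \<le> ereal (measure lebesgue \<Theta> * (7 * embed_const *
        (a + e * b powr \<alpha> + e * \<bar>1 - (\<integral>y. \<delta> y \<partial>lborel)\<bar> + e * Lp_norm (ennreal p) UNIV (\<lambda>y. \<delta> y *\<^sub>R y))))"
    (is "_ \<le> ereal (_ * (_ * ?B))")
  unfolding W1_dual_norm_def
proof (rule SUP_least)
  fix \<phi> :: "'a \<Rightarrow> 'a" assume "\<phi> \<in> {\<phi> \<in> W1_0 t \<Omega>. W1_norm t \<Omega> \<phi> \<le> 1}"
  then have \<phi>: "\<phi> \<in> W1_0 t \<Omega>" "W1_norm t \<Omega> \<phi> \<le> 1" by auto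
  interpret regularization \<Theta> \<delta> Xh Fh e by (rule R)
  interpret W: W1_0_function t \<Omega> \<phi> by unfold_locales (rule t_ge_1 \<Omega> \<phi>)+
  define G where "G = regularized_force \<Theta> \<delta> Xh Fh"
  have B0: "?B \<ge> 0" using diff e Lp_norm_nonneg by (intro add_nonneg_nonneg mult_nonneg_nonneg) auto
  have le: "\<bar>force_on_tests \<Theta> X F (W.approx k) - functional_of \<Omega> G (W.approx k)\<bar> \<le> measure lebesgue \<Theta> * (7 * embed_const * ?B)" for k
  proof -
    define N0 where "N0 = Lp_norm t \<Omega> \<phi>"
    define N where "N b = 7 * Lp_norm t \<Omega> (weak_deriv \<Omega> b \<phi>)" for b
    have N0: "N0 \<ge> 0" by (simp add: N0_def Lp_norm_nonneg)
    have "N0 + (\<Sum>b\<in>Basis. N b) \<le> 7 * W1_norm t \<Omega> \<phi>"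
      using N0 by (simp add: N0_def N_def W1_norm_def W1_seminorm_def sum_distrib_left)
    then have "N0 + (\<Sum>b\<in>Basis. N b) \<le> 7" using \<phi>(2) by linarith
    then have "embed_const * (N0 + (\<Sum>b\<in>Basis. N b)) * ?B \<le> embed_const * 7 * ?B"
      using embed_const_pos B0 by (intro mult_right_mono mult_left_mono) auto
    then have "measure lebesgue \<Theta> * (embed_const * (N0 + (\<Sum>b\<in>Basis. N b)) * ?B) \<le> measure lebesgue \<Theta> * (embed_const * 7 * ?B)"
      by (rule mult_left_mono) simp
    moreover have "\<bar>force_on_tests \<Theta> X F (W.approx k) - functional_of \<Omega> G (W.approx k)\<bar> \<le> measure lebesgue \<Theta> * (embed_const * (N0 + (\<Sum>b\<in>Basis. N b)) * ?B)"
      unfolding G_def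
      by (rule test_function_estimate[OF R \<Omega>(1) W.approx_test meas F_le diff(1-3) _ N0])
        (auto simp: N0_def N_def Lp_norm_nonneg W.approx_Lp_bound W.dir_deriv_approx_Lp_bound)
    ultimately show ?thesis by (simp add: mult.commute mult.left_commute)
  qed
  have L1: "(\<lambda>k. force_on_tests \<Theta> X F (W.approx k)) \<longlonglongrightarrow> f \<phi>"
    by (rule W.W1_dual_approx_tendsto[OF f])
  obtain C where C: "C \<ge> 0" "\<And>x. norm (G x) \<le> C" using regularized_force_bounded unfolding G_def by blast
  obtain a0 c0 where ac: "\<And>x. x \<notin> cbox a0 c0 \<Longrightarrow> W.rep x = 0" using W.box by blast
  obtain C' where C': "C' \<ge> 0" "\<And>x. norm (W.rep x) \<le> C'"
    using continuous_bounded_support_bounded[OF W.rep(1) ac] by blast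
  have \<Omega>m: "\<Omega> \<in> lmeasurable" using bounded_set_imp_lmeasurable[OF \<Omega>(2) W.\<Omega>_sets(1)] .
  have Gm: "G \<in> borel_measurable (lebesgue_on \<Omega>)"
    using regularized_force_measurable by (simp add: G_def measurable_completion measurable_restrict_space1)
  have near: "norm (W.approx k x - W.rep x) \<le> 3 * W.\<eta> k" for k x by (rule W.approx_near)
  have L2: "(\<lambda>k. functional_of \<Omega> G (W.approx k)) \<longlonglongrightarrow> functional_of \<Omega> G \<phi>"
    unfolding functional_of_def
  proof (rule integral_dominated_convergence[where w = "\<lambda>x. C * (C' + 3)"])
    show "(\<lambda>x. G x \<bullet> \<phi> x) \<in> borel_measurable (lebesgue_on \<Omega>)"
      using W.\<phi>_Lp Gm by (intro borel_measurable_inner) (simp_all add: Lp_space_def)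
    show "(\<lambda>x. G x \<bullet> W.approx k x) \<in> borel_measurable (lebesgue_on \<Omega>)" for k
      using borel_measurable_continuous_onI[OF test_function_continuous[OF W.approx_test]] Gm
      by (intro borel_measurable_inner) (simp_all add: measurable_completion measurable_restrict_space1)
    show "integrable (lebesgue_on \<Omega>) (\<lambda>x. C * (C' + 3))"
      using finite_measure.integrable_const[OF finite_measure_lebesgue_on[OF \<Omega>m]] by blast
    show "AE x in lebesgue_on \<Omega>. (\<lambda>k. G x \<bullet> W.approx k x) \<longlonglongrightarrow> G x \<bullet> \<phi> x"
      using W.rep(3)
    proof eventually_elim
      case (elim x)
      have "(\<lambda>k. W.approx k x - W.rep x) \<longlonglongrightarrow> 0"
      proof (rule Lim_null_comparison)
        show "\<forall>\<^sub>F k in sequentially. norm (W.approx k x - W.rep x) \<le> 3 * W.\<eta> k" using near by simp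
        show "(\<lambda>k. 3 * W.\<eta> k) \<longlonglongrightarrow> 0" using tendsto_mult_left[OF W.\<eta>(2), of 3] by simp
      qed
      then have "(\<lambda>k. W.approx k x) \<longlonglongrightarrow> \<phi> x" unfolding elim by (simp add: LIM_zero_iff)
      then show ?case by (intro tendsto_inner tendsto_const)
    qed
    show "AE x in lebesgue_on \<Omega>. norm (G x \<bullet> W.approx k x) \<le> C * (C' + 3)" for k
    proof (rule AE_I2)
      fix x
      have "W.\<eta> k \<le> 1" by (simp add: W.\<eta>_def inverse_le_1_iff)
      then have "norm (W.approx k x) \<le> C' + 3"
        using near[of k x] norm_triangle_sub[of "W.approx k x" "W.rep x"] C'(2)[of x] by linarith
      then have "norm (G x) * norm (W.approx k x) \<le> C * (C' + 3)" using C by (intro mult_mono) auto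
      then show "norm (G x \<bullet> W.approx k x) \<le> C * (C' + 3)" using Cauchy_Schwarz_ineq2[of "G x" "W.approx k x"] by simp
    qed
  qed
  have "\<bar>f \<phi> - functional_of \<Omega> G \<phi>\<bar> \<le> measure lebesgue \<Theta> * (7 * embed_const * ?B)"
    by (rule LIMSEQ_le_const2[OF tendsto_rabs[OF tendsto_diff[OF L1 L2]]]) (use le in blast)
  then show "ereal \<bar>f \<phi> - functional_of \<Omega> (regularized_force \<Theta> \<delta> Xh Fh) \<phi>\<bar> \<le> ereal (measure lebesgue \<Theta> * (7 * embed_const * ?B))"
    by (simp add: G_def)
qed

end

section \<open>Interpolation of the data\<close>

text \<open>The classical derivative is also the weak one, and essential bounds of continuous functions hold
  everywhere.\<close>

lemma W1_infinity_bounds: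
  fixes g :: "'t::euclidean_space \<Rightarrow> 'b::euclidean_space"
  assumes S: "open S" and g: "Ck_on 1 S g" "g \<in> W1 \<infinity> S" and x: "x \<in> S"
  shows "norm (g x) \<le> Lp_norm \<infinity> S g"
    and "b \<in> Basis \<Longrightarrow> norm (dir_deriv b g x) \<le> Lp_norm \<infinity> S (weak_deriv S b g)"
proof -
  note S' = open_in_lebesgue[OF S]
  have "AE x in lebesgue_on S. norm (g x) \<le> Lp_norm \<infinity> S g"
    using g(2) by (intro Lp_norm_infinity_AE) (simp add: W1_def)
  then have "AE x in lborel. x \<in> S \<longrightarrow> norm (g x) \<le> Lp_norm \<infinity> S g" by (simp add: AE_lebesgue_on_iff[OF S'])
  then show "norm (g x) \<le> Lp_norm \<infinity> S g"
    by (rule AE_le_imp_le_continuous[OF S continuous_on_norm[OF Ck_on_continuous[OF g(1)]] _ x])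
  assume b: "b \<in> Basis"
  obtain v where v: "v \<in> Lp_space \<infinity> S" "has_weak_deriv S b g v" using g(2) b unfolding W1_def by blast
  have "AE x in lebesgue_on S. v x = weak_deriv S b g x"
    using weak_deriv_AE(1)[OF S v(2)] by eventually_elim simp
  then have "weak_deriv S b g \<in> Lp_space \<infinity> S" by (rule Lp_space_AE[OF S' v(1)])
  from Lp_norm_infinity_AE[OF this] weak_deriv_AE(1)[OF S has_weak_deriv_classical[OF S g(1) b]]
  have "AE x in lebesgue_on S. norm (dir_deriv b g x) \<le> Lp_norm \<infinity> S (weak_deriv S b g)"
    by eventually_elim simp
  then have ae: "AE x in lborel. x \<in> S \<longrightarrow> norm (dir_deriv b g x) \<le> Lp_norm \<infinity> S (weak_deriv S b g)"
    by (simp add: AE_lebesgue_on_iff[OF S'])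
  have cont: "continuous_on S (\<lambda>x. norm (dir_deriv b g x))"
    using g(1) b by (intro continuous_on_norm) simp
  show "norm (dir_deriv b g x) \<le> Lp_norm \<infinity> S (weak_deriv S b g)"
    by (rule AE_le_imp_le_continuous[OF S cont ae x])
qed

lemma W1_infinity_Lipschitz:
  fixes g :: "'t::euclidean_space \<Rightarrow> 'b::euclidean_space"
  assumes S: "open S" "convex S" and g: "Ck_on 1 S g" "g \<in> W1 \<infinity> S" and x: "x \<in> S" "y \<in> S"
  shows "norm (g x - g y) \<le> W1_seminorm \<infinity> S g * norm (x - y)"
proof (rule differentiable_bound[OF S(2)])
  fix z assume z: "z \<in> S"
  show "(g has_derivative (\<lambda>h. \<Sum>b\<in>Basis. (h \<bullet> b) *\<^sub>R dir_deriv b g z)) (at z within S)"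
    by (rule has_derivative_at_withinI[OF has_derivative_dir_deriv]) (use g(1) z in simp)
  show "onorm (\<lambda>h. \<Sum>b\<in>Basis. (h \<bullet> b) *\<^sub>R dir_deriv b g z) \<le> W1_seminorm \<infinity> S g"
  proof (rule onorm_le)
    fix h :: 't
    have "norm (\<Sum>b\<in>Basis. (h \<bullet> b) *\<^sub>R dir_deriv b g z) \<le> (\<Sum>b\<in>Basis. norm h * Lp_norm \<infinity> S (weak_deriv S b g))"
    proof (rule sum_norm_le)
      fix b :: 't assume b: "b \<in> Basis"
      show "norm ((h \<bullet> b) *\<^sub>R dir_deriv b g z) \<le> norm h * Lp_norm \<infinity> S (weak_deriv S b g)"
        unfolding norm_scaleR
        by (intro mult_mono Basis_le_norm b W1_infinity_bounds(2)[OF S(1) g z b]) auto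
    qed
    then show "norm (\<Sum>b\<in>Basis. (h \<bullet> b) *\<^sub>R dir_deriv b g z) \<le> W1_seminorm \<infinity> S g * norm h"
      by (simp add: W1_seminorm_def sum_distrib_left mult.commute)
  qed
qed (use x in auto)

text \<open>By Lipschitz continuity \<open>g\<close> extends to the closure, so the limit defining \<open>cont_ext\<close> exists and inherits
  the bounds.\<close>

lemma cont_ext_bounds:
  fixes g :: "'t::euclidean_space \<Rightarrow> 'b::euclidean_space"
  assumes S: "open S" "convex S" and g: "Ck_on 1 S g" "g \<in> W1 \<infinity> S" and \<xi>: "\<xi> \<in> closure S"
  shows "norm (cont_ext S g \<xi>) \<le> Lp_norm \<infinity> S g"
    and "x \<in> S \<Longrightarrow> norm (g x - cont_ext S g \<xi>) \<le> W1_seminorm \<infinity> S g * norm (x - \<xi>)"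
proof -
  have L0: "W1_seminorm \<infinity> S g \<ge> 0" by (simp add: W1_seminorm_def sum_nonneg Lp_norm_nonneg)
  have uc: "uniformly_continuous_on S g"
    unfolding uniformly_continuous_on_def
  proof (intro allI impI)
    fix e :: real assume e: "e > 0"
    define d where "d = e / (W1_seminorm \<infinity> S g + 1)"
    have d: "d > 0" using e L0 by (simp add: d_def)
    have "dist (g y) (g x) < e" if xy: "x \<in> S" "y \<in> S" "dist y x < d" for x y
    proof -
      have "norm (g y - g x) \<le> W1_seminorm \<infinity> S g * norm (y - x)" by (rule W1_infinity_Lipschitz[OF S g xy(2,1)])
      also have "\<dots> \<le> (W1_seminorm \<infinity> S g + 1) * norm (y - x)" by (intro mult_right_mono) auto
      also have "\<dots> < (W1_seminorm \<infinity> S g + 1) * d" using xy(3) L0 by (intro mult_strict_left_mono) (auto simp: dist_norm)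
      also have "\<dots> = e" using L0 by (simp add: d_def)
      finally show ?thesis by (simp add: dist_norm)
    qed
    then show "\<exists>d>0. \<forall>x\<in>S. \<forall>x'\<in>S. dist x' x < d \<longrightarrow> dist (g x') (g x) < e" using d by blast
  qed
  obtain h where h: "uniformly_continuous_on (closure S) h" "\<And>x. x \<in> S \<Longrightarrow> g x = h x"
    by (rule uniformly_continuous_on_extension_on_closure[OF uc]) (rule that)
  have "continuous_on (closure S) h" using h(1) by (rule uniformly_continuous_imp_continuous)
  then have "(h \<longlongrightarrow> h \<xi>) (at \<xi> within closure S)" using \<xi> by (simp add: continuous_on_def)
  then have "(h \<longlongrightarrow> h \<xi>) (at \<xi> within S)" by (rule tendsto_within_subset) (rule closure_subset)
  then have lim: "(g \<longlongrightarrow> h \<xi>) (at \<xi> within S)"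
    by (rule Lim_transform_eventually) (auto simp: eventually_at_filter h(2))
  have nt: "at \<xi> within S \<noteq> bot"
  proof -
    have "\<xi> islimpt S"
    proof (cases "\<xi> \<in> S")
      case True then show ?thesis using S(1) interior_limit_point[of \<xi> S] by (simp add: interior_open)
    next
      case False then show ?thesis using \<xi> by (simp add: closure_def)
    qed
    then show ?thesis by (simp add: trivial_limit_within)
  qed
  have ext: "cont_ext S g \<xi> = h \<xi>" unfolding cont_ext_def by (rule tendsto_Lim[OF nt lim])
  show "norm (cont_ext S g \<xi>) \<le> Lp_norm \<infinity> S g"
  proof -
    have "\<forall>\<^sub>F y in at \<xi> within S. norm (g y) \<le> Lp_norm \<infinity> S g"
      unfolding eventually_at_filter by (rule always_eventually) (blast intro: W1_infinity_bounds(1)[OF S(1) g])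
    then show ?thesis unfolding ext by (rule Lim_norm_ubound[OF nt lim])
  qed
  assume x: "x \<in> S"
  have A: "((\<lambda>y. norm (g x - g y)) \<longlongrightarrow> norm (g x - h \<xi>)) (at \<xi> within S)"
    by (intro tendsto_norm tendsto_diff tendsto_const lim)
  have B: "((\<lambda>y. W1_seminorm \<infinity> S g * norm (x - y)) \<longlongrightarrow> W1_seminorm \<infinity> S g * norm (x - \<xi>)) (at \<xi> within S)"
    by (intro tendsto_mult tendsto_norm tendsto_diff tendsto_const tendsto_ident_at)
  have C: "\<forall>\<^sub>F y in at \<xi> within S. norm (g x - g y) \<le> W1_seminorm \<infinity> S g * norm (x - y)"
    unfolding eventually_at_filter by (rule always_eventually) (blast intro: W1_infinity_Lipschitz[OF S g x])
  show "norm (g x - cont_ext S g \<xi>) \<le> W1_seminorm \<infinity> S g * norm (x - \<xi>)"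
    unfolding ext by (rule tendsto_le[OF nt B A C])
qed

lemma grid_mono:
  assumes "grid c d M \<tau>" "i \<le> j" "j \<le> M"
  shows "\<tau> i \<le> \<tau> j"
  using assms(2,3)
proof (induction j rule: dec_induct)
  case (step n)
  then have "\<tau> i \<le> \<tau> n" by simp
  also have "\<tau> n \<le> \<tau> (Suc n)" using assms(1) step by (simp add: grid_def less_imp_le)
  finally show ?case .
qed simp

lemma half_node_le:
  assumes g: "grid c d M \<tau>" "c < d" and i: "i \<le> M"
  shows "half_node M \<tau> i \<le> \<tau> i" "\<tau> i \<le> half_node M \<tau> (Suc i)"
proof -
  have M: "M \<noteq> 0"
  proof
    assume "M = 0"
    then have "c = d" using g(1) unfolding grid_def by blast
    then show False using g(2) by simp
  qed
  show "half_node M \<tau> i \<le> \<tau> i"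
    using i grid_mono[OF g(1), of "i - 1" i] by (auto simp: half_node_def)
  show "\<tau> i \<le> half_node M \<tau> (Suc i)"
    using i grid_mono[OF g(1), of i "Suc i"] by (auto simp: half_node_def)
qed

lemma half_node_mono:
  assumes g: "grid c d M \<tau>" "c < d" and ij: "i \<le> j" "j \<le> Suc M"
  shows "half_node M \<tau> i \<le> half_node M \<tau> j"
  using ij
proof (induction j rule: dec_induct)
  case (step n)
  then show ?case using half_node_le[OF g, of n] by simp
qed simp

text \<open>The cell of \<open>x\<close> is the first one whose right end is not below \<open>x\<close>. Its node lies in the closed cell, so
  the distance from \<open>x\<close> is at most the length of the cell.\<close>

lemma grid_interp_cell:
  assumes g: "grid c d M \<tau>" "c < d" and x: "c < x" "x < d"
  shows "\<exists>i\<le>M. (\<forall>u :: real \<Rightarrow> 'b::euclidean_space. grid_interp c d M \<tau> u x = cont_ext {c<..<d} u (\<tau> i)) \<and>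
    \<tau> i \<in> {c..d} \<and> \<bar>x - \<tau> i\<bar> \<le> mesh_size M \<tau>"
proof -
  define h where "h = half_node M \<tau>"
  define i where "i = (LEAST i. x \<le> h (Suc i))"
  have ends: "h 0 = c" "h (Suc M) = d" using g by (auto simp: h_def half_node_def grid_def)
  have ex: "x \<le> h (Suc M)" using x ends by simp
  have hi: "x \<le> h (Suc i)" unfolding i_def by (rule LeastI[of _ M]) (rule ex)
  have iM: "i \<le> M" unfolding i_def by (rule Least_le) (rule ex)
  have lo: "h i < x"
  proof (cases i)
    case 0 then show ?thesis using x ends by simp
  next
    case (Suc k)
    then have "\<not> x \<le> h (Suc k)" using not_less_Least[of k "\<lambda>i. x \<le> h (Suc i)"] by (simp add: i_def)
    then show ?thesis using Suc by simp
  qed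
  have ind: "indicat_real {h j <.. h (Suc j)} x = (if j = i then 1 else 0)" if "j \<le> M" for j
  proof (cases "j = i")
    case False
    have "h (Suc j) \<le> h i" if "j < i" using that iM unfolding h_def by (intro half_node_mono[OF g]) auto
    moreover have "h (Suc i) \<le> h j" if "i < j" using that \<open>j \<le> M\<close> unfolding h_def by (intro half_node_mono[OF g]) auto
    ultimately show ?thesis using False lo hi by (cases "j < i") (auto simp: indicator_def)
  qed (use lo hi in simp)
  have "grid_interp c d M \<tau> u x = cont_ext {c<..<d} u (\<tau> i)" for u :: "real \<Rightarrow> 'b"
  proof -
    have "grid_interp c d M \<tau> u x = (\<Sum>j=0..M. (if j = i then 1 else 0) *\<^sub>R cont_ext {c<..<d} u (\<tau> j))"
      unfolding grid_interp_def h_def[symmetric] by (rule sum.cong) (auto simp: ind)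
    also have "\<dots> = (\<Sum>j=0..M. if j = i then cont_ext {c<..<d} u (\<tau> j) else 0)"
      by (rule sum.cong) auto
    finally show ?thesis using iM by simp
  qed
  moreover have "\<tau> i \<in> {c..d}"
    using grid_mono[OF g(1), of 0 i] grid_mono[OF g(1), of i M] iM g(1) by (auto simp: grid_def)
  moreover have "\<bar>x - \<tau> i\<bar> \<le> mesh_size M \<tau>"
  proof -
    have "h i \<le> \<tau> i" "\<tau> i \<le> h (Suc i)" using half_node_le[OF g iM] by (simp_all add: h_def)
    then have "\<bar>x - \<tau> i\<bar> \<le> h (Suc i) - h i" using lo hi by linarith
    also have "\<dots> \<le> mesh_size M \<tau>"
      unfolding mesh_size_def h_def using iM by (intro Max_ge) auto
    finally show ?thesis .
  qed
  ultimately show ?thesis using iM by blast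
qed

lemma grid_interp_measurable:
  fixes u :: "real \<Rightarrow> 'b::euclidean_space"
  shows "grid_interp c d M \<tau> u \<in> borel_measurable (lebesgue_on S)"
proof -
  have "(\<lambda>t. grid_interp c d M \<tau> u t) \<in> borel_measurable borel"
    unfolding grid_interp_def by (intro borel_measurable_sum borel_measurable_scaleR borel_measurable_indicator) auto
  then show ?thesis by (simp add: measurable_completion measurable_restrict_space1)
qed

lemma piecewise_const_interp_measurable:
  fixes gh :: "'t::euclidean_space \<Rightarrow> 'b::euclidean_space"
  assumes S: "S \<in> sets lebesgue" and pc: "piecewise_const_interp S \<T> g gh"
  shows "gh \<in> borel_measurable (lebesgue_on S)"
proof -
  have T: "finite \<T>" "partition_on S \<T>" "\<T> \<subseteq> sets lebesgue"
    and v: "\<forall>T\<in>\<T>. \<exists>\<xi>\<in>closure T. \<forall>t\<in>T. gh t = cont_ext S g \<xi>"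
    using pc by (auto simp: piecewise_const_interp_def)
  define v where "v T = gh (SOME t. t \<in> T)" for T
  have val: "gh x = v T" if "T \<in> \<T>" "x \<in> T" for x T
  proof -
    have "(SOME t. t \<in> T) \<in> T" using that(2) by (rule someI)
    then show ?thesis using v that unfolding v_def by metis
  qed
  have eq: "indicator S x *\<^sub>R gh x = (\<Sum>T\<in>\<T>. indicator T x *\<^sub>R v T)" for x
  proof (cases "x \<in> S")
    case True
    then obtain T where T0: "T \<in> \<T>" "x \<in> T" using T(2) by (auto simp: partition_on_def)
    have "(\<Sum>T'\<in>\<T>. indicator T' x *\<^sub>R v T') = (\<Sum>T'\<in>\<T>. if T' = T then v T else 0)"
    proof (rule sum.cong[OF refl])
      fix T' assume "T' \<in> \<T>"
      then have "x \<notin> T'" if "T' \<noteq> T"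
        using that T0 T(2) unfolding partition_on_def disjoint_def by blast
      then show "indicator T' x *\<^sub>R v T' = (if T' = T then v T else 0)" using T0 by (cases "T' = T") auto
    qed
    then show ?thesis using T0 T(1) True by (simp add: val)
  next
    case False
    then have "x \<notin> T" if "T \<in> \<T>" for T using that T(2) by (auto simp: partition_on_def)
    then show ?thesis using False by simp
  qed
  have "(\<lambda>x. \<Sum>T\<in>\<T>. indicator T x *\<^sub>R v T) \<in> borel_measurable lebesgue"
    using T(3) by (intro borel_measurable_sum borel_measurable_scaleR borel_measurable_indicator) auto
  then show ?thesis unfolding measurable_lebesgue_on_iff[OF S] eq .
qed

lemma piecewise_const_interp_bound:
  fixes g :: "'t::euclidean_space \<Rightarrow> 'b::euclidean_space"
  assumes S: "open S" "convex S" and g: "Ck_on 1 S g" "g \<in> W1 \<infinity> S" and pc: "piecewise_const_interp S \<T> g gh" and x: "x \<in> S"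
  shows "norm (gh x) \<le> Lp_norm \<infinity> S g"
proof -
  have P: "partition_on S \<T>" "\<forall>T\<in>\<T>. \<exists>\<xi>\<in>closure T. \<forall>t\<in>T. gh t = cont_ext S g \<xi>"
    using pc by (auto simp: piecewise_const_interp_def)
  obtain T where T: "T \<in> \<T>" "x \<in> T" "T \<subseteq> S" using x P(1) by (auto simp: partition_on_def)
  then obtain \<xi> where "\<xi> \<in> closure T" "gh x = cont_ext S g \<xi>" using P(2) by blast
  moreover have "closure T \<subseteq> closure S" by (rule closure_mono[OF T(3)])
  ultimately show ?thesis using cont_ext_bounds(1)[OF S g] by auto
qed

text \<open>The \<open>L\<^sup>\<infinity>\<close> norm bounds a function almost everywhere only if the function is essentially bounded;
  here this is so because the interpolant takes values bounded by those of \<open>g\<close>.\<close>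

lemma piecewise_const_interp_AE:
  fixes g :: "'t::euclidean_space \<Rightarrow> 'b::euclidean_space"
  assumes S: "open S" "convex S" and g: "Ck_on 1 S g" "g \<in> W1 \<infinity> S" and pc: "piecewise_const_interp S \<T> g gh"
    and le: "Lp_norm \<infinity> S (\<lambda>t. g t - gh t) \<le> c"
  shows "AE x in lebesgue_on S. norm (g x - gh x) \<le> c"
proof -
  note S' = open_in_lebesgue[OF S(1)]
  have "gh \<in> Lp_space \<infinity> S"
    by (rule Lp_norm_infinity_le(1)[OF piecewise_const_interp_measurable[OF S' pc] _ Lp_norm_nonneg])
      (auto intro!: AE_I2 piecewise_const_interp_bound[OF S g pc])
  then have "(\<lambda>t. g t - gh t) \<in> Lp_space \<infinity> S"
    using g(2) by (intro Lp_space_diff) (auto simp: W1_def)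
  from Lp_norm_infinity_AE[OF this] show ?thesis
    by eventually_elim (use le in linarith)
qed

lemma polyhedral_domain_open_bounded:
  assumes "polyhedral_domain S" shows "open S" "bounded S"
proof -
  obtain \<P> where P: "finite \<P>" "\<forall>P\<in>\<P>. polytope P" "S = interior (\<Union>\<P>)"
    using assms by (auto simp: polyhedral_domain_def)
  show "open S" using P(3) by simp
  have "bounded (\<Union>\<P>)" using P(1,2) by (intro bounded_Union) (auto intro: polytope_imp_bounded)
  then show "bounded S" using P(3) bounded_subset interior_subset by blast
qed

lemma support_in_box:
  fixes \<delta> :: "'a::euclidean_space \<Rightarrow> real"
  assumes "closure {x. \<delta> x \<noteq> 0} \<subseteq> ball 0 r"
  shows "\<exists>a c. \<forall>y. y \<notin> cbox a c \<longrightarrow> \<delta> y = 0"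
proof -
  obtain a where a: "ball (0::'a) r \<subseteq> cbox (- a) a"
    by (rule bounded_subset_cbox_symmetric[OF bounded_ball])
  have "{x. \<delta> x \<noteq> 0} \<subseteq> cbox (- a) a"
    by (rule subset_trans[OF closure_subset subset_trans[OF assms a]])
  then have "\<forall>y. y \<notin> cbox (- a) a \<longrightarrow> \<delta> y = 0" by auto
  then show ?thesis by (intro exI)
qed

text \<open>Separates the data from the four small quantities \<open>x\<close>, \<open>D\<close>, \<open>\<zeta>\<close> and \<open>\<zeta> powr \<alpha>\<close>.\<close>

lemma collect_terms:
  fixes m k A e B x D \<zeta> \<alpha> :: real
  assumes "m \<ge> 0" "k \<ge> 0" "A \<ge> 0" "e \<ge> 0" "B \<ge> 0" "x \<ge> 0" "D \<ge> 0" "\<zeta> \<ge> 0"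
  shows "m * (k * (A * \<zeta> + e * (B * \<zeta>) powr \<alpha> + e * x + e * D))
    \<le> (1 + m * k * (A + e * B powr \<alpha> + e)) * (x + D + \<zeta> + \<zeta> powr \<alpha>)"
proof -
  define z where "z = x + D + \<zeta> + \<zeta> powr \<alpha>"
  have z: "\<zeta> \<le> z" "\<zeta> powr \<alpha> \<le> z" "x + D \<le> z" "z \<ge> 0"
    using assms powr_ge_zero[of \<zeta> \<alpha>] unfolding z_def by linarith+
  have "A * \<zeta> + e * (B * \<zeta>) powr \<alpha> + e * x + e * D = A * \<zeta> + e * B powr \<alpha> * \<zeta> powr \<alpha> + e * (x + D)"
    using assms by (simp add: powr_mult distrib_left)
  also have "\<dots> \<le> A * z + e * B powr \<alpha> * z + e * z"
    using assms z by (intro add_mono mult_left_mono) auto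
  also have "\<dots> = (A + e * B powr \<alpha> + e) * z" by (simp add: algebra_simps)
  finally have "m * (k * (A * \<zeta> + e * (B * \<zeta>) powr \<alpha> + e * x + e * D)) \<le> m * (k * ((A + e * B powr \<alpha> + e) * z))"
    using assms by (intro mult_left_mono) auto
  also have "\<dots> \<le> 1 * z + m * (k * ((A + e * B powr \<alpha> + e) * z))" using z by simp
  also have "\<dots> = (1 + m * k * (A + e * B powr \<alpha> + e)) * z" by (simp add: algebra_simps)
  finally show ?thesis by (simp add: z_def)
qed

context conjugate_exponents
begin

text \<open>The absolute values and the summand 1 make the constant positive for all arguments.\<close>

definition total_const :: "real \<Rightarrow> real \<Rightarrow> real \<Rightarrow> real \<Rightarrow> real" where
  "total_const a b m e = 1 + \<bar>m\<bar> * (7 * embed_const) * (\<bar>a\<bar> + \<bar>e\<bar> * \<bar>b\<bar> powr \<alpha> + \<bar>e\<bar>)"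

lemma total_const_pos: "0 < total_const a b m e"
  unfolding total_const_def using embed_const_pos
  by (intro add_pos_nonneg mult_nonneg_nonneg add_nonneg_nonneg) auto

text \<open>Both dimensions are instances: only the constants \<open>A\<close> and \<open>B\<close> of the two interpolation errors differ.\<close>

lemma interpolated_force_estimate:
  fixes \<Theta> :: "'t::euclidean_space set" and F X Fh Xh :: "'t \<Rightarrow> 'a" and \<Omega> :: "'a set"
  assumes \<Omega>: "polyhedral_domain \<Omega>" and \<Theta>: "open \<Theta>" "bounded \<Theta>"
    and XF: "Ck_on 1 \<Theta> X" "X \<in> W1 \<infinity> \<Theta>" "Ck_on 1 \<Theta> F" "F \<in> W1 \<infinity> \<Theta>"
    and f: "extends_by_continuity t \<Omega> (force_on_tests \<Theta> X F) f"
    and \<delta>: "continuous_on UNIV \<delta>" "closure {x. \<delta> x \<noteq> 0} \<subseteq> ball 0 r"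
    and h: "Xh \<in> borel_measurable (lebesgue_on \<Theta>)" "Fh \<in> borel_measurable (lebesgue_on \<Theta>)"
      "\<And>\<theta>. \<theta> \<in> \<Theta> \<Longrightarrow> norm (Fh \<theta>) \<le> Lp_norm \<infinity> \<Theta> F"
    and diff: "AE \<theta> in lebesgue_on \<Theta>. norm (F \<theta> - Fh \<theta>) \<le> A * \<zeta>" "AE \<theta> in lebesgue_on \<Theta>. norm (X \<theta> - Xh \<theta>) \<le> B * \<zeta>"
    and nn: "A \<ge> 0" "B \<ge> 0" "\<zeta> \<ge> 0"
  shows "W1_dual_norm t \<Omega> (\<lambda>\<phi>. f \<phi> - functional_of \<Omega> (regularized_force \<Theta> \<delta> Xh Fh) \<phi>)
    \<le> ereal (total_const A B (measure lebesgue \<Theta>) (Lp_norm \<infinity> \<Theta> F) *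
       (\<bar>1 - (\<integral>y. \<delta> y \<partial>lebesgue)\<bar> + Lp_norm (ennreal p) UNIV (\<lambda>y. \<delta> y *\<^sub>R y) + \<zeta> + \<zeta> powr \<alpha>))"
proof -
  define m where "m = measure lebesgue \<Theta>"
  define e where "e = Lp_norm \<infinity> \<Theta> F"
  define x where "x = \<bar>1 - (\<integral>y. \<delta> y \<partial>lborel)\<bar>"
  define D where "D = Lp_norm (ennreal p) UNIV (\<lambda>y. \<delta> y *\<^sub>R y)"
  note \<Theta>' = open_in_lebesgue[OF \<Theta>(1)]
  have R: "regularization \<Theta> \<delta> Xh Fh e"
  proof
    show "\<Theta> \<in> lmeasurable" by (rule bounded_set_imp_lmeasurable[OF \<Theta>(2) \<Theta>'])
    show "\<exists>a c. \<forall>y. y \<notin> cbox a c \<longrightarrow> \<delta> y = 0" by (rule support_in_box[OF \<delta>(2)])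
  qed (use \<delta>(1) h in \<open>auto simp: e_def Lp_norm_nonneg\<close>)
  have meas: "X \<in> borel_measurable (lebesgue_on \<Theta>)" "F \<in> borel_measurable (lebesgue_on \<Theta>)"
    using XF by (auto simp: W1_def Lp_space_def)
  have int: "(\<integral>y. \<delta> y \<partial>lebesgue) = (\<integral>y. \<delta> y \<partial>lborel)"
    using borel_measurable_continuous_onI[OF \<delta>(1)] by (simp add: integral_completion)
  have "W1_dual_norm t \<Omega> (\<lambda>\<phi>. f \<phi> - functional_of \<Omega> (regularized_force \<Theta> \<delta> Xh Fh) \<phi>)
    \<le> ereal (m * (7 * embed_const * (A * \<zeta> + e * (B * \<zeta>) powr \<alpha> + e * x + e * D)))"
    unfolding m_def x_def D_def
  proof (rule dual_norm_estimate[OF R polyhedral_domain_open_bounded[OF \<Omega>] meas _ diff _ _ f])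
    show "norm (F \<theta>) \<le> e" if "\<theta> \<in> \<Theta>" for \<theta>
      unfolding e_def by (rule W1_infinity_bounds(1)[OF \<Theta>(1) XF(3,4) that])
  qed (use nn in auto)
  also have "\<dots> \<le> ereal ((1 + m * (7 * embed_const) * (A + e * B powr \<alpha> + e)) * (x + D + \<zeta> + \<zeta> powr \<alpha>))"
    unfolding ereal_less_eq(3) using nn embed_const_pos
    by (intro collect_terms) (auto simp: m_def e_def x_def D_def Lp_norm_nonneg)
  also have "1 + m * (7 * embed_const) * (A + e * B powr \<alpha> + e) = total_const A B m e"
    using nn by (simp add: total_const_def m_def e_def Lp_norm_nonneg)
  finally show ?thesis by (simp add: m_def e_def x_def D_def int)
qed

end

theorem proposition18:
  fixes p :: real and p' :: ennreal
  assumes p: "1 \<le> p" and p': "1 / ennreal p + 1 / p' = 1"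
  shows
    "(p < 2 / (2 - 1) \<longrightarrow>
      (\<exists>C :: real \<Rightarrow> real \<Rightarrow> real \<Rightarrow> real \<Rightarrow> real \<Rightarrow> real.
        (\<forall>j a b m e. 0 < C j a b m e) \<and>
        (\<forall>(\<Omega> :: (real^2) set) c d (\<Theta> :: real set) (X :: real \<Rightarrow> real^2) (F :: real \<Rightarrow> real^2) f
           \<epsilon> K (\<delta> :: real^2 \<Rightarrow> real) M \<tau> \<zeta>.
          polyhedral_domain \<Omega> \<and> c < d \<and> \<Theta> = {c<..<d} \<and>
          Ck_on 1 \<Theta> X \<and> X \<in> W1 \<infinity> \<Theta> \<and> (\<forall>t\<in>\<Theta>. jacobian2 X t \<noteq> 0) \<and>
          simple_closed_curve (immersed_set \<Theta> X) \<and> divides_domain (immersed_set \<Theta> X) \<Omega> \<and>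
          Ck_on 1 \<Theta> F \<and> F \<in> W1 \<infinity> \<Theta> \<and>
          extends_by_continuity p' \<Omega> (force_on_tests \<Theta> X F) f \<and>
          0 < \<epsilon> \<and> 0 < K \<and> continuous_on UNIV \<delta> \<and> closure {x. \<delta> x \<noteq> 0} \<subseteq> ball 0 (K * \<epsilon>) \<and>
          grid c d M \<tau> \<and> \<zeta> = mesh_size M \<tau>
          \<longrightarrow>
          W1_dual_norm p' \<Omega> (\<lambda>\<phi>. f \<phi> - functional_of \<Omega>
              (regularized_force \<Theta> \<delta> (grid_interp c d M \<tau> X) (grid_interp c d M \<tau> F)) \<phi>)
          \<le> ereal (C (Lp_norm \<infinity> \<Theta> (jacobian2 X)) (W1_seminorm \<infinity> \<Theta> F) (W1_seminorm \<infinity> \<Theta> X)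
                     (measure lebesgue \<Theta>) (Lp_norm \<infinity> \<Theta> F)
              * (\<bar>1 - (\<integral>y. \<delta> y \<partial>lebesgue)\<bar> + Lp_norm (ennreal p) UNIV (\<lambda>y. \<delta> y *\<^sub>R y)
                 + \<zeta> + \<zeta> powr (1 - 2 + 2 / p))))))
     \<and>
     (p < 3 / (3 - 1) \<longrightarrow>
      (\<exists>C :: real \<Rightarrow> real \<Rightarrow> real \<Rightarrow> real \<Rightarrow> real \<Rightarrow> real \<Rightarrow> real.
        (\<forall>j a b m e C'. 0 < C j a b m e C') \<and>
        (\<forall>(\<Omega> :: (real^3) set) c\<^sub>1 d\<^sub>1 c\<^sub>2 d\<^sub>2 (\<Theta> :: (real \<times> real) set)
           (X :: real \<times> real \<Rightarrow> real^3) (F :: real \<times> real \<Rightarrow> real^3) f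
           \<epsilon> K (\<delta> :: real^3 \<Rightarrow> real) \<T> Xh Fh \<zeta> C'.
          polyhedral_domain \<Omega> \<and> c\<^sub>1 < d\<^sub>1 \<and> c\<^sub>2 < d\<^sub>2 \<and> \<Theta> = {c\<^sub>1<..<d\<^sub>1} \<times> {c\<^sub>2<..<d\<^sub>2} \<and>
          Ck_on 1 \<Theta> X \<and> X \<in> W1 \<infinity> \<Theta> \<and> (\<forall>t\<in>\<Theta>. jacobian3 X t \<noteq> 0) \<and>
          simple_closed_surface (immersed_set \<Theta> X) \<and> divides_domain (immersed_set \<Theta> X) \<Omega> \<and>
          Ck_on 1 \<Theta> F \<and> F \<in> W1 \<infinity> \<Theta> \<and>
          extends_by_continuity p' \<Omega> (force_on_tests \<Theta> X F) f \<and>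
          0 < \<epsilon> \<and> 0 < K \<and> continuous_on UNIV \<delta> \<and> closure {x. \<delta> x \<noteq> 0} \<subseteq> ball 0 (K * \<epsilon>) \<and>
          0 < \<zeta> \<and> 0 < C' \<and>
          piecewise_const_interp \<Theta> \<T> X Xh \<and> piecewise_const_interp \<Theta> \<T> F Fh \<and>
          Lp_norm \<infinity> \<Theta> (\<lambda>t. F t - Fh t) \<le> C' * \<zeta> * W1_seminorm \<infinity> \<Theta> F \<and>
          Lp_norm \<infinity> \<Theta> (\<lambda>t. X t - Xh t) \<le> C' * \<zeta> * W1_seminorm \<infinity> \<Theta> X
          \<longrightarrow>
          W1_dual_norm p' \<Omega> (\<lambda>\<phi>. f \<phi> - functional_of \<Omega> (regularized_force \<Theta> \<delta> Xh Fh) \<phi>)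
          \<le> ereal (C (Lp_norm \<infinity> \<Theta> (jacobian3 X)) (W1_seminorm \<infinity> \<Theta> F) (W1_seminorm \<infinity> \<Theta> X)
                     (measure lebesgue \<Theta>) (Lp_norm \<infinity> \<Theta> F) C'
              * (\<bar>1 - (\<integral>y. \<delta> y \<partial>lebesgue)\<bar> + Lp_norm (ennreal p) UNIV (\<lambda>y. \<delta> y *\<^sub>R y)
                 + \<zeta> + \<zeta> powr (1 - 3 + 3 / p))))))" (is "(_ \<longrightarrow> ?A2) \<and> (_ \<longrightarrow> ?A3)")
proof (intro conjI impI)
  assume "p < 2 / (2 - 1)"
  then interpret E: conjugate_exponents p p' "TYPE(real^2)"
    using p p' by unfold_locales auto
  have \<alpha>: "E.\<alpha> = 1 - 2 + 2 / p" by (simp add: E.\<alpha>_def)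
  show ?A2
  proof (rule exI[of _ "\<lambda>j a b m e. E.total_const a b m e"], intro conjI allI impI)
    show "0 < E.total_const a b m e" for a b m e by (rule E.total_const_pos)
  next
    fix \<Omega> :: "(real^2) set" and c d \<Theta> and X F :: "real \<Rightarrow> real^2" and f \<epsilon> K and \<delta> :: "real^2 \<Rightarrow> real" and M \<tau> \<zeta>
    assume "polyhedral_domain \<Omega> \<and> c < d \<and> \<Theta> = {c<..<d} \<and>
          Ck_on 1 \<Theta> X \<and> X \<in> W1 \<infinity> \<Theta> \<and> (\<forall>t\<in>\<Theta>. jacobian2 X t \<noteq> 0) \<and>
          simple_closed_curve (immersed_set \<Theta> X) \<and> divides_domain (immersed_set \<Theta> X) \<Omega> \<and>
          Ck_on 1 \<Theta> F \<and> F \<in> W1 \<infinity> \<Theta> \<and>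
          extends_by_continuity p' \<Omega> (force_on_tests \<Theta> X F) f \<and>
          0 < \<epsilon> \<and> 0 < K \<and> continuous_on UNIV \<delta> \<and> closure {x. \<delta> x \<noteq> 0} \<subseteq> ball 0 (K * \<epsilon>) \<and>
          grid c d M \<tau> \<and> \<zeta> = mesh_size M \<tau>"
    then have \<Omega>: "polyhedral_domain \<Omega>" and cd: "c < d" and \<Theta>: "\<Theta> = {c<..<d}"
      and XF: "Ck_on 1 \<Theta> X" "X \<in> W1 \<infinity> \<Theta>" "Ck_on 1 \<Theta> F" "F \<in> W1 \<infinity> \<Theta>"
      and f: "extends_by_continuity p' \<Omega> (force_on_tests \<Theta> X F) f"
      and \<delta>: "continuous_on UNIV \<delta>" "closure {x. \<delta> x \<noteq> 0} \<subseteq> ball 0 (K * \<epsilon>)"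
      and g: "grid c d M \<tau>" and \<zeta>: "\<zeta> = mesh_size M \<tau>"
      by auto
    have \<Theta>_props: "open \<Theta>" "convex \<Theta>" "bounded \<Theta>" "closure \<Theta> = {c..d}" using cd by (auto simp: \<Theta>)
    have semi: "0 \<le> W1_seminorm \<infinity> \<Theta> u" for u :: "real \<Rightarrow> real^2"
      by (simp add: W1_seminorm_def sum_nonneg Lp_norm_nonneg)
    have cell: "norm (u x - grid_interp c d M \<tau> u x) \<le> W1_seminorm \<infinity> \<Theta> u * \<zeta> \<and> norm (grid_interp c d M \<tau> u x) \<le> Lp_norm \<infinity> \<Theta> u \<and> 0 \<le> \<zeta>"
      if x: "x \<in> \<Theta>" and u: "Ck_on 1 \<Theta> u" "u \<in> W1 \<infinity> \<Theta>" for x and u :: "real \<Rightarrow> real^2"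
    proof -
      obtain i where i: "grid_interp c d M \<tau> u x = cont_ext \<Theta> u (\<tau> i)" "\<tau> i \<in> closure \<Theta>" "\<bar>x - \<tau> i\<bar> \<le> \<zeta>"
        using grid_interp_cell[OF g cd, of x, where 'b = "real^2"] x unfolding \<zeta> \<Theta>_props(4) by (auto simp: \<Theta>)
      have "norm (u x - cont_ext \<Theta> u (\<tau> i)) \<le> W1_seminorm \<infinity> \<Theta> u * norm (x - \<tau> i)"
        by (rule cont_ext_bounds(2)[OF \<Theta>_props(1,2) u i(2) x])
      also have "\<dots> \<le> W1_seminorm \<infinity> \<Theta> u * \<zeta>" using i(3) semi by (intro mult_left_mono) auto
      finally show ?thesis
        using cont_ext_bounds(1)[OF \<Theta>_props(1,2) u i(2)] i by simp
    qed
    have \<zeta>0: "\<zeta> \<ge> 0" using cell[of "(c + d) / 2", OF _ XF(3,4)] cd by (simp add: \<Theta>)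
    show "W1_dual_norm p' \<Omega> (\<lambda>\<phi>. f \<phi> - functional_of \<Omega>
              (regularized_force \<Theta> \<delta> (grid_interp c d M \<tau> X) (grid_interp c d M \<tau> F)) \<phi>)
          \<le> ereal (E.total_const (W1_seminorm \<infinity> \<Theta> F) (W1_seminorm \<infinity> \<Theta> X) (measure lebesgue \<Theta>) (Lp_norm \<infinity> \<Theta> F)
              * (\<bar>1 - (\<integral>y. \<delta> y \<partial>lebesgue)\<bar> + Lp_norm (ennreal p) UNIV (\<lambda>y. \<delta> y *\<^sub>R y)
                 + \<zeta> + \<zeta> powr (1 - 2 + 2 / p)))"
      unfolding \<alpha>[symmetric]
      by (rule E.interpolated_force_estimate[OF \<Omega> \<Theta>_props(1,3) XF f \<delta> grid_interp_measurable grid_interp_measurable])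
        (use cell XF semi \<zeta>0 in \<open>auto intro!: AE_I2\<close>)
  qed
next
  assume "p < 3 / (3 - 1)"
  then interpret E: conjugate_exponents p p' "TYPE(real^3)"
    using p p' by unfold_locales auto
  have \<alpha>: "E.\<alpha> = 1 - 3 + 3 / p" by (simp add: E.\<alpha>_def)
  show ?A3
  proof (rule exI[of _ "\<lambda>j a b m e C'. E.total_const (C' * a) (C' * b) m e"], intro conjI allI impI)
    show "0 < E.total_const (C' * a) (C' * b) m e" for a b m e C' by (rule E.total_const_pos)
  next
    fix \<Omega> :: "(real^3) set" and c\<^sub>1 d\<^sub>1 c\<^sub>2 d\<^sub>2 and \<Theta> :: "(real \<times> real) set"
      and X F :: "real \<times> real \<Rightarrow> real^3" and f \<epsilon> K and \<delta> :: "real^3 \<Rightarrow> real" and \<T> Xh Fh \<zeta> C'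
    assume "polyhedral_domain \<Omega> \<and> c\<^sub>1 < d\<^sub>1 \<and> c\<^sub>2 < d\<^sub>2 \<and> \<Theta> = {c\<^sub>1<..<d\<^sub>1} \<times> {c\<^sub>2<..<d\<^sub>2} \<and>
          Ck_on 1 \<Theta> X \<and> X \<in> W1 \<infinity> \<Theta> \<and> (\<forall>t\<in>\<Theta>. jacobian3 X t \<noteq> 0) \<and>
          simple_closed_surface (immersed_set \<Theta> X) \<and> divides_domain (immersed_set \<Theta> X) \<Omega> \<and>
          Ck_on 1 \<Theta> F \<and> F \<in> W1 \<infinity> \<Theta> \<and>
          extends_by_continuity p' \<Omega> (force_on_tests \<Theta> X F) f \<and>
          0 < \<epsilon> \<and> 0 < K \<and> continuous_on UNIV \<delta> \<and> closure {x. \<delta> x \<noteq> 0} \<subseteq> ball 0 (K * \<epsilon>) \<and>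
          0 < \<zeta> \<and> 0 < C' \<and>
          piecewise_const_interp \<Theta> \<T> X Xh \<and> piecewise_const_interp \<Theta> \<T> F Fh \<and>
          Lp_norm \<infinity> \<Theta> (\<lambda>t. F t - Fh t) \<le> C' * \<zeta> * W1_seminorm \<infinity> \<Theta> F \<and>
          Lp_norm \<infinity> \<Theta> (\<lambda>t. X t - Xh t) \<le> C' * \<zeta> * W1_seminorm \<infinity> \<Theta> X"
    then have \<Omega>: "polyhedral_domain \<Omega>" and \<Theta>: "\<Theta> = {c\<^sub>1<..<d\<^sub>1} \<times> {c\<^sub>2<..<d\<^sub>2}"
      and XF: "Ck_on 1 \<Theta> X" "X \<in> W1 \<infinity> \<Theta>" "Ck_on 1 \<Theta> F" "F \<in> W1 \<infinity> \<Theta>"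
      and f: "extends_by_continuity p' \<Omega> (force_on_tests \<Theta> X F) f"
      and \<delta>: "continuous_on UNIV \<delta>" "closure {x. \<delta> x \<noteq> 0} \<subseteq> ball 0 (K * \<epsilon>)"
      and pos: "0 < \<zeta>" "0 < C'"
      and pc: "piecewise_const_interp \<Theta> \<T> X Xh" "piecewise_const_interp \<Theta> \<T> F Fh"
      and le: "Lp_norm \<infinity> \<Theta> (\<lambda>t. F t - Fh t) \<le> C' * W1_seminorm \<infinity> \<Theta> F * \<zeta>"
        "Lp_norm \<infinity> \<Theta> (\<lambda>t. X t - Xh t) \<le> C' * W1_seminorm \<infinity> \<Theta> X * \<zeta>"
      by (auto simp: mult_ac)
    have \<Theta>_props: "open \<Theta>" "convex \<Theta>" "bounded \<Theta>"
      unfolding \<Theta> by (auto intro: open_Times convex_Times bounded_Times)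
    note \<Theta>' = open_in_lebesgue[OF \<Theta>_props(1)]
    have semi: "0 \<le> W1_seminorm \<infinity> \<Theta> u" for u :: "real \<times> real \<Rightarrow> real^3"
      by (simp add: W1_seminorm_def sum_nonneg Lp_norm_nonneg)
    show "W1_dual_norm p' \<Omega> (\<lambda>\<phi>. f \<phi> - functional_of \<Omega> (regularized_force \<Theta> \<delta> Xh Fh) \<phi>)
          \<le> ereal (E.total_const (C' * W1_seminorm \<infinity> \<Theta> F) (C' * W1_seminorm \<infinity> \<Theta> X) (measure lebesgue \<Theta>) (Lp_norm \<infinity> \<Theta> F)
              * (\<bar>1 - (\<integral>y. \<delta> y \<partial>lebesgue)\<bar> + Lp_norm (ennreal p) UNIV (\<lambda>y. \<delta> y *\<^sub>R y)
                 + \<zeta> + \<zeta> powr (1 - 3 + 3 / p)))"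
      unfolding \<alpha>[symmetric]
    proof (rule E.interpolated_force_estimate[OF \<Omega> \<Theta>_props(1,3) XF f \<delta>
          piecewise_const_interp_measurable[OF \<Theta>' pc(1)] piecewise_const_interp_measurable[OF \<Theta>' pc(2)]])
      show "norm (Fh \<theta>) \<le> Lp_norm \<infinity> \<Theta> F" if "\<theta> \<in> \<Theta>" for \<theta>
        by (rule piecewise_const_interp_bound[OF \<Theta>_props(1,2) XF(3,4) pc(2) that])
      show "AE \<theta> in lebesgue_on \<Theta>. norm (F \<theta> - Fh \<theta>) \<le> C' * W1_seminorm \<infinity> \<Theta> F * \<zeta>"
        by (rule piecewise_const_interp_AE[OF \<Theta>_props(1,2) XF(3,4) pc(2) le(1)])
      show "AE \<theta> in lebesgue_on \<Theta>. norm (X \<theta> - Xh \<theta>) \<le> C' * W1_seminorm \<infinity> \<Theta> X * \<zeta>"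
        by (rule piecewise_const_interp_AE[OF \<Theta>_props(1,2) XF(1,2) pc(1) le(2)])
    qed (use semi pos in auto)
  qed
qed

end
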